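(* Let $n\ge1$ be an integer and let $s\ge 0$ be a real number. Let $\mu$ be a Radon measure on $(\mathbb{R}^{n+1},d)$ such that $\lim_{r\to0}r^{-s}\mu(B_d(x,r))$ exists and is finite and positive for all $x$ in a set of positive $\mu$ measure. Then $s$ is an integer.
   Context: Points of $\mathbb{R}^{n+1}=\mathbb{R}^n\times\mathbb{R}$ are written $(x',t)$ with $x'\in\mathbb{R}^n$, $t\in\mathbb{R}$. The metric $d$ on $\mathbb{R}^{n+1}$ is $d((x',t),(y',u))=(|x'-y'|^4+(t-u)^2)^{1/4}$, where $|\cdot|$ is the Euclidean norm on $\mathbb{R}^n$. $B_d(x,r)$ denotes the closed ball with center $x$ and radius $r$ with respect to $d$. *)

theory Defs
  imports "HOL-Analysis.Analysis"
begin

definition pdist :: "(real ^ 'n) \<times> real \<Rightarrow> (real ^ 'n) \<times> real \<Rightarrow> real" where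
  "pdist x y = root 4 (norm (fst x - fst y) ^ 4 + (snd x - snd y)\<^sup>2)"

definition pcball :: "(real ^ 'n) \<times> real \<Rightarrow> real \<Rightarrow> ((real ^ 'n) \<times> real) set" where
  "pcball x r = {y. pdist x y \<le> r}"

text \<open>Regularity is required with respect to the given topology \<open>T\<close>. Compact sets are meant to be
  measurable, which is automatic for Hausdorff \<open>T\<close>.\<close>
definition radon_measure :: "'a topology \<Rightarrow> 'a measure \<Rightarrow> bool" where
  "radon_measure T \<mu> \<longleftrightarrow>
     space \<mu> = topspace T \<and>
     sets \<mu> = sigma_sets (topspace T) {U. openin T U} \<and>
     (\<forall>K. compactin T K \<longrightarrow> emeasure \<mu> K < \<infinity>) \<and>
     (\<forall>U. openin T U \<longrightarrow>
        emeasure \<mu> U = (SUP K\<in>{K. compactin T K \<and> K \<subseteq> U}. emeasure \<mu> K)) \<and>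
     (\<forall>A\<in>sets \<mu>.
        emeasure \<mu> A = (INF U\<in>{U. openin T U \<and> A \<subseteq> U}. emeasure \<mu> U))"

lemma pdist_eq_sqrt_norm: "pdist x y = sqrt (norm ((norm (fst x - fst y))\<^sup>2, snd x - snd y))"
proof -
  have "root 4 z = sqrt (sqrt z)" for z
    using real_root_mult_exp[of 2 2 z] by (simp add: sqrt_def)
  then show ?thesis
    by (simp add: pdist_def norm_Pair)
qed

lemma pdist_bounds:
  "norm (fst x - fst y) \<le> pdist x y" "\<bar>snd x - snd y\<bar> \<le> (pdist x y)\<^sup>2"
proof -
  have "sqrt ((norm (fst x - fst y))\<^sup>2) \<le> pdist x y"
    unfolding pdist_eq_sqrt_norm
    using norm_fst_le[of "(norm (fst x - fst y))\<^sup>2" "snd x - snd y"] by (intro real_sqrt_le_mono) simp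
  then show "norm (fst x - fst y) \<le> pdist x y" by simp
  show "\<bar>snd x - snd y\<bar> \<le> (pdist x y)\<^sup>2"
    using norm_snd_le[of "snd x - snd y" "(norm (fst x - fst y))\<^sup>2"]
    by (simp add: pdist_eq_sqrt_norm)
qed

lemma pdist_triangle: "pdist x z \<le> pdist x y + pdist y z"
proof -
  define a b c t u where "a = norm (fst x - fst y)" and "b = norm (fst y - fst z)"
    and "c = norm (fst x - fst z)" and "t = snd x - snd y" and "u = snd y - snd z"
  have nn: "0 \<le> a" "0 \<le> b" "0 \<le> c" "0 \<le> pdist x y" "0 \<le> pdist y z"
    by (auto simp: a_def b_def c_def pdist_eq_sqrt_norm)
  have "c \<le> a + b"
    unfolding a_def b_def c_def using norm_triangle_ineq[of "fst x - fst y" "fst y - fst z"] by simp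
  then have "c\<^sup>2 \<le> (a + b)\<^sup>2" using nn by (intro power_mono)
  then have "norm (c\<^sup>2, t + u) \<le> norm ((a + b)\<^sup>2, t + u)"
    unfolding norm_Pair real_norm_def power2_abs
    by (intro real_sqrt_le_mono add_right_mono power_mono[of "c\<^sup>2"]) auto
  also have "((a + b)\<^sup>2, t + u) = (a\<^sup>2, t) + (b\<^sup>2, u) + (2 * a * b, 0)"
    by (simp add: power2_sum)
  also have "norm \<dots> \<le> norm (a\<^sup>2, t) + norm (b\<^sup>2, u) + norm (2 * a * b, 0::real)"
    using norm_triangle_ineq[of "(a\<^sup>2, t)" "(b\<^sup>2, u)"]
      norm_triangle_ineq[of "(a\<^sup>2, t) + (b\<^sup>2, u)" "(2 * a * b, 0)"] by linarith
  also have "\<dots> = (pdist x y)\<^sup>2 + (pdist y z)\<^sup>2 + 2 * (a * b)"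
    using nn by (simp add: pdist_eq_sqrt_norm a_def b_def t_def u_def norm_Pair)
  also have "a * b \<le> pdist x y * pdist y z"
    using nn pdist_bounds(1)[of x y] pdist_bounds(1)[of y z]
    by (intro mult_mono) (auto simp: a_def b_def)
  finally have "norm (c\<^sup>2, t + u) \<le> (pdist x y + pdist y z)\<^sup>2"
    by (simp add: power2_sum)
  then show ?thesis
    using nn by (simp add: pdist_eq_sqrt_norm[of x z] c_def t_def u_def real_le_lsqrt)
qed

lemma Metric_space_pdist: "Metric_space UNIV pdist"
proof
  show "0 \<le> pdist x y" for x y :: "(real ^ 'n) \<times> real" by (simp add: pdist_eq_sqrt_norm)
  show "pdist x y = pdist y x" for x y :: "(real ^ 'n) \<times> real"
    by (simp add: pdist_def norm_minus_commute power2_commute)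
  show "pdist x y = 0 \<longleftrightarrow> x = y" for x y :: "(real ^ 'n) \<times> real"
    by (auto simp: pdist_eq_sqrt_norm prod_eq_iff)
  show "pdist x z \<le> pdist x y + pdist y z" for x y z :: "(real ^ 'n) \<times> real"
    by (rule pdist_triangle)
qed

lemma mtopology_pdist: "Metric_space.mtopology UNIV pdist = (euclidean :: ((real ^ 'n) \<times> real) topology)"
proof -
  interpret P: Metric_space "UNIV :: ((real ^ 'n) \<times> real) set" pdist
    by (rule Metric_space_pdist)
  have "openin P.mtopology S \<longleftrightarrow> open S" for S :: "((real ^ 'n) \<times> real) set"
  proof
    assume L: "openin P.mtopology S"
    show "open S"
    proof (subst open_subopen, intro ballI)
      fix x assume "x \<in> S"
      then obtain r where r: "r > 0" "P.mball x r \<subseteq> S"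
        using L unfolding P.openin_mtopology by blast
      have "P.mball x r = {y. pdist x y < r}" by auto
      moreover have "open {y. pdist x y < r}"
        unfolding pdist_eq_sqrt_norm by (intro open_Collect_less continuous_intros)
      ultimately show "\<exists>T. open T \<and> x \<in> T \<and> T \<subseteq> S"
        using r by (metis P.centre_in_mball_iff UNIV_I)
    qed
  next
    assume R: "open S"
    show "openin P.mtopology S"
      unfolding P.openin_mtopology
    proof (intro conjI allI impI)
      fix x assume "x \<in> S"
      then obtain e where e: "e > 0" "ball x e \<subseteq> S"
        using R by (meson openE)
      define r where "r = min 1 (e / 2)"
      have r: "0 < r" "r \<le> 1" "2 * r \<le> e" using e by (auto simp: r_def)
      have "P.mball x r \<subseteq> ball x e"
      proof
        fix y assume "y \<in> P.mball x r"
        then have y: "pdist x y < r" by simp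
        have "(pdist x y)\<^sup>2 \<le> r * 1"
          unfolding power2_eq_square using y r(1,2) P.nonneg[of x y] by (intro mult_mono) linarith+
        then have "norm (fst x - fst y) + \<bar>snd x - snd y\<bar> < 2 * r"
          using y pdist_bounds[of x y] by linarith
        moreover have "dist x y \<le> norm (fst x - fst y) + \<bar>snd x - snd y\<bar>"
          using sqrt_sum_squares_le_sum[of "norm (fst x - fst y)" "\<bar>snd x - snd y\<bar>"]
          by (simp add: dist_prod_def dist_norm)
        ultimately show "y \<in> ball x e" using r by simp
      qed
      then show "\<exists>r>0. P.mball x r \<subseteq> S" using e r by blast
    qed simp
  qed
  then show ?thesis by (simp add: topology_eq)
qed

end

theory Submission
  imports Defs
begin

text \<open>
  Blow-ups of \<open>\<mu>\<close> at points of density, rescaled by the dilations \<open>(x, t) \<mapsto> (r x, r\<^sup>2 t)\<close>, have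
  limits that are \<open>s\<close>-uniform: every ball of radius \<open>r\<close> centred on the support has mass proportional
  to \<open>r\<^sup>s\<close>. Since only weak limits are needed, measures are replaced by positive linear
  functionals on compactly supported continuous functions, and uniformity is tested on one radial
  bump function.

  Among all homogeneous subgroups \<open>V \<times> \<real>\<close> and \<open>V \<times> {0}\<close> that contain the support of some \<open>s\<close>-uniform
  functional choose a minimal one. If the support is not everything, blow up at a point where a ball
  that misses the support touches it; the tangent functional lives in a half space
  \<open>{a \<bullet> x \<le> 0}\<close> or \<open>{\<tau> t \<le> 0}\<close>. Uniformity makes the integral of a bump function independent
  of its centre \<open>x\<close> in the support. Its first order Taylor term at \<open>0\<close> is a linear form that must
  vanish on \<open>V\<close> by minimality, which in the horizontal case forces the support into the
  boundary of the half space. In the vertical case the second order term confines the support, after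
  one more blow-up, to a graph \<open>t = p(x)\<close> of a quadratic form; its tangents at \<open>(x, p(x))\<close> lie in
  the kernel of the derivative of \<open>p\<close> at \<open>x\<close>, so by minimality \<open>p\<close> vanishes on the support.
  Hence the support is the whole subgroup, and counting lattice points shows that \<open>s\<close> is its
  homogeneous dimension.
\<close>

section \<open>Limits along ultrafilters\<close>

text \<open>The obstacle is that \<open>t\<close> has degree two. On the support, Taylor's formula
  bounds a linear form in \<open>x\<close> only by quadratic terms, and the height enters together
  with the quadratic form; neither relation is exact. A blow-up at \<open>0\<close> removes the
  higher order error, so each use of the moments costs one tangent. This is harmless because
  minimality ranges over all \<open>s\<close>-uniform functionals inside the subgroup, and tangents
  stay inside it: a nonzero linear form vanishing on the support of any of them would cut out a
  smaller subgroup. Where the empty ball is touched straight above or below its centre, the half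
  space only restricts the sign of \<open>t\<close>. Then a vanishing vertical moment forces
  \<open>t = 0\<close>, whereas a nonvanishing one lets \<open>t\<close> be solved for by the
  quadratic form. For the measure itself, the density may vary from point to point. The uniform
  functional is therefore a limit over a sequence of compact sets, base points and scales with
  improving tolerance, rather than a blow-up at one fixed point.\<close>

lemma ultrafilter_like:
  fixes F :: "'i filter"
  assumes "F \<noteq> bot"
  obtains G where "G \<le> F" "G \<noteq> bot"
    "\<And>h :: 'i \<Rightarrow> real. Bfun h F \<Longrightarrow> (h \<longlongrightarrow> Lim G h) G"
proof -
  \<comment> \<open>\<open>C h\<close> is some eventual bound of \<open>h\<close> along
    \<open>F\<close>, arbitrary if there is none. Truncating at \<open>\<bar>C h\<bar>\<close> puts
    every \<open>L i\<close> into one product of compact intervals; for bounded \<open>h\<close> the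
    truncation is eventually the identity.\<close>
  define C :: "('i \<Rightarrow> real) \<Rightarrow> real" where
    "C h = (SOME c. eventually (\<lambda>i. \<bar>h i\<bar> \<le> c) F)" for h
  define L :: "'i \<Rightarrow> ('i \<Rightarrow> real) \<Rightarrow> real" where
    "L i h = max (- \<bar>C h\<bar>) (min \<bar>C h\<bar> (h i))" for i h
  define K where "K = (PiE UNIV (\<lambda>h. {- \<bar>C h\<bar> .. \<bar>C h\<bar>}))"
  have "compactin (product_topology (\<lambda>_. euclidean) UNIV) K"
    unfolding K_def compactin_PiE by (simp add: compactin_euclidean_iff)
  then have "compact K"
    by (simp add: euclidean_product_topology compactin_euclidean_iff)
  moreover have "filtermap L F \<noteq> bot" using assms by (simp add: filtermap_bot_iff)
  moreover have "eventually (\<lambda>l. l \<in> K) (filtermap L F)"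
    by (auto simp: eventually_filtermap K_def L_def intro!: always_eventually)
  \<comment> \<open>A cluster point exists by Tychonoff. The filter \<open>G\<close> of indices sent
    close to \<open>l\<close> makes all bounded functions converge at once, which replaces diagonal
    subsequences.\<close>
  ultimately obtain l where l: "inf (nhds l) (filtermap L F) \<noteq> bot"
    unfolding compact_filter by blast
  define G where "G = inf F (filtercomap L (nhds l))"
  have "G \<noteq> bot"
  proof
    assume "G = bot"
    then have "eventually (\<lambda>_. False) (inf F (filtercomap L (nhds l)))" by (simp add: G_def)
    then obtain P Q where P: "eventually P F" and Q: "eventually Q (filtercomap L (nhds l))"
      and PQ: "\<And>i. P i \<Longrightarrow> Q i \<Longrightarrow> False"
      unfolding eventually_inf by blast
    from Q obtain T where T: "eventually T (nhds l)" "\<And>i. T (L i) \<Longrightarrow> Q i"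
      unfolding eventually_filtercomap by blast
    have "eventually (\<lambda>x. \<not> T x) (filtermap L F)"
      unfolding eventually_filtermap using P by eventually_elim (use PQ T in blast)
    with T(1) have "eventually (\<lambda>_. False) (inf (nhds l) (filtermap L F))"
      unfolding eventually_inf by blast
    with l show False by (simp add: eventually_False)
  qed
  moreover have "G \<le> F" by (simp add: G_def)
  moreover have "(h \<longlongrightarrow> Lim G h) G" if "Bfun h F" for h :: "'i \<Rightarrow> real"
  proof -
    have "\<exists>c. eventually (\<lambda>i. \<bar>h i\<bar> \<le> c) F"
      using that unfolding Bfun_def by auto
    then have "eventually (\<lambda>i. \<bar>h i\<bar> \<le> C h) F"
      unfolding C_def by (rule someI_ex)
    then have ev: "eventually (\<lambda>i. L i h = h i) G"
      by (rule eventually_mono[OF filter_leD[OF \<open>G \<le> F\<close>]]) (auto simp: L_def)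
    have lim: "filterlim L (nhds l) G"
      by (rule filterlim_mono[OF filterlim_filtercomap[of L "nhds l"]]) (auto simp: G_def)
    have "((\<lambda>i. L i h) \<longlongrightarrow> l h) G"
    proof (rule topological_tendstoI)
      fix S :: "real set" assume S: "open S" "l h \<in> S"
      have "open ((\<lambda>f. f h) -` S)"
        using continuous_on_product_coordinates[of h] S(1)
        by (metis open_vimage)
      then have "eventually (\<lambda>f. f \<in> (\<lambda>f. f h) -` S) (nhds l)"
        using S by (intro eventually_nhds_in_open) auto
      from eventually_compose_filterlim[OF this lim]
      show "eventually (\<lambda>i. L i h \<in> S) G" by simp
    qed
    then have "(h \<longlongrightarrow> l h) G" using ev by (rule Lim_transform_eventually)
    with tendsto_Lim[OF \<open>G \<noteq> bot\<close> this] show ?thesis by simp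
  qed
  ultimately show ?thesis using that by blast
qed

section \<open>Parabolic space and positive functionals\<close>

type_synonym 'n par = "(real ^ 'n) \<times> real"

section \<open>Gauge norm, dilations and compactness of gauge balls\<close>

definition gnorm :: "'n::finite par \<Rightarrow> real" where
  "gnorm z = root 4 (norm (fst z) ^ 4 + (snd z)\<^sup>2)"

definition dil :: "real \<Rightarrow> 'n::finite par \<Rightarrow> 'n par" where
  "dil r z = (r *\<^sub>R fst z, r\<^sup>2 * snd z)"

lemma pdist_gnorm: "pdist x y = gnorm (y - x)"
  by (simp add: pdist_def gnorm_def norm_minus_commute power2_commute)

lemma pcball_gnorm: "pcball x r = {y. gnorm (y - x) \<le> r}"
  by (simp add: pcball_def pdist_gnorm)

lemma gnorm_nonneg [simp]: "0 \<le> gnorm z"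
  by (simp add: gnorm_def)

lemma gnorm_power4: "gnorm z ^ 4 = norm (fst z) ^ 4 + (snd z)\<^sup>2"
  by (simp add: gnorm_def)

lemma gnorm_zero [simp]: "gnorm 0 = 0"
  by (simp add: gnorm_def)

lemma gnorm_minus [simp]: "gnorm (- z) = gnorm z"
  by (simp add: gnorm_def)

lemma gnorm_minus_commute: "gnorm (x - y) = gnorm (y - x)"
  using gnorm_minus[of "x - y"] by simp

lemma norm_fst_le_gnorm: "norm (fst z) \<le> gnorm z"
  using pdist_bounds(1)[of z 0] by (simp add: pdist_gnorm)

lemma snd_le_gnorm: "\<bar>snd z\<bar> \<le> (gnorm z)\<^sup>2"
  using pdist_bounds(2)[of z 0] by (simp add: pdist_gnorm)

lemma gnorm_triangle: "gnorm (x + y) \<le> gnorm x + gnorm y"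
  using pdist_triangle[of 0 "x + y" x] by (simp add: pdist_gnorm)

lemma gnorm_triangle': "gnorm (x - z) \<le> gnorm (x - y) + gnorm (y - z)"
  using gnorm_triangle[of "x - y" "y - z"] by simp

lemma gnorm_le: "gnorm z \<le> norm (fst z) + sqrt \<bar>snd z\<bar>"
proof -
  have "sqrt \<bar>snd z\<bar> ^ (2 * 2) = (snd z)\<^sup>2" by (simp only: power_mult) simp
  then have "root 4 ((snd z)\<^sup>2) = sqrt \<bar>snd z\<bar>"
    by (intro real_root_pos_unique) auto
  then show ?thesis
    using gnorm_triangle[of "(fst z, 0)" "(0, snd z)"]
    by (simp add: gnorm_def real_root_power_cancel)
qed

lemma continuous_on_gnorm [continuous_intros]:
  "continuous_on S f \<Longrightarrow> continuous_on S (\<lambda>x. gnorm (f x))"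
  unfolding gnorm_def by (intro continuous_intros)

lemma gnorm_dil: "gnorm (dil r z) = \<bar>r\<bar> * gnorm z"
proof (rule power_eq_imp_eq_base)
  show "gnorm (dil r z) ^ 4 = (\<bar>r\<bar> * gnorm z) ^ 4"
    unfolding power_mult_distrib gnorm_power4
    by (simp add: dil_def power_mult_distrib algebra_simps flip: power_mult)
qed auto

lemma fst_dil [simp]: "fst (dil r z) = r *\<^sub>R fst z" and snd_dil [simp]: "snd (dil r z) = r\<^sup>2 * snd z"
  by (simp_all add: dil_def)

lemma dil_add: "dil r (x + y) = dil r x + dil r y"
  by (simp add: prod_eq_iff algebra_simps)

lemma dil_diff: "dil r (x - y) = dil r x - dil r y"
  by (simp add: prod_eq_iff algebra_simps)

lemma dil_dil [simp]: "dil r (dil q z) = dil (r * q) z"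
  by (simp add: prod_eq_iff algebra_simps power_mult_distrib)

lemma dil_1 [simp]: "dil 1 z = z" by (simp add: prod_eq_iff)
lemma dil_0 [simp]: "dil r 0 = 0" by (simp add: prod_eq_iff)

lemma continuous_on_dil [continuous_intros]:
  "continuous_on S f \<Longrightarrow> continuous_on S (\<lambda>x. dil r (f x))"
  unfolding dil_def by (intro continuous_intros)

lemma norm_power4: "norm v ^ 4 = (v \<bullet> v)\<^sup>2"
  using power_mult[of "norm v" 2 2] by (simp add: dot_square_norm)

lemma norm_le_gnorm: "norm z \<le> gnorm z + (gnorm z)\<^sup>2"
proof -
  have "norm z \<le> norm (fst z) + \<bar>snd z\<bar>"
    using norm_Pair_le[of "fst z" "snd z"] by (simp only: prod.collapse real_norm_def)
  also have "\<dots> \<le> gnorm z + (gnorm z)\<^sup>2"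
    by (intro add_mono norm_fst_le_gnorm snd_le_gnorm)
  finally show ?thesis .
qed

lemma compact_gball: "compact {y. gnorm (y - x) \<le> R}"
proof (rule compact_eq_bounded_closed[THEN iffD2], rule conjI)
  show "closed {y. gnorm (y - x) \<le> R}"
    by (intro closed_Collect_le continuous_intros)
  have "norm (y - x) \<le> \<bar>R\<bar> + R\<^sup>2" if "gnorm (y - x) \<le> R" for y
  proof -
    have "norm (y - x) \<le> gnorm (y - x) + (gnorm (y - x))\<^sup>2"
      by (rule norm_le_gnorm)
    also have "\<dots> \<le> \<bar>R\<bar> + R\<^sup>2" using that by (intro add_mono power_mono) auto
    finally show ?thesis .
  qed
  then have "{y. gnorm (y - x) \<le> R} \<subseteq> cball x (\<bar>R\<bar> + R\<^sup>2)"
    by (auto simp: dist_norm norm_minus_commute)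
  then show "bounded {y. gnorm (y - x) \<le> R}"
    using bounded_cball bounded_subset by blast
qed

text \<open>The fourth power turns the argument into a polynomial, and the cube makes the profile twice
  continuously differentiable with Lipschitz second derivative.\<close>

definition bump :: "'n::finite par \<Rightarrow> real \<Rightarrow> 'n par \<Rightarrow> real" where
  "bump x r y = (max 0 (1 - (gnorm (y - x) / r) ^ 4)) ^ 3"

section \<open>Test functions, positive functionals and uniformity\<close>

definition test :: "('n::finite par \<Rightarrow> real) \<Rightarrow> bool" where
  "test f \<longleftrightarrow> continuous_on UNIV f \<and> (\<exists>R. \<forall>y. R \<le> gnorm y \<longrightarrow> f y = 0)"

text \<open>The Riesz counterpart of a Radon measure. Values outside \<open>test\<close> are
  unconstrained, and limits can be taken value by value without constructing a limit
  measure.\<close>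

definition posfun :: "(('n::finite par \<Rightarrow> real) \<Rightarrow> real) \<Rightarrow> bool" where
  "posfun \<Lambda> \<longleftrightarrow>
     (\<forall>f g. test f \<longrightarrow> test g \<longrightarrow> \<Lambda> (\<lambda>y. f y + g y) = \<Lambda> f + \<Lambda> g) \<and>
     (\<forall>f c. test f \<longrightarrow> \<Lambda> (\<lambda>y. c * f y) = c * \<Lambda> f) \<and>
     (\<forall>f. test f \<longrightarrow> (\<forall>y. 0 \<le> f y) \<longrightarrow> 0 \<le> \<Lambda> f)"

definition supp :: "(('n::finite par \<Rightarrow> real) \<Rightarrow> real) \<Rightarrow> 'n par set" where
  "supp \<Lambda> = {x. \<forall>r>0. 0 < \<Lambda> (bump x r)}"

text \<open>If all balls have mass proportional to \<open>r powr s\<close>, so do the bump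
  integrals, with another constant; the normalisation absorbs it. Membership of \<open>0\<close> in
  the support fixes the base point for Taylor expansions and further blow-ups.\<close>

definition uniform :: "real \<Rightarrow> (('n::finite par \<Rightarrow> real) \<Rightarrow> real) \<Rightarrow> bool" where
  "uniform s \<Lambda> \<longleftrightarrow> posfun \<Lambda> \<and> 0 \<in> supp \<Lambda> \<and> (\<forall>x\<in>supp \<Lambda>. \<forall>r>0. \<Lambda> (bump x r) = r powr s)"

lemma bump_nonneg [simp]: "0 \<le> bump x r y"
  by (simp add: bump_def)

lemma bump_le_1 [simp]: "bump x r y \<le> 1"
  unfolding bump_def by (rule power_le_one) auto

lemma bump_eq_0: "0 < r \<Longrightarrow> r \<le> gnorm (y - x) \<Longrightarrow> bump x r y = 0"
proof -
  assume "0 < r" "r \<le> gnorm (y - x)"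
  then have "1 \<le> (gnorm (y - x) / r) ^ 4" by (intro one_le_power) simp
  then show ?thesis by (simp add: bump_def)
qed

lemma bump_pos: "0 < r \<Longrightarrow> gnorm (y - x) < r \<Longrightarrow> 0 < bump x r y"
proof -
  assume "0 < r" "gnorm (y - x) < r"
  then have "(gnorm (y - x) / r) ^ 4 < 1" by (simp add: power_less_one_iff)
  then show ?thesis by (simp add: bump_def)
qed

text \<open>Source of the factors 8 and of the \<open>3 / 4 * R\<close> margins below:
  \<open>(3 / 4) ^ 4 < 1 / 2\<close> and \<open>(1 / 2) ^ 3 = 1 / 8\<close>.\<close>

lemma bump_ge: "0 < r \<Longrightarrow> gnorm (y - x) \<le> 3 / 4 * r \<Longrightarrow> 1 / 8 \<le> bump x r y"
proof -
  assume "0 < r" "gnorm (y - x) \<le> 3 / 4 * r"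
  then have "gnorm (y - x) / r \<le> 3 / 4" by (simp add: field_simps)
  then have "(gnorm (y - x) / r) ^ 4 \<le> (3 / 4) ^ 4" 
    using \<open>0 < r\<close> by (intro power_mono) auto
  also have "\<dots> \<le> (1 / 2 :: real)" by (simp add: power_divide)
  finally have "1 / 2 \<le> max 0 (1 - (gnorm (y - x) / r) ^ 4)" by linarith
  then have "(1 / 2) ^ 3 \<le> bump x r y" unfolding bump_def by (rule power_mono) simp
  then show ?thesis by (simp add: power_divide)
qed

lemma continuous_on_bump [continuous_intros]:
  "continuous_on S f \<Longrightarrow> continuous_on S g \<Longrightarrow> 0 < r \<Longrightarrow> continuous_on S (\<lambda>x. bump (f x) r (g x))"
  unfolding bump_def by (intro continuous_intros) auto

lemma test_bump [simp]:
  fixes x :: "'a::finite par"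
  shows "0 < r \<Longrightarrow> test (bump x r)"
  unfolding test_def
proof (intro conjI exI allI impI)
  fix y :: "'a par" assume "0 < r" "gnorm x + r \<le> gnorm y"
  then show "bump x r y = 0" using gnorm_triangle[of "y - x" x] by (intro bump_eq_0) auto
qed (intro continuous_intros continuous_on_id)

lemma test_add [simp]: "test f \<Longrightarrow> test g \<Longrightarrow> test (\<lambda>y. f y + g y)"
  unfolding test_def
proof (elim conjE exE, intro conjI)
  fix R R' assume "\<forall>y. R \<le> gnorm y \<longrightarrow> f y = 0" "\<forall>y. R' \<le> gnorm y \<longrightarrow> g y = 0"
  then show "\<exists>R. \<forall>y. R \<le> gnorm y \<longrightarrow> f y + g y = 0"
    by (intro exI[of _ "max R R'"]) auto
qed (intro continuous_intros)

lemma test_mult [simp]: "continuous_on UNIV g \<Longrightarrow> test f \<Longrightarrow> test (\<lambda>y. g y * f y)"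
  unfolding test_def by (force intro!: continuous_intros)

lemma test_cmult [simp]: "test f \<Longrightarrow> test (\<lambda>y. c * f y)"
  by (rule test_mult) auto

lemma test_minus [simp]: "test f \<Longrightarrow> test (\<lambda>y. - f y)"
  using test_cmult[of f "-1"] by simp

lemma test_diff [simp]: "test f \<Longrightarrow> test g \<Longrightarrow> test (\<lambda>y. f y - g y)"
  using test_add[of f "\<lambda>y. - g y"] by simp

lemma test_zero [simp]: "test (\<lambda>_. 0)"
  by (simp add: test_def)

lemma test_sum [simp]: "(\<And>i. i \<in> I \<Longrightarrow> test (f i)) \<Longrightarrow> test (\<lambda>y. \<Sum>i\<in>I. f i y)"
  by (induction I rule: infinite_finite_induct) auto

lemma test_affine:
  assumes "test f" "0 < r"
  shows "test (\<lambda>y. f (dil (1 / r) (y - q)))"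
proof -
  from assms obtain R where R: "\<And>y. R \<le> gnorm y \<Longrightarrow> f y = 0" and c: "continuous_on UNIV f"
    by (auto simp: test_def)
  have "f (dil (1 / r) (y - q)) = 0" if "r * R + gnorm q \<le> gnorm y" for y
  proof (rule R)
    have "r * R \<le> gnorm (y - q)" using that gnorm_triangle[of "y - q" q] by auto
    then show "R \<le> gnorm (dil (1 / r) (y - q))" using \<open>0 < r\<close> by (simp add: gnorm_dil field_simps)
  qed
  moreover have "continuous_on UNIV (\<lambda>y. f (dil (1 / r) (y - q)))"
    by (rule continuous_on_compose2[OF c]) (auto intro!: continuous_intros)
  ultimately show ?thesis unfolding test_def by blast
qed

text \<open>Translations and dilations permute the bumps, so rescaled functionals can be tested on
  the same family.\<close>

lemma bump_affine:
  assumes "0 < r"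
  shows "bump x \<rho> (dil (1 / r) (y - q)) = bump (q + dil r x) (r * \<rho>) y"
proof -
  have "dil (1 / r) (y - q) - x = dil (1 / r) (y - (q + dil r x))"
    using assms by (simp add: dil_diff dil_add)
  then show ?thesis using assms by (simp add: bump_def gnorm_dil)
qed

text \<open>Positivity turns this into a bound of \<open>\<Lambda> f\<close> by a single bump value.
  The radius is doubled so that the bump is at least 1/8 on the ball carrying
  \<open>f\<close>.\<close>

lemma test_dominated:
  assumes "test f"
  obtains M R where "0 \<le> M" "0 < R" "\<And>y. \<bar>f y\<bar> \<le> M * bump 0 R y" 
    "\<And>y. \<bar>f y\<bar> \<le> M"
proof -
  from assms obtain R0 where R0: "\<And>y. R0 \<le> gnorm y \<Longrightarrow> f y = 0" and c: "continuous_on UNIV f"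
    by (auto simp: test_def)
  define R where "R = \<bar>R0\<bar> + 1"
  have "compact (f ` {y. gnorm (y - 0) \<le> R})"
    by (intro compact_continuous_image compact_gball continuous_on_subset[OF c]) auto
  then have "bounded (f ` {y. gnorm (y - 0) \<le> R})" by (rule compact_imp_bounded)
  then obtain M where M: "\<And>y. gnorm y \<le> R \<Longrightarrow> \<bar>f y\<bar> \<le> M"
    unfolding bounded_iff by (metis (mono_tags, lifting) diff_zero image_eqI mem_Collect_eq real_norm_def)
  have "M \<ge> 0" using M[of 0] by (simp add: R_def)
  show ?thesis
  proof (rule that[of "8 * M" "2 * R"])
    fix y show "\<bar>f y\<bar> \<le> 8 * M * bump 0 (2 * R) y"
    proof (cases "gnorm y \<le> R")
      case True
      then have "M * (1/8) \<le> M * bump 0 (2 * R) y"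
        using \<open>M \<ge> 0\<close> by (intro mult_left_mono bump_ge) (auto simp: R_def)
      then show ?thesis using M[OF True] by simp
    next
      case False
      then show ?thesis using R0[of y] \<open>M \<ge> 0\<close> by (simp add: R_def)
    qed
    show "\<bar>f y\<bar> \<le> 8 * M" using M[of y] R0[of y] \<open>M \<ge> 0\<close> by (cases "gnorm y \<le> R") (auto simp: R_def)
  qed (use \<open>M \<ge> 0\<close> R_def in auto)
qed

section \<open>Consequences of positivity\<close>

context
  fixes \<Lambda> :: "('n::finite par \<Rightarrow> real) \<Rightarrow> real"
  assumes pf: "posfun \<Lambda>"
begin

lemma posfun_add: "test f \<Longrightarrow> test g \<Longrightarrow> \<Lambda> (\<lambda>y. f y + g y) = \<Lambda> f + \<Lambda> g"
  using pf unfolding posfun_def by blast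

lemma posfun_cmult: "test f \<Longrightarrow> \<Lambda> (\<lambda>y. c * f y) = c * \<Lambda> f"
  using pf unfolding posfun_def by blast

lemma posfun_nonneg: "test f \<Longrightarrow> (\<And>y. 0 \<le> f y) \<Longrightarrow> 0 \<le> \<Lambda> f"
  using pf unfolding posfun_def by blast

lemma posfun_diff: "test f \<Longrightarrow> test g \<Longrightarrow> \<Lambda> (\<lambda>y. f y - g y) = \<Lambda> f - \<Lambda> g"
  using posfun_add[of f "\<lambda>y. -1 * g y"] posfun_cmult[of g "-1"] test_cmult[of g "-1"] by simp

lemma posfun_zero: "\<Lambda> (\<lambda>_. 0) = 0"
  using posfun_cmult[of "\<lambda>_. 0" 0] by simp

lemma posfun_sum: "(\<And>i. i \<in> I \<Longrightarrow> test (f i)) \<Longrightarrow> \<Lambda> (\<lambda>y. \<Sum>i\<in>I. f i y) = (\<Sum>i\<in>I. \<Lambda> (f i))"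
  by (induction I rule: infinite_finite_induct) (auto simp: posfun_zero posfun_add)

lemma posfun_mono: "test f \<Longrightarrow> test g \<Longrightarrow> (\<And>y. f y \<le> g y) \<Longrightarrow> \<Lambda> f \<le> \<Lambda> g"
  using posfun_nonneg[of "\<lambda>y. g y - f y"] posfun_diff[of g f] by simp

lemma posfun_abs_le:
  assumes "test f" "test g" "\<And>y. \<bar>f y\<bar> \<le> g y"
  shows "\<bar>\<Lambda> f\<bar> \<le> \<Lambda> g"
proof -
  have "\<Lambda> f \<le> \<Lambda> g" using assms by (intro posfun_mono) (auto dest: abs_le_D1)
  moreover have "\<Lambda> (\<lambda>y. -1 * f y) \<le> \<Lambda> g" using assms by (intro posfun_mono test_cmult) (auto dest: abs_le_D2)
  ultimately show ?thesis using assms posfun_cmult[of f "-1"] by simp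
qed

lemma posfun_bump_nonneg: "0 < r \<Longrightarrow> 0 \<le> \<Lambda> (bump x r)"
  by (intro posfun_nonneg) auto

text \<open>The functional sees only its support. The compact set \<open>K\<close> where
  \<open>f \<le> - \<epsilon>\<close> is covered by finitely many bumps of integral zero; adding a
  large multiple of their sum to \<open>f\<close> costs nothing and leaves a function bounded below
  by a bump of size \<open>\<epsilon>\<close>.\<close>

lemma posfun_nonneg_supp:
  assumes f: "test f" and nn: "\<And>y. y \<in> supp \<Lambda> \<Longrightarrow> 0 \<le> f y"
  shows "0 \<le> \<Lambda> f"
proof -
  obtain M R where M: "0 \<le> M" "0 < R" and le: "\<And>y. \<bar>f y\<bar> \<le> M * bump 0 R y"
    and M': "\<And>y. \<bar>f y\<bar> \<le> M"
    using test_dominated[OF f] by metis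
  have c: "continuous_on UNIV f" using f by (simp add: test_def)
  have "- \<epsilon> * (8 * \<Lambda> (bump 0 (2 * R))) \<le> \<Lambda> f" if "\<epsilon> > 0" for \<epsilon>
  proof -
    define K where "K = {y. f y \<le> - \<epsilon>}"
    have KR: "gnorm y < R" if "y \<in> K" for y
      using le[of y] bump_eq_0[of R y 0] that \<open>\<epsilon> > 0\<close> \<open>0 < R\<close> by (force simp: K_def)
    have "closed K" unfolding K_def by (intro closed_Collect_le c continuous_intros)
    then have "compact ({y. gnorm (y - 0) \<le> R} \<inter> K)" by (intro compact_Int_closed compact_gball)
    moreover have "{y. gnorm (y - 0) \<le> R} \<inter> K = K" using KR by force
    ultimately have "compact K" by simp
    have "\<exists>r>0. \<Lambda> (bump x r) = 0" if "x \<in> K" for x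
    proof -
      have "x \<notin> supp \<Lambda>" using that nn[of x] \<open>\<epsilon> > 0\<close> by (force simp: K_def)
      then obtain r where "r > 0" "\<Lambda> (bump x r) \<le> 0" by (auto simp: supp_def not_less)
      then show ?thesis using posfun_bump_nonneg[of r x] by force
    qed
    then obtain r where r: "\<And>x. x \<in> K \<Longrightarrow> r x > 0" "\<And>x. x \<in> K \<Longrightarrow> \<Lambda> (bump x (r x)) = 0" by metis
    have "open {y. gnorm (y - x) < r x}" for x by (intro open_Collect_less continuous_intros)
    moreover have "K \<subseteq> (\<Union>x\<in>K. {y. gnorm (y - x) < r x})" using r by force
    ultimately obtain Y where Y: "Y \<subseteq> K" "finite Y" "K \<subseteq> (\<Union>x\<in>Y. {y. gnorm (y - x) < r x})"
      by (rule compactE_image[OF \<open>compact K\<close>, of K "\<lambda>x. {y. gnorm (y - x) < r x}"])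
    define \<sigma> where "\<sigma> y = (\<Sum>x\<in>Y. bump x (r x) y)" for y
    have ts: "test \<sigma>" unfolding \<sigma>_def using Y r by (intro test_sum test_bump) auto
    have \<Lambda>\<sigma>: "\<Lambda> \<sigma> = 0" unfolding \<sigma>_def using Y r by (subst posfun_sum) (auto intro!: sum.neutral test_bump)
    have \<sigma>nn: "0 \<le> \<sigma> y" for y unfolding \<sigma>_def by (intro sum_nonneg) auto
    have \<sigma>pos: "0 < \<sigma> y" if "y \<in> K" for y
    proof -
      from that Y obtain x where x: "x \<in> Y" "gnorm (y - x) < r x" by auto
      then have "0 < bump x (r x) y" using r Y bump_pos by blast
      then show ?thesis unfolding \<sigma>_def using x Y by (intro sum_pos2[of _ x]) auto
    qed
    obtain m where m: "m > 0" "\<And>y. y \<in> K \<Longrightarrow> m \<le> \<sigma> y"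
    proof (cases "K = {}")
      case False
      have "continuous_on K \<sigma>" using ts continuous_on_subset unfolding test_def by blast
      then obtain y where "y \<in> K" "\<And>z. z \<in> K \<Longrightarrow> \<sigma> y \<le> \<sigma> z"
        using continuous_attains_inf[OF \<open>compact K\<close> False] by blast
      then show ?thesis using \<sigma>pos that by blast
    qed (use that[of 1] in auto)
    have "- \<epsilon> * (8 * bump 0 (2 * R) y) \<le> f y + M / m * \<sigma> y" for y
    proof (cases "y \<in> K")
      case True
      have "M \<le> M / m * \<sigma> y" using m(2)[OF True] m(1) M mult_left_mono[of m "\<sigma> y" M] by (simp add: field_simps)
      moreover have "- M \<le> f y" using M'[of y] by linarith
      moreover have "0 \<le> \<epsilon> * (8 * bump 0 (2 * R) y)" using \<open>\<epsilon> > 0\<close> by auto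
      ultimately show ?thesis by linarith
    next
      case False
      have nn: "0 \<le> M / m * \<sigma> y" using M m \<sigma>nn by auto
      show ?thesis
      proof (cases "gnorm y < R")
        case True
        have "\<epsilon> * 1 \<le> \<epsilon> * (8 * bump 0 (2 * R) y)"
          using True M \<open>\<epsilon> > 0\<close> bump_ge[of "2 * R" y 0] by (intro mult_left_mono) auto
        then show ?thesis using False nn unfolding K_def by simp
      next
        case f: False
        then have "f y = 0" using le[of y] bump_eq_0[of R y 0] M by auto
        moreover have "0 \<le> \<epsilon> * (8 * bump 0 (2 * R) y)" using \<open>\<epsilon> > 0\<close> by auto
        ultimately show ?thesis using nn by linarith
      qed
    qed
    then have "\<Lambda> (\<lambda>y. - (8 * \<epsilon>) * bump 0 (2 * R) y) \<le> \<Lambda> (\<lambda>y. f y + M / m * \<sigma> y)"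
      using M f ts by (intro posfun_mono test_add test_cmult) (auto simp: ac_simps)
    also have "\<dots> = \<Lambda> f + M / m * \<Lambda> \<sigma>"
      using f ts by (simp only: posfun_add test_cmult posfun_cmult)
    also have "\<dots> = \<Lambda> f" using \<Lambda>\<sigma> by simp
    finally show ?thesis using M by (subst (asm) posfun_cmult) auto
  qed
  note * = this
  define c where "c = 8 * \<Lambda> (bump 0 (2 * R))"
  have "c \<ge> 0" using posfun_bump_nonneg[of "2*R" 0] M by (simp add: c_def)
  show ?thesis
  proof (rule ccontr)
    assume "\<not> 0 \<le> \<Lambda> f"
    \<comment> \<open>With this value as \<open>\<epsilon>\<close> the bound reads
      \<open>\<Lambda> f * (c / (c + 1)) \<le> \<Lambda> f\<close>, impossible for negative
      \<open>\<Lambda> f\<close>.\<close>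
    then have "- \<Lambda> f / (c + 1) > 0" using \<open>c \<ge> 0\<close> by (intro divide_pos_pos) auto
    from *[OF this] have "\<Lambda> f * (c / (c + 1)) \<le> \<Lambda> f" by (simp add: c_def)
    moreover have "c / (c + 1) < 1" using \<open>c \<ge> 0\<close> by simp
    ultimately show False using \<open>\<not> 0 \<le> \<Lambda> f\<close>
      by (metis mult.right_neutral mult_less_cancel_left_disj not_le)
  qed
qed

lemma posfun_mono_supp: "test f \<Longrightarrow> test g \<Longrightarrow> (\<And>y. y \<in> supp \<Lambda> \<Longrightarrow> f y \<le> g y) \<Longrightarrow> \<Lambda> f \<le> \<Lambda> g"
  using posfun_nonneg_supp[of "\<lambda>y. g y - f y"] posfun_diff[of g f] by simp

text \<open>Turns a vanishing moment of a function of constant sign into a pointwise identity: if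
  \<open>f p > 0\<close>, a small multiple of a bump at \<open>p\<close> lies below \<open>f\<close>
  on the support and has positive integral.\<close>

lemma posfun_eq_0_supp:
  assumes f: "test f" and nn: "\<And>y. y \<in> supp \<Lambda> \<Longrightarrow> 0 \<le> f y" and "\<Lambda> f = 0" and p: "p \<in> supp \<Lambda>"
  shows "f p = 0"
proof (rule ccontr)
  assume "f p \<noteq> 0"
  then have fp: "f p > 0" using nn[OF p] by simp
  have c: "continuous_on UNIV f" using f by (simp add: test_def)
  have "open {y. f p / 2 < f y}" by (intro open_Collect_less c continuous_intros)
  moreover have "p \<in> {y. f p / 2 < f y}" using fp by simp
  ultimately have "openin (Metric_space.mtopology UNIV pdist) {y. f p / 2 < f y}"
    by (simp add: mtopology_pdist)
  with \<open>p \<in> {y. f p / 2 < f y}\<close> obtain r where r: "r > 0" "\<And>y. pdist p y < r \<Longrightarrow> f p / 2 < f y"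
    unfolding Metric_space.openin_mtopology[OF Metric_space_pdist]
    using Metric_space.in_mball[OF Metric_space_pdist] by blast
  have "\<Lambda> (\<lambda>y. f p / 2 * bump p r y) \<le> \<Lambda> f"
  proof (rule posfun_mono_supp)
    fix y assume y: "y \<in> supp \<Lambda>"
    show "f p / 2 * bump p r y \<le> f y"
    proof (cases "gnorm (y - p) < r")
      case True
      then have "f p / 2 < f y" using r by (simp add: pdist_gnorm)
      moreover have "f p / 2 * bump p r y \<le> f p / 2 * 1" using fp by (intro mult_left_mono) auto
      ultimately show ?thesis by linarith
    qed (use r y nn bump_eq_0[of r y p] in auto)
  qed (use r f in \<open>auto intro!: test_cmult simp del: times_divide_eq_left\<close>)
  moreover have "\<Lambda> (\<lambda>y. f p / 2 * bump p r y) > 0"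
    using fp r p by (subst posfun_cmult) (auto simp: supp_def)
  ultimately show False using \<open>\<Lambda> f = 0\<close> by simp
qed

lemma posfun_meets_supp:
  assumes "0 < r" "0 < \<Lambda> (bump x r)"
  shows "\<exists>y\<in>supp \<Lambda>. gnorm (y - x) < r"
proof (rule ccontr)
  assume "\<not> ?thesis"
  then have "\<Lambda> (bump x r) \<le> \<Lambda> (\<lambda>_. 0)" using assms by (intro posfun_mono_supp) (auto simp: bump_eq_0)
  then show False using assms posfun_zero by simp
qed

text \<open>A bump of radius \<open>r / 2\<close> centred within \<open>r / 4\<close> of
  \<open>x\<close> lives where \<open>gnorm (z - x) \<le> 3 / 4 * r\<close>, so it is dominated by
  eight times \<open>bump x r\<close>.\<close>

lemma closed_supp: "closed (supp \<Lambda>)"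
proof -
  have "open (- supp \<Lambda>)"
  proof (subst open_subopen, intro ballI)
    fix x assume "x \<in> - supp \<Lambda>"
    then obtain r where r: "r > 0" "\<Lambda> (bump x r) \<le> 0" by (auto simp: supp_def not_less)
    let ?T = "{y. gnorm (y - x) < r / 4}"
    have "y \<notin> supp \<Lambda>" if y: "gnorm (y - x) < r / 4" for y
    proof -
      have "\<Lambda> (bump y (r / 2)) \<le> \<Lambda> (\<lambda>z. 8 * bump x r z)"
      proof (rule posfun_mono)
        fix z show "bump y (r / 2) z \<le> 8 * bump x r z"
        proof (cases "gnorm (z - y) < r / 2")
          case True
          then have "gnorm (z - x) \<le> 3 / 4 * r" using y gnorm_triangle'[of z x y] by linarith
          then show ?thesis using bump_ge[of r z x] bump_le_1[of y "r/2" z] r(1) by linarith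
        qed (use r bump_eq_0[of "r/2" z y] in auto)
      qed (use r in auto)
      then show ?thesis using r unfolding supp_def mem_Collect_eq 
        by (subst (asm) posfun_cmult) (auto intro!: exI[of _ "r / 2"])
    qed
    moreover have "open ?T" by (intro open_Collect_less continuous_intros)
    ultimately show "\<exists>T. open T \<and> x \<in> T \<and> T \<subseteq> - supp \<Lambda>"
      using r by (intro exI[of _ ?T]) auto
  qed
  then show ?thesis by (simp add: open_closed)
qed

end

section \<open>Limits and tangents of uniform functionals\<close>

text \<open>The error is stated as a multiple of a bump, so that any positive functional can be
  applied to it. Both bumps live in the ball of radius \<open>gnorm x + r + 1\<close>, which is
  doubled as in \<open>bump_ge\<close>.\<close>

lemma bump_equicontinuous:
  fixes x :: "'n::finite par"
  assumes "0 < r" "0 < \<eta>"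
  obtains \<delta> where "0 < \<delta>" "\<delta> \<le> 1"
    "\<And>x' y. gnorm (x' - x) < \<delta> \<Longrightarrow> \<bar>bump x' r y - bump x r y\<bar> \<le> \<eta> * bump 0 (2 * (gnorm x + r + 1)) y"
proof -
  define R where "R = gnorm x + r + 1"
  have R: "0 < R" using assms gnorm_nonneg[of x] unfolding R_def by linarith
  let ?K = "{x'. gnorm (x' - x) \<le> 1} \<times> {y. gnorm (y - 0) \<le> R}"
  have "continuous_on ?K (\<lambda>p. bump (fst p) r (snd p))"
    using assms by (intro continuous_intros)
  moreover have "compact ?K" by (intro compact_Times compact_gball)
  ultimately have uc: "uniformly_continuous_on ?K (\<lambda>p. bump (fst p) r (snd p))"
    by (rule compact_uniformly_continuous)
  have "0 < \<eta> / 8" using assms by simp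
  with uc obtain d where d: "d > 0" "\<And>p p'. p \<in> ?K \<Longrightarrow> p' \<in> ?K \<Longrightarrow> dist p' p < d \<Longrightarrow>
      dist (bump (fst p') r (snd p')) (bump (fst p) r (snd p)) < \<eta> / 8"
    unfolding uniformly_continuous_on_def by meson
  have "open (ball x d)" "x \<in> ball x d" using d by auto
  then have "openin (Metric_space.mtopology UNIV pdist) (ball x d)"
    by (simp add: mtopology_pdist)
  with \<open>x \<in> ball x d\<close> obtain e where e: "e > 0" "\<And>y. pdist x y < e \<Longrightarrow> y \<in> ball x d"
    unfolding Metric_space.openin_mtopology[OF Metric_space_pdist]
    using Metric_space.in_mball[OF Metric_space_pdist] by blast
  show ?thesis
  proof (rule that[of "min 1 e"])
    fix x' y :: "'n par" assume x': "gnorm (x' - x) < min 1 e"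
    show "\<bar>bump x' r y - bump x r y\<bar> \<le> \<eta> * bump 0 (2 * (gnorm x + r + 1)) y"
    proof (cases "gnorm y \<le> R")
      case True
      have "dist x x' < d" using e(2)[of x'] x' by (simp add: pdist_gnorm)
      then have "dist (x', y) (x, y) < d" by (simp add: dist_Pair_Pair dist_commute)
      with d(2)[of "(x, y)" "(x', y)"] True x'
      have "\<bar>bump x' r y - bump x r y\<bar> \<le> \<eta> * (1 / 8)" by (auto simp: dist_real_def)
      also have "\<dots> \<le> \<eta> * bump 0 (2 * R) y"
        using True R assms by (intro mult_left_mono bump_ge) auto
      finally show ?thesis by (simp add: R_def)
    next
      case False
      have "gnorm y \<le> gnorm (y - x) + gnorm x" "gnorm y \<le> gnorm (y - x') + gnorm (x' - x) + gnorm x"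
        using gnorm_triangle[of "y - x" x] gnorm_triangle'[of y x x'] by auto
      then have "bump x r y = 0" "bump x' r y = 0"
        using False x' assms by (auto intro!: bump_eq_0 simp: R_def)
      then show ?thesis using assms by simp
    qed
  qed (use e in auto)
qed

text \<open>\<open>S i\<close> stands for an approximate support: bumps centred on it have nearly
  the right integral, and bumps away from it have nearly none. This form serves both the exact
  supports of rescaled functionals and the rescaled compact sets that come from the measure.\<close>

lemma posfun_limit:
  fixes \<Lambda> :: "'i \<Rightarrow> ('n::finite par \<Rightarrow> real) \<Rightarrow> real" and S :: "'i \<Rightarrow> 'n par set"
  assumes F: "F \<noteq> bot"
    and pf: "\<And>i. posfun (\<Lambda> i)"
    and zero: "eventually (\<lambda>i. 0 \<in> S i) F"
    and dens: "\<And>R r \<epsilon>. 0 < r \<Longrightarrow> 0 < \<epsilon> \<Longrightarrow>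
      eventually (\<lambda>i. \<forall>x\<in>S i. gnorm x \<le> R \<longrightarrow> \<bar>\<Lambda> i (bump x r) - r powr s\<bar> \<le> \<epsilon>) F"
    and off: "\<And>z \<rho> \<epsilon>. 0 < \<rho> \<Longrightarrow> 0 < \<epsilon> \<Longrightarrow>
      eventually (\<lambda>i. (\<forall>y\<in>S i. \<rho> \<le> gnorm (y - z)) \<longrightarrow> \<Lambda> i (bump z \<rho>) \<le> \<epsilon>) F"
  obtains M where "uniform s M"
    "\<And>z \<rho>. z \<in> supp M \<Longrightarrow> 0 < \<rho> \<Longrightarrow> frequently (\<lambda>i. \<exists>y\<in>S i. gnorm (y - z) < \<rho>) F"
proof -
  obtain G where G: "G \<le> F" "G \<noteq> bot" and
    lim: "\<And>h :: 'i \<Rightarrow> real. Bfun h F \<Longrightarrow> (h \<longlongrightarrow> Lim G h) G"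
    using ultrafilter_like[OF F] by metis
  define M where "M f = Lim G (\<lambda>i. \<Lambda> i f)" for f
  \<comment> \<open>Since \<open>0\<close> eventually lies in \<open>S i\<close>, bumps at
    \<open>0\<close> are controlled, and they dominate all test functions; hence every
    \<open>\<Lambda> i f\<close> is eventually bounded.\<close>
  have dens0: "eventually (\<lambda>i. \<bar>\<Lambda> i (bump 0 r) - r powr s\<bar> \<le> \<epsilon>) F" if "0 < r" "0 < \<epsilon>" for r \<epsilon>
    using dens[OF that, of 0] zero by eventually_elim simp
  have lim_test: "((\<lambda>i. \<Lambda> i f) \<longlongrightarrow> M f) G" if f: "test f" for f
    unfolding M_def
  proof (rule lim)
    obtain C R where C: "0 \<le> C" "0 < R" and le: "\<And>y. \<bar>f y\<bar> \<le> C * bump 0 R y"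
      using test_dominated[OF f] by metis
    have "eventually (\<lambda>i. norm (\<Lambda> i f) \<le> C * (R powr s + 1) + 1) F"
      using dens0[OF C(2) zero_less_one]
    proof eventually_elim
      case (elim i)
      have "\<bar>\<Lambda> i f\<bar> \<le> \<Lambda> i (\<lambda>y. C * bump 0 R y)"
        by (rule posfun_abs_le[OF pf f _ le]) (use C in auto)
      also have "\<dots> = C * \<Lambda> i (bump 0 R)" by (rule posfun_cmult[OF pf]) (use C in auto)
      also have "\<dots> \<le> C * (R powr s + 1)" using elim C by (intro mult_left_mono) linarith+
      finally show ?case by simp
    qed
    moreover have "0 < C * (R powr s + 1) + 1" using C by (intro add_nonneg_pos mult_nonneg_nonneg) auto
    ultimately show "Bfun (\<lambda>i. \<Lambda> i f) F" unfolding Bfun_def by blast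
  qed
  have pfM: "posfun M"
    unfolding posfun_def
  proof (intro conjI allI impI)
    fix f g :: "'n par \<Rightarrow> real" assume fg: "test f" "test g"
    have "((\<lambda>i. \<Lambda> i (\<lambda>y. f y + g y)) \<longlongrightarrow> M f + M g) G"
      using tendsto_add[OF lim_test[OF fg(1)] lim_test[OF fg(2)]] by (simp add: posfun_add[OF pf fg])
    then show "M (\<lambda>y. f y + g y) = M f + M g"
      by (rule tendsto_unique[OF G(2) lim_test[OF test_add[OF fg]]])
  next
    fix f :: "'n par \<Rightarrow> real" and c assume f: "test f"
    have "((\<lambda>i. \<Lambda> i (\<lambda>y. c * f y)) \<longlongrightarrow> c * M f) G"
      using tendsto_mult_left[OF lim_test[OF f]] by (simp add: posfun_cmult[OF pf f])
    then show "M (\<lambda>y. c * f y) = c * M f"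
      by (rule tendsto_unique[OF G(2) lim_test[OF test_cmult[OF f]]])
  next
    fix f :: "'n par \<Rightarrow> real" assume f: "test f" "\<forall>y. 0 \<le> f y"
    show "0 \<le> M f"
      by (rule tendsto_lowerbound[OF lim_test[OF f(1)] _ G(2)])
        (use f in \<open>auto intro!: always_eventually posfun_nonneg[OF pf]\<close>)
  qed
  have M0: "M (bump 0 r) = r powr s" if "0 < r" for r
  proof -
    have "((\<lambda>i. \<Lambda> i (bump 0 r)) \<longlongrightarrow> r powr s) F"
      by (rule tendstoI, rule eventually_mono[OF dens0[OF that half_gt_zero]])
        (auto simp: dist_real_def)
    then have "((\<lambda>i. \<Lambda> i (bump 0 r)) \<longlongrightarrow> r powr s) G" using G(1) by (rule tendsto_mono[rotated])
    from tendsto_unique[OF G(2) lim_test[OF test_bump[OF that]] this] show ?thesis .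
  qed
  \<comment> \<open>Near a support point of the limit the bump integrals stay above
    \<open>c / 2\<close>, which the hypothesis \<open>off\<close> forbids unless \<open>S i\<close>
    comes close.\<close>
  have near: "eventually (\<lambda>i. \<exists>y\<in>S i. gnorm (y - z) < \<rho>) G" if "z \<in> supp M" "0 < \<rho>" for z \<rho>
  proof -
    define c where "c = M (bump z \<rho>)"
    have c: "0 < c" using that by (simp add: c_def supp_def)
    have "eventually (\<lambda>i. c / 2 < \<Lambda> i (bump z \<rho>)) G"
      by (rule order_tendstoD(1)[OF lim_test]) (use c c_def that in auto)
    moreover have "eventually (\<lambda>i. (\<forall>y\<in>S i. \<rho> \<le> gnorm (y - z)) \<longrightarrow> \<Lambda> i (bump z \<rho>) \<le> c / 2) G"
      using off[of \<rho> "c / 2" z] that c G(1) by (auto dest: filter_leD)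
    ultimately show ?thesis by eventually_elim force
  qed
  have unif: "M (bump x r) = r powr s" if x: "x \<in> supp M" and r: "0 < r" for x r
  proof -
    define R where "R = 2 * (gnorm x + r + 1)"
    have R: "0 < R" unfolding R_def using r by (intro mult_pos_pos add_nonneg_pos add_nonneg_nonneg) auto
    define C where "C = R powr s + 1"
    have C: "C > 0" by (simp add: C_def add_nonneg_pos)
    \<comment> \<open>The errors are one \<open>\<eta>\<close> from the density at a nearby point
      \<open>x'\<close> of \<open>S i\<close>, one from convergence along \<open>G\<close>, and
      \<open>\<eta> * C\<close> from moving the centre from \<open>x'\<close> to
      \<open>x\<close>.\<close>
    have "\<bar>M (bump x r) - r powr s\<bar> \<le> \<eta> * (C + 2)" if \<eta>: "\<eta> > 0" for \<eta>
    proof -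
      obtain \<delta> where \<delta>: "0 < \<delta>" "\<delta> \<le> 1"
        "\<And>x' y. gnorm (x' - x) < \<delta> \<Longrightarrow> \<bar>bump x' r y - bump x r y\<bar> \<le> \<eta> * bump 0 R y"
        using bump_equicontinuous[OF r \<eta>, of x] unfolding R_def by metis
      have "eventually (\<lambda>i. \<exists>y\<in>S i. gnorm (y - x) < \<delta>) G" by (rule near[OF x \<delta>(1)])
      moreover have "eventually (\<lambda>i. \<forall>x'\<in>S i. gnorm x' \<le> gnorm x + 1 \<longrightarrow> \<bar>\<Lambda> i (bump x' r) - r powr s\<bar> \<le> \<eta>) G"
        using dens[OF r \<eta>] G(1) by (auto dest: filter_leD)
      moreover have "eventually (\<lambda>i. \<bar>\<Lambda> i (bump 0 R) - R powr s\<bar> \<le> 1) G"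
        using dens0[OF R, of 1] G(1) by (auto dest: filter_leD)
      moreover have "eventually (\<lambda>i. dist (\<Lambda> i (bump x r)) (M (bump x r)) < \<eta>) G"
        using lim_test[OF test_bump[OF r]] \<eta> by (rule tendstoD)
      ultimately have "eventually (\<lambda>i. \<bar>M (bump x r) - r powr s\<bar> \<le> \<eta> * (C + 2)) G"
      proof eventually_elim
        case (elim i)
        then obtain x' where x': "x' \<in> S i" "gnorm (x' - x) < \<delta>" by blast
        have "gnorm x' \<le> gnorm x + 1" using gnorm_triangle[of "x' - x" x] x' \<delta> by simp
        then have 1: "\<bar>\<Lambda> i (bump x' r) - r powr s\<bar> \<le> \<eta>" using elim x' by blast
        have "\<bar>\<Lambda> i (\<lambda>y. bump x' r y - bump x r y)\<bar> \<le> \<Lambda> i (\<lambda>y. \<eta> * bump 0 R y)"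
          by (rule posfun_abs_le[OF pf]) (use \<delta>(3)[OF x'(2)] r R in auto)
        also have "\<dots> = \<eta> * \<Lambda> i (bump 0 R)" by (rule posfun_cmult[OF pf]) (use R in auto)
        also have "\<dots> \<le> \<eta> * C" using elim(3) \<eta> by (intro mult_left_mono) (auto simp: C_def)
        also have "\<Lambda> i (\<lambda>y. bump x' r y - bump x r y) = \<Lambda> i (bump x' r) - \<Lambda> i (bump x r)"
          by (rule posfun_diff[OF pf]) (use r in auto)
        finally show ?case using 1 elim(4) by (auto simp: dist_real_def algebra_simps)
      qed
      then show ?thesis using G(2) by (simp add: eventually_const)
    qed
    note * = this
    have "\<bar>M (bump x r) - r powr s\<bar> \<le> 0 + e" if "0 < e" for e
      using *[of "e / (C + 2)"] that C by simp
    then have "\<bar>M (bump x r) - r powr s\<bar> \<le> 0" by (rule field_le_epsilon)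
    then show ?thesis by simp
  qed
  have "0 \<in> supp M" by (simp add: supp_def M0)
  with pfM unif have "uniform s M" by (simp add: uniform_def)
  moreover have "frequently (\<lambda>i. \<exists>y\<in>S i. gnorm (y - z) < \<rho>) F" if "z \<in> supp M" "0 < \<rho>" for z \<rho>
    using near[OF that] G by (metis (lifting) eventually_frequently filter_leD frequently_def)
  ultimately show ?thesis using that by blast
qed

text \<open>A tangent is described only by what it inherits from the support of \<open>\<Lambda>\<close> near \<open>q\<close>: inequalities
  that hold on the rescaled supports up to an error \<open>O(r)\<close>. Nothing else about the blow-up is
  needed.\<close>

definition is_tangent ::
  "real \<Rightarrow> (('n::finite par \<Rightarrow> real) \<Rightarrow> real) \<Rightarrow> 'n par \<Rightarrow> (('n par \<Rightarrow> real) \<Rightarrow> real) \<Rightarrow> bool" where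
  "is_tangent s \<Lambda> q M \<longleftrightarrow> uniform s M \<and> (\<forall>h z. continuous_on UNIV h \<longrightarrow>
      (\<forall>R. \<exists>C. \<exists>r0>0. \<forall>r z. 0 < r \<longrightarrow> r < r0 \<longrightarrow> gnorm z \<le> R \<longrightarrow> q + dil r z \<in> supp \<Lambda> \<longrightarrow> h z \<le> C * r) \<longrightarrow>
      z \<in> supp M \<longrightarrow> h z \<le> (0::real))"

text \<open>For rescalings of a uniform functional both approximation hypotheses of
  \<open>posfun_limit\<close> hold exactly. An upper bound \<open>C * r\<close> on the rescaled
  supports passes to the limit because \<open>h\<close> is continuous and support points of the
  limit are approached at arbitrarily small scales.\<close>

lemma tangent_exists:
  fixes \<Lambda> :: "('n::finite par \<Rightarrow> real) \<Rightarrow> real"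
  assumes u: "uniform s \<Lambda>" and q: "q \<in> supp \<Lambda>"
  obtains M where "is_tangent s \<Lambda> q M" "uniform s M"
proof -
  have pf: "posfun \<Lambda>" using u by (simp add: uniform_def)
  \<comment> \<open>The zero functional for \<open>r \<le> 0\<close> makes \<open>T r\<close>
    positive for every index; the filter \<open>at_right 0\<close> ignores it.\<close>
  define T where "T r = (if 0 < r then (\<lambda>f. r powr (- s) * \<Lambda> (\<lambda>y. f (dil (1 / r) (y - q)))) else (\<lambda>_. 0))"
    for r :: real
  define S where "S r = {z. q + dil r z \<in> supp \<Lambda>}" for r
  have Tb: "T r (bump x \<rho>) = r powr (- s) * \<Lambda> (bump (q + dil r x) (r * \<rho>))" if "0 < r" for r x \<rho>
    using that by (simp add: T_def bump_affine)
  have pos: "eventually (\<lambda>r::real. 0 < r) (at_right 0)" by (rule eventually_at_right_less)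
  have Tu: "T r (bump x \<rho>) = \<rho> powr s" if "0 < r" "0 < \<rho>" "x \<in> S r" for r x \<rho>
    using that u by (simp add: Tb S_def uniform_def powr_mult powr_minus)
  have "\<exists>M. uniform s M \<and>
    (\<forall>z \<rho>. z \<in> supp M \<longrightarrow> 0 < \<rho> \<longrightarrow> frequently (\<lambda>r. \<exists>y\<in>S r. gnorm (y - z) < \<rho>) (at_right 0))"
  proof (rule posfun_limit[of "at_right 0" T S s])
    fix r show "posfun (T r)"
      unfolding posfun_def T_def
      by (auto simp: posfun_add[OF pf test_affine test_affine] posfun_cmult[OF pf test_affine]
          algebra_simps simp del: split_paired_All intro!: mult_nonneg_nonneg posfun_nonneg[OF pf test_affine])
  next
    show "\<forall>\<^sub>F r in at_right 0. 0 \<in> S r" using q by (simp add: S_def)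
  next
    fix R r \<epsilon> :: real assume "0 < r" "0 < \<epsilon>"
    then show "\<forall>\<^sub>F i in at_right 0. \<forall>x\<in>S i. gnorm x \<le> R \<longrightarrow> \<bar>T i (bump x r) - r powr s\<bar> \<le> \<epsilon>"
      using pos by (auto elim!: eventually_mono simp: Tu)
  next
    fix z :: "'n par" and \<rho> \<epsilon> :: real assume a: "0 < \<rho>" "0 < \<epsilon>"
    show "\<forall>\<^sub>F i in at_right 0. (\<forall>y\<in>S i. \<rho> \<le> gnorm (y - z)) \<longrightarrow> T i (bump z \<rho>) \<le> \<epsilon>"
      using pos
    proof eventually_elim
      case (elim r)
      show ?case
      proof
        assume *: "\<forall>y\<in>S r. \<rho> \<le> gnorm (y - z)"
        have "\<not> 0 < \<Lambda> (bump (q + dil r z) (r * \<rho>))"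
        proof
          assume "0 < \<Lambda> (bump (q + dil r z) (r * \<rho>))"
          then obtain y where y: "y \<in> supp \<Lambda>" "gnorm (y - (q + dil r z)) < r * \<rho>"
            using posfun_meets_supp[OF pf] a elim by (meson mult_pos_pos)
          define w where "w = dil (1 / r) (y - q)"
          have w: "dil r w = y - q" using elim by (simp add: w_def)
          then have "w \<in> S r" using y by (simp add: S_def)
          then have "r * \<rho> \<le> r * gnorm (w - z)" using * elim by (intro mult_left_mono) auto
          also have "\<dots> = gnorm (dil r (w - z))" using elim by (simp add: gnorm_dil)
          also have "dil r (w - z) = y - (q + dil r z)" by (simp add: dil_diff w)
          finally show False using y by simp
        qed
        then have "T r (bump z \<rho>) \<le> 0" using elim by (simp add: Tb mult_le_0_iff not_less)
        then show "T r (bump z \<rho>) \<le> \<epsilon>" using a by simp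
      qed
    qed
  qed (auto simp: trivial_limit_at_right_real)
  then obtain M where M: "uniform s M"
    "\<And>z \<rho>. z \<in> supp M \<Longrightarrow> 0 < \<rho> \<Longrightarrow> frequently (\<lambda>r. \<exists>y\<in>S r. gnorm (y - z) < \<rho>) (at_right 0)" by blast
  show ?thesis
  proof (rule that[OF _ M(1)], unfold is_tangent_def, intro conjI allI impI, rule M(1), rule ccontr)
    fix h :: "'n par \<Rightarrow> real" and z :: "'n par"
    assume h: "continuous_on UNIV h" and z: "z \<in> supp M" and "\<not> h z \<le> 0"
      and bd: "\<forall>R. \<exists>C. \<exists>r0>0. \<forall>r z. 0 < r \<longrightarrow> r < r0 \<longrightarrow> gnorm z \<le> R \<longrightarrow> q + dil r z \<in> supp \<Lambda> \<longrightarrow> h z \<le> C * r"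
    then have hz: "h z > 0" by simp
    have "open {y. h z / 2 < h y}" by (intro open_Collect_less h continuous_intros)
    then have "openin (Metric_space.mtopology UNIV pdist) {y. h z / 2 < h y}"
      by (simp add: mtopology_pdist)
    moreover have "z \<in> {y. h z / 2 < h y}" using hz by simp
    ultimately obtain e where e: "e > 0" "\<And>y. pdist z y < e \<Longrightarrow> h z / 2 < h y"
      unfolding Metric_space.openin_mtopology[OF Metric_space_pdist]
      using Metric_space.in_mball[OF Metric_space_pdist] by blast
    obtain C r0 where C: "r0 > 0" "\<And>r y. 0 < r \<Longrightarrow> r < r0 \<Longrightarrow> gnorm y \<le> gnorm z + e \<Longrightarrow>
        q + dil r y \<in> supp \<Lambda> \<Longrightarrow> h y \<le> C * r" using bd by meson
    \<comment> \<open>Below \<open>r1\<close> the bound \<open>C * r\<close> is at most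
      \<open>h z / 2\<close>, contradicting \<open>h z / 2 < h y\<close> at an approximating point
      \<open>y\<close>.\<close>
    define r1 where "r1 = min r0 (h z / (2 * (\<bar>C\<bar> + 1)))"
    have "r1 > 0" using C hz by (simp add: r1_def)
    then have "eventually (\<lambda>r. 0 < r \<and> r < r1) (at_right 0)"
      by (simp add: eventually_at_right_less eventually_at_right_real[unfolded greaterThanLessThan_iff])
    from frequently_eventually_frequently[OF M(2)[OF z e(1)] this]
    obtain r y where r: "0 < r" "r < r1" and y: "y \<in> S r" "gnorm (y - z) < e"
      by (auto dest: frequently_ex)
    have "h z / 2 < h y" using e y by (simp add: pdist_gnorm)
    also have "h y \<le> C * r"
      by (rule C(2)) (use r y gnorm_triangle[of "y - z" z] in \<open>auto simp: r1_def S_def\<close>)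
    also have "\<dots> \<le> (\<bar>C\<bar> + 1) * r" using r by (intro mult_right_mono) auto
    also have "\<dots> \<le> h z / 2" using r hz by (simp add: r1_def field_simps)
    finally show False by simp
  qed
qed

section \<open>Moments\<close>

text \<open>The second derivative of the profile has Lipschitz constant 6 even across the kink, and
  \<open>6 / 3! = 1\<close> is the constant of the remainder.\<close>

lemma cube_taylor:
  fixes w h :: real
  shows "\<bar>(max 0 (1 - (w + h))) ^ 3 - (max 0 (1 - w)) ^ 3 + 3 * (max 0 (1 - w))\<^sup>2 * h
    - 3 * max 0 (1 - w) * h\<^sup>2\<bar> \<le> \<bar>h\<bar> ^ 3"
proof -
  define a where "a = 1 - w"
  have *: "1 - (w + h) = a - h" by (simp add: a_def)
  consider "a \<le> 0" | "a > 0" "a - h \<ge> 0" | "a > 0" "a - h < 0" by linarith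
  then have "\<bar>(max 0 (a - h)) ^ 3 - (max 0 a) ^ 3 + 3 * (max 0 a)\<^sup>2 * h - 3 * max 0 a * h\<^sup>2\<bar> \<le> \<bar>h\<bar> ^ 3"
  proof cases
    case 1
    then have "max 0 (a - h) ^ 3 \<le> \<bar>h\<bar> ^ 3" by (intro power_mono) auto
    then show ?thesis using 1 by simp
  next
    case 2
    have "(a - h) ^ 3 - a ^ 3 + 3 * a\<^sup>2 * h - 3 * a * h\<^sup>2 = - (h ^ 3)"
      by (simp add: power2_eq_square power3_eq_cube algebra_simps)
    then show ?thesis using 2 by (simp add: power_abs)
  next
    case 3
    have eq: "- (a ^ 3) + 3 * a\<^sup>2 * h - 3 * a * h\<^sup>2 = (h - a) ^ 3 - h ^ 3"
      by (simp add: power2_eq_square power3_eq_cube algebra_simps)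
    have "0 \<le> (h - a) ^ 3" "(h - a) ^ 3 \<le> h ^ 3" using 3 by (auto intro!: power_mono)
    then show ?thesis using 3 eq by (simp add: power_abs)
  qed
  then show ?thesis by (simp only: * a_def)
qed

text \<open>The moments below are the coefficients in the Taylor expansion of \<open>x \<mapsto> \<Lambda> (bump x 1)\<close> at \<open>0\<close>, where
  \<open>snd x\<close> counts as second order.\<close>

definition wt :: "'n::finite par \<Rightarrow> real" where "wt y = max 0 (1 - gnorm y ^ 4)"

definition mom1 :: "(('n::finite par \<Rightarrow> real) \<Rightarrow> real) \<Rightarrow> real ^ 'n \<Rightarrow> real" where
  "mom1 \<Lambda> x = \<Lambda> (\<lambda>y. (wt y)\<^sup>2 * (norm (fst y))\<^sup>2 * (x \<bullet> fst y))"

definition mom2_fun :: "real ^ 'n \<Rightarrow> real ^ 'n \<Rightarrow> 'n::finite par \<Rightarrow> real" where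
  "mom2_fun x z y = 48 * wt y * (norm (fst y)) ^ 4 * (x \<bullet> fst y) * (z \<bullet> fst y)
     - 3 * (wt y)\<^sup>2 * (2 * (norm (fst y))\<^sup>2 * (x \<bullet> z) + 4 * (x \<bullet> fst y) * (z \<bullet> fst y))"

definition mom2 :: "(('n::finite par \<Rightarrow> real) \<Rightarrow> real) \<Rightarrow> real ^ 'n \<Rightarrow> real ^ 'n \<Rightarrow> real" where
  "mom2 \<Lambda> x z = \<Lambda> (mom2_fun x z)"

definition vmom :: "(('n::finite par \<Rightarrow> real) \<Rightarrow> real) \<Rightarrow> real" where
  "vmom \<Lambda> = \<Lambda> (\<lambda>y. (wt y)\<^sup>2 * snd y)"

lemma wt_nonneg: "0 \<le> wt y" and wt_le_1: "wt y \<le> 1"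
  by (auto simp: wt_def)

lemma wt_eq_0: "1 \<le> gnorm y \<Longrightarrow> wt y = 0"
  using one_le_power[of "gnorm y" 4] by (simp add: wt_def)

lemma wt_pos: "gnorm y < 1 \<Longrightarrow> 0 < wt y"
  using power_less_one_iff[of "gnorm y" 4] by (simp add: wt_def)

lemma continuous_on_wt [continuous_intros]:
  "continuous_on S f \<Longrightarrow> continuous_on S (\<lambda>x. wt (f x))"
  unfolding wt_def by (intro continuous_intros)

lemma test_unit_ball:
  fixes f :: "'n::finite par \<Rightarrow> real"
  assumes "continuous_on UNIV f" "\<And>y. wt y = 0 \<Longrightarrow> f y = 0"
  shows "test f"
  using assms unfolding test_def by (meson wt_eq_0)

lemma test_mom1_fun: "test (\<lambda>y::'n::finite par. (wt y)\<^sup>2 * (norm (fst y))\<^sup>2 * (x \<bullet> fst y))"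
  by (rule test_unit_ball) (auto intro!: continuous_intros)

lemma test_mom2_fun: "test (mom2_fun x z)"
  unfolding mom2_fun_def by (rule test_unit_ball) (auto intro!: continuous_intros)

lemma test_vmom_fun: "test (\<lambda>y. (wt y)\<^sup>2 * snd y)"
  by (rule test_unit_ball) (auto intro!: continuous_intros)

lemma linear_mom1: "posfun \<Lambda> \<Longrightarrow> linear (mom1 \<Lambda>)"
proof (rule linearI)
  assume pf: "posfun \<Lambda>"
  show "mom1 \<Lambda> (x + z) = mom1 \<Lambda> x + mom1 \<Lambda> z" for x z
    unfolding mom1_def posfun_add[OF pf test_mom1_fun test_mom1_fun, symmetric]
    by (simp add: inner_add_left algebra_simps)
  show "mom1 \<Lambda> (c *\<^sub>R x) = c *\<^sub>R mom1 \<Lambda> x" for x c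
    unfolding mom1_def real_scaleR_def posfun_cmult[OF pf test_mom1_fun, symmetric]
    by (simp add: mult_ac)
qed

lemma mom2_commute: "mom2 \<Lambda> x z = mom2 \<Lambda> z x"
  unfolding mom2_def mom2_fun_def by (simp add: inner_commute mult_ac)

lemma linear_mom2: "posfun \<Lambda> \<Longrightarrow> linear (mom2 \<Lambda> x)"
proof (rule linearI)
  assume pf: "posfun \<Lambda>"
  have "mom2_fun x (z + z') = (\<lambda>y. mom2_fun x z y + mom2_fun x z' y)" for z z'
    by (rule ext) (simp add: mom2_fun_def inner_add_left inner_add_right algebra_simps)
  then show "mom2 \<Lambda> x (z + z') = mom2 \<Lambda> x z + mom2 \<Lambda> x z'" for z z'
    unfolding mom2_def by (simp add: posfun_add[OF pf test_mom2_fun test_mom2_fun])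
  have "mom2_fun x (c *\<^sub>R z) = (\<lambda>y. c * mom2_fun x z y)" for z c
    by (rule ext) (simp add: mom2_fun_def algebra_simps)
  then show "mom2 \<Lambda> x (c *\<^sub>R z) = c *\<^sub>R mom2 \<Lambda> x z" for z c
    unfolding mom2_def by (simp add: posfun_cmult[OF pf test_mom2_fun])
qed

lemma bounded_bilinear_mom2: "posfun \<Lambda> \<Longrightarrow> bounded_bilinear (mom2 \<Lambda>)"
  unfolding bilinear_conv_bounded_bilinear[symmetric] bilinear_def
  using linear_mom2[of \<Lambda>] mom2_commute[of \<Lambda>] by (auto simp: mom2_commute[of \<Lambda> _ _])

text \<open>Terms are sorted by degree in \<open>x\<close>, with \<open>snd x\<close> of degree two.
  For \<open>gnorm y\<close> at least 2 the left side vanishes, which allows the error to be written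
  as a multiple of one bump.\<close>

lemma bump_expansion:
  fixes x y :: "'n::finite par"
  assumes x: "gnorm x \<le> 1"
  shows "\<bar>bump x 1 y - (bump 0 1 y + 12 * ((wt y)\<^sup>2 * (norm (fst y))\<^sup>2 * (fst x \<bullet> fst y))
      + (mom2_fun (fst x) (fst x) y + 6 * snd x * ((wt y)\<^sup>2 * snd y)))\<bar>
    \<le> (4000000 * gnorm x ^ 3) * bump 0 4 y"
proof (cases "gnorm y < 2")
  case False
  then have "1 \<le> gnorm (y - x)" using gnorm_triangle[of "y - x" x] x by simp
  then have "bump x 1 y = 0" "bump 0 1 y = 0" "wt y = 0" using False by (auto simp: bump_eq_0 wt_eq_0)
  then show ?thesis by (simp add: mom2_fun_def)
next
  case True
  define \<rho> where "\<rho> = gnorm x"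
  have \<rho>: "0 \<le> \<rho>" "\<rho> \<le> 1" using x by (auto simp: \<rho>_def)
  define X where "X = fst x \<bullet> fst x"
  define Y where "Y = fst y \<bullet> fst y"
  define p where "p = fst x \<bullet> fst y"
  define t where "t = snd x"
  define u where "u = snd y"
  define a where "a = wt y"
  define w where "w = gnorm y ^ 4"
  define h where "h = gnorm (y - x) ^ 4 - w"
  \<comment> \<open>\<open>h1\<close>, \<open>h2\<close>, \<open>h3\<close> collect the terms of
    degree 1, 2 and at least 3 of \<open>gnorm (y - x) ^ 4 - gnorm y ^ 4\<close>. The profile
    contributes \<open>- 3 * a\<^sup>2 * h + 3 * a * h\<^sup>2\<close>, hence the coefficients 12 =
    3 * 4, 48 = 3 * 4^2 and 6 = 3 * 2.\<close>
  define h1 where "h1 = - 4 * Y * p"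
  define h2 where "h2 = 2 * Y * X + 4 * p\<^sup>2 - 2 * t * u"
  define h3 where "h3 = - 4 * X * p + X\<^sup>2 + t\<^sup>2"
  have h: "h = h1 + h2 + h3"
    unfolding h_def w_def gnorm_power4 norm_power4 h1_def h2_def h3_def X_def Y_def p_def t_def u_def
    by (simp add: inner_diff_left inner_diff_right inner_commute power2_eq_square algebra_simps)
  have X: "0 \<le> X" "X \<le> \<rho>\<^sup>2"
    using norm_fst_le_gnorm[of x] by (auto simp: X_def \<rho>_def dot_square_norm intro!: power_mono)
  have Y: "0 \<le> Y" "Y \<le> 2\<^sup>2"
    using norm_fst_le_gnorm[of y] True unfolding Y_def dot_square_norm by (auto intro!: power_mono[of _ 2 2, simplified])
  have "\<bar>p\<bar> \<le> norm (fst x) * norm (fst y)" unfolding p_def by (rule Cauchy_Schwarz_ineq2)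
  also have "\<dots> \<le> \<rho> * 2"
    using norm_fst_le_gnorm[of x] norm_fst_le_gnorm[of y] True \<rho> by (intro mult_mono) (auto simp: \<rho>_def)
  finally have p: "\<bar>p\<bar> \<le> 2 * \<rho>" by simp
  have t: "\<bar>t\<bar> \<le> \<rho>\<^sup>2" using snd_le_gnorm[of x] by (simp add: t_def \<rho>_def)
  have "(gnorm y)\<^sup>2 \<le> 2\<^sup>2" using True by (intro power_mono) auto
  then have u: "\<bar>u\<bar> \<le> 4" using snd_le_gnorm[of y] by (simp add: u_def)
  have p2: "p\<^sup>2 \<le> 4 * \<rho>\<^sup>2" using abs_le_square_iff[of p "2 * \<rho>"] p \<rho> by (simp add: power_mult_distrib)
  have b1: "\<bar>h1\<bar> \<le> 32 * \<rho>"
  proof -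
    have "\<bar>h1\<bar> = 4 * (Y * \<bar>p\<bar>)" using Y by (simp add: h1_def abs_mult)
    also have "\<dots> \<le> 4 * (2\<^sup>2 * (2 * \<rho>))" using Y p by (intro mult_left_mono mult_mono) auto
    finally show ?thesis by simp
  qed
  have b2: "\<bar>h2\<bar> \<le> 32 * \<rho>\<^sup>2"
  proof -
    have "0 \<le> Y * X" using X Y by simp
    moreover have "Y * X \<le> 4 * \<rho>\<^sup>2" using X Y by (intro mult_mono) auto
    moreover have "\<bar>t * u\<bar> \<le> \<rho>\<^sup>2 * 4" unfolding abs_mult using t u by (intro mult_mono) auto
    ultimately show ?thesis using p2 zero_le_power2[of p] unfolding h2_def mult.assoc by linarith
  qed
  have r32: "\<rho> ^ 3 \<le> \<rho>\<^sup>2" "\<rho>\<^sup>2 \<le> \<rho>" "\<rho> ^ 4 \<le> \<rho> ^ 3" "\<rho> ^ 3 \<le> \<rho>" "0 \<le> \<rho> ^ 3" "0 \<le> \<rho>\<^sup>2"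
    using \<rho> power_decreasing[of 1 2 \<rho>] power_decreasing[of 2 3 \<rho>] power_decreasing[of 3 4 \<rho>]
      power_decreasing[of 1 3 \<rho>] by auto
  have b3: "\<bar>h3\<bar> \<le> 10 * \<rho> ^ 3"
  proof -
    have "\<bar>X * p\<bar> \<le> \<rho>\<^sup>2 * (2 * \<rho>)" unfolding abs_mult using X p by (intro mult_mono) auto
    moreover have "X\<^sup>2 \<le> (\<rho>\<^sup>2)\<^sup>2" using X by (intro power_mono)
    moreover have "\<bar>t\<bar>\<^sup>2 \<le> (\<rho>\<^sup>2)\<^sup>2" using t by (intro power_mono) auto
    moreover have "(\<rho>\<^sup>2)\<^sup>2 = \<rho> ^ 4" "\<rho>\<^sup>2 * (2 * \<rho>) = 2 * \<rho> ^ 3"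
      by (simp_all add: power2_eq_square power3_eq_cube power4_eq_xxxx)
    ultimately have "\<bar>X * p\<bar> \<le> 2 * \<rho> ^ 3" "X\<^sup>2 \<le> \<rho> ^ 3" "t\<^sup>2 \<le> \<rho> ^ 3" using r32 by auto
    moreover have "0 \<le> X\<^sup>2" "0 \<le> t\<^sup>2" by auto
    ultimately show ?thesis unfolding h3_def mult.assoc by linarith
  qed
  have a: "0 \<le> a" "a \<le> 1" by (auto simp: a_def wt_nonneg wt_le_1)
  have hb: "\<bar>h\<bar> \<le> 74 * \<rho>" using h b1 b2 b3 r32 by linarith
  have bx: "bump x 1 y = (max 0 (1 - (w + h))) ^ 3" and b0: "bump 0 1 y = a ^ 3" and aw: "a = max 0 (1 - w)"
    by (simp_all add: bump_def h_def w_def a_def wt_def)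
  define E where "E = bump x 1 y - a ^ 3 + 3 * a\<^sup>2 * h - 3 * a * h\<^sup>2"
  have E: "\<bar>E\<bar> \<le> (74 * \<rho>) ^ 3"
    using cube_taylor[of w h] power_mono[OF hb, of 3] unfolding E_def bx aw by simp
  \<comment> \<open>Only \<open>h1\<^sup>2\<close> is of second order; the excess
    \<open>h\<^sup>2 - h1\<^sup>2 = (h2 + h3) * (h + h1)\<close> is of third order.\<close>
  have "bump x 1 y - (bump 0 1 y + 12 * (a\<^sup>2 * Y * p)
      + ((48 * a * Y\<^sup>2 * p * p - 3 * a\<^sup>2 * (2 * Y * X + 4 * p * p)) + 6 * t * (a\<^sup>2 * u)))
    = E - 3 * a\<^sup>2 * h3 + 3 * a * ((h2 + h3) * (h + h1))"
    unfolding E_def b0 h h1_def h2_def by (simp add: power2_eq_square power3_eq_cube algebra_simps)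
  \<comment> \<open>The total is 405224 + 30 + 3 * 4452 = 418610, rounded up; the factor 8 of
    \<open>bump_ge\<close> later gives 4000000.\<close>
  moreover have "\<bar>E - 3 * a\<^sup>2 * h3 + 3 * a * ((h2 + h3) * (h + h1))\<bar> \<le> 500000 * \<rho> ^ 3"
  proof -
    have "\<bar>a\<^sup>2 * h3\<bar> \<le> 1 * (10 * \<rho> ^ 3)" unfolding abs_mult
      using b3 a by (intro mult_mono) (auto simp: power_le_one)
    moreover have "\<bar>a * ((h2 + h3) * (h + h1))\<bar> \<le> 1 * ((42 * \<rho>\<^sup>2) * (106 * \<rho>))" unfolding abs_mult
      using b1 b2 b3 hb a r32 by (intro mult_mono) auto
    moreover have "(42 * \<rho>\<^sup>2) * (106 * \<rho>) = 4452 * \<rho> ^ 3" by (simp add: power2_eq_square power3_eq_cube)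
    moreover have "(74 * \<rho>) ^ 3 = 405224 * \<rho> ^ 3" by (simp add: power_mult_distrib)
    ultimately show ?thesis using E r32 by (simp add: abs_if split: if_splits)
  qed
  ultimately have "\<bar>bump x 1 y - (bump 0 1 y + 12 * (a\<^sup>2 * Y * p)
      + ((48 * a * Y\<^sup>2 * p * p - 3 * a\<^sup>2 * (2 * Y * X + 4 * p * p)) + 6 * t * (a\<^sup>2 * u)))\<bar> \<le> 500000 * \<rho> ^ 3"
    by simp
  also have "\<dots> = 4000000 * \<rho> ^ 3 * (1 / 8)" by simp
  also have "\<dots> \<le> 4000000 * \<rho> ^ 3 * bump 0 4 y"
    using True \<rho> by (intro mult_left_mono bump_ge) auto
  finally show ?thesis
    unfolding mom2_fun_def a_def Y_def X_def p_def t_def u_def \<rho>_def norm_power4 by (simp add: dot_square_norm)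
qed

text \<open>Bumps of radius 1 at \<open>x\<close> and at \<open>0\<close> have equal integrals, so
  the terms of order zero cancel and the polynomial is left bounded by the cubic remainder. The
  factor \<open>4 powr s\<close> is the integral of \<open>bump 0 4\<close>.\<close>

lemma moment_expansion:
  fixes \<Lambda> :: "('n::finite par \<Rightarrow> real) \<Rightarrow> real"
  assumes "uniform s \<Lambda>"
  obtains C where "0 < C"
    "\<And>x. x \<in> supp \<Lambda> \<Longrightarrow> gnorm x \<le> 1 \<Longrightarrow>
      \<bar>12 * mom1 \<Lambda> (fst x) + (mom2 \<Lambda> (fst x) (fst x) + 6 * snd x * vmom \<Lambda>)\<bar> \<le> C * gnorm x ^ 3"
proof -
  have pf: "posfun \<Lambda>" and z: "0 \<in> supp \<Lambda>" and un: "\<And>x r. x \<in> supp \<Lambda> \<Longrightarrow> r > 0 \<Longrightarrow> \<Lambda> (bump x r) = r powr s"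
    using assms by (auto simp: uniform_def)
  have "\<bar>12 * mom1 \<Lambda> (fst x) + (mom2 \<Lambda> (fst x) (fst x) + 6 * snd x * vmom \<Lambda>)\<bar>
     \<le> (4000000 * 4 powr s) * gnorm x ^ 3" if x: "x \<in> supp \<Lambda>" "gnorm x \<le> 1" for x
  proof -
    let ?f = "\<lambda>y. (wt y)\<^sup>2 * (norm (fst y))\<^sup>2 * (fst x \<bullet> fst y)"
    let ?v = "\<lambda>y :: 'n par. (wt y)\<^sup>2 * snd y"
    let ?g = "\<lambda>y. bump 0 1 y + 12 * ?f y + (mom2_fun (fst x) (fst x) y + 6 * snd x * ?v y)"
    have t1: "test (\<lambda>y. 12 * ?f y)" by (rule test_cmult[OF test_mom1_fun])
    have t2: "test (\<lambda>y. 6 * snd x * ?v y)" by (rule test_cmult[OF test_vmom_fun])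
    have t3: "test (\<lambda>y. mom2_fun (fst x) (fst x) y + 6 * snd x * ?v y)"
      by (rule test_add[OF test_mom2_fun t2])
    have t4: "test (\<lambda>y. bump 0 1 y + 12 * ?f y)" by (rule test_add[OF test_bump t1]) simp
    have tg: "test ?g" by (rule test_add[OF t4 t3])
    have "\<Lambda> ?g = \<Lambda> (bump 0 1) + 12 * mom1 \<Lambda> (fst x) + (mom2 \<Lambda> (fst x) (fst x) + 6 * snd x * vmom \<Lambda>)"
      using posfun_add[OF pf t4 t3] posfun_add[OF pf test_bump t1] posfun_cmult[OF pf test_mom1_fun]
        posfun_add[OF pf test_mom2_fun t2] posfun_cmult[OF pf test_vmom_fun]
      by (simp add: mom1_def mom2_def vmom_def)
    moreover have "\<Lambda> (bump x 1) = \<Lambda> (bump 0 1)" using un x z by simp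
    moreover have "\<bar>\<Lambda> (\<lambda>y. bump x 1 y - ?g y)\<bar> \<le> \<Lambda> (\<lambda>y. (4000000 * gnorm x ^ 3) * bump 0 4 y)"
      by (rule posfun_abs_le[OF pf test_diff[OF test_bump tg] test_cmult[OF test_bump] bump_expansion[OF x(2)]]) auto
    moreover have "\<Lambda> (\<lambda>y. bump x 1 y - ?g y) = \<Lambda> (bump x 1) - \<Lambda> ?g"
      by (rule posfun_diff[OF pf test_bump tg]) simp
    moreover have "\<Lambda> (\<lambda>y. (4000000 * gnorm x ^ 3) * bump 0 4 y) = (4000000 * gnorm x ^ 3) * 4 powr s"
      using posfun_cmult[OF pf test_bump, of 4] un[OF z, of 4] by simp
    ultimately show ?thesis by (simp add: abs_minus_commute mult_ac) 
  qed
  then show ?thesis by (intro that[of "4000000 * 4 powr s"]) auto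
qed

section \<open>Reduction to full support\<close>

definition plane :: "(real ^ 'n::finite) set \<Rightarrow> bool \<Rightarrow> 'n par set" where
  "plane V b = {z. fst z \<in> V \<and> (b \<or> snd z = 0)}"

section \<open>Transfer of equations and inequalities to tangents\<close>

lemma tangent_le_0:
  assumes "is_tangent s \<Lambda> q M" "continuous_on UNIV h" "z \<in> supp M"
    and "\<And>R. \<exists>C. \<exists>r0>0. \<forall>r z. 0 < r \<longrightarrow> r < r0 \<longrightarrow> gnorm z \<le> R \<longrightarrow> q + dil r z \<in> supp \<Lambda> \<longrightarrow> h z \<le> C * r"
  shows "h z \<le> 0"
  using assms unfolding is_tangent_def by blast

lemma tangent_eq_0:
  fixes h :: "'n::finite par \<Rightarrow> real"
  assumes "is_tangent s \<Lambda> q M" "continuous_on UNIV h" "z \<in> supp M"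
    and "\<And>R. \<exists>C. \<exists>r0>0. \<forall>r z. 0 < r \<longrightarrow> r < r0 \<longrightarrow> gnorm z \<le> R \<longrightarrow> q + dil r z \<in> supp \<Lambda> \<longrightarrow> \<bar>h z\<bar> \<le> C * r"
  shows "h z = 0"
  using tangent_le_0[OF assms(1) _ assms(3), of "\<lambda>z. \<bar>h z\<bar>"] assms(2,4)
  by (auto intro!: continuous_intros)

text \<open>Moments carry the weight \<open>wt\<close>, so they give identities only in the unit
  ball. Blowing up at \<open>0\<close> moves every bounded set into that ball, and homogeneity of
  the zero set makes the identity global.\<close>

lemma tangent_eq_0_local:
  fixes h :: "'n::finite par \<Rightarrow> real"
  assumes t: "is_tangent s \<Lambda> 0 M" and h: "continuous_on UNIV h" and z: "z \<in> supp M"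
    and hom: "\<And>r z. 0 < r \<Longrightarrow> h (dil r z) = 0 \<Longrightarrow> h z = 0"
    and loc: "\<And>y. y \<in> supp \<Lambda> \<Longrightarrow> gnorm y < 1 \<Longrightarrow> h y = 0"
  shows "h z = 0"
proof (rule tangent_eq_0[OF t h z])
  fix R
  show "\<exists>C. \<exists>r0>0. \<forall>r z. 0 < r \<longrightarrow> r < r0 \<longrightarrow> gnorm z \<le> R \<longrightarrow> 0 + dil r z \<in> supp \<Lambda> \<longrightarrow> \<bar>h z\<bar> \<le> C * r"
  proof (rule exI[of _ 0], rule exI[of _ "1 / (\<bar>R\<bar> + 1)"], intro conjI allI impI)
    fix r z assume r: "0 < r" "r < 1 / (\<bar>R\<bar> + 1)" "gnorm z \<le> R" "0 + dil r z \<in> supp \<Lambda>"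
    have "r * gnorm z \<le> r * (\<bar>R\<bar> + 1)" using r by (intro mult_left_mono) auto
    also have "\<dots> < 1" using r by (simp add: field_simps)
    finally have "gnorm (dil r z) < 1" using r by (simp add: gnorm_dil)
    then show "\<bar>h z\<bar> \<le> 0 * r" using hom[OF r(1), of z] loc r by simp
  qed simp
qed

text \<open>The plane is closed, and invariant under dilations and under translation by its
  elements, so its equations hold on the rescaled supports without error. Distance to
  \<open>V\<close> expresses membership by a continuous function.\<close>

lemma tangent_plane:
  assumes t: "is_tangent s \<Lambda> q M" and V: "subspace V" and sub: "supp \<Lambda> \<subseteq> plane V b" and q: "q \<in> supp \<Lambda>"
  shows "supp M \<subseteq> plane V b"
proof
  fix z assume z: "z \<in> supp M"
  have q': "q \<in> plane V b" using q sub by blast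
  have V0: "V \<noteq> {}" "closed V" using V subspace_0 closed_subspace by auto
  have "infdist (fst z) V = 0"
  proof (rule tangent_eq_0[OF t _ z])
    fix R
    have "infdist (fst w) V = 0" if r: "0 < r" "q + dil r w \<in> supp \<Lambda>" for r w
    proof -
      have "fst q + r *\<^sub>R fst w \<in> V" "fst q \<in> V" using r sub q' by (auto simp: plane_def)
      then have "(1 / r) *\<^sub>R ((fst q + r *\<^sub>R fst w) - fst q) \<in> V"
        using V by (intro subspace_scale subspace_diff)
      then show ?thesis using r by simp
    qed
    then show "\<exists>C. \<exists>r0>0. \<forall>r z. 0 < r \<longrightarrow> r < r0 \<longrightarrow> gnorm z \<le> R \<longrightarrow> q + dil r z \<in> supp \<Lambda> \<longrightarrow>
         \<bar>infdist (fst z) V\<bar> \<le> C * r"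
      by (intro exI[of _ 0] exI[of _ 1]) auto
  qed (intro continuous_intros)
  then have 1: "fst z \<in> V" using V0 in_closed_iff_infdist_zero by blast
  have 2: "snd z = 0" if "\<not> b"
  proof (rule tangent_eq_0[OF t _ z])
    fix R
    have "snd w = 0" if r: "0 < r" "q + dil r w \<in> supp \<Lambda>" for r w
    proof -
      have "snd q + r\<^sup>2 * snd w = 0" "snd q = 0" using r sub q' \<open>\<not> b\<close> by (auto simp: plane_def)
      then show ?thesis using r by simp
    qed
    then show "\<exists>C. \<exists>r0>0. \<forall>r z. 0 < r \<longrightarrow> r < r0 \<longrightarrow> gnorm z \<le> R \<longrightarrow> q + dil r z \<in> supp \<Lambda> \<longrightarrow> \<bar>snd z\<bar> \<le> C * r"
      by (intro exI[of _ 0] exI[of _ 1]) auto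
  qed (intro continuous_intros)
  show "z \<in> plane V b" using 1 2 by (auto simp: plane_def)
qed

section \<open>Geometry of tangents: touching balls, half spaces, quadrics\<close>

lemma touching_ball:
  fixes \<Lambda> :: "('n::finite par \<Rightarrow> real) \<Rightarrow> real"
  assumes u: "uniform s \<Lambda>" and p: "p \<notin> supp \<Lambda>"
  obtains q where "q \<in> supp \<Lambda>" "q \<noteq> p" "\<And>y. y \<in> supp \<Lambda> \<Longrightarrow> gnorm (q - p) \<le> gnorm (y - p)"
proof -
  have pf: "posfun \<Lambda>" and 0: "0 \<in> supp \<Lambda>" using u by (auto simp: uniform_def)
  let ?K = "{y. gnorm (y - p) \<le> gnorm (0 - p)} \<inter> supp \<Lambda>"
  have "compact ?K" by (intro compact_Int_closed compact_gball closed_supp[OF pf])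
  moreover have "0 \<in> ?K" using 0 by simp
  then have "?K \<noteq> {}" by blast
  moreover have "continuous_on ?K (\<lambda>y. gnorm (y - p))" by (intro continuous_intros)
  ultimately have "\<exists>q\<in>?K. \<forall>y\<in>?K. gnorm (q - p) \<le> gnorm (y - p)"
    by (intro continuous_attains_inf)
  then obtain q where q: "q \<in> ?K" "\<And>y. y \<in> ?K \<Longrightarrow> gnorm (q - p) \<le> gnorm (y - p)"
    by (metis (no_types, lifting))
  show ?thesis
  proof (rule that)
    show "q \<in> supp \<Lambda>" using q by auto
    then show "q \<noteq> p" using p by auto
    fix y assume y: "y \<in> supp \<Lambda>"
    show "gnorm (q - p) \<le> gnorm (y - p)"
    proof (cases "gnorm (y - p) \<le> gnorm (0 - p)")
      case True then show ?thesis using q y by blast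
    next
      case False
      have "gnorm (q - p) \<le> gnorm (0 - p)" using q by blast
      with False show ?thesis by linarith
    qed
  qed
qed

text \<open>The blow-up at \<open>q\<close> flattens the empty ball around \<open>p\<close>. If
  \<open>a \<noteq> 0\<close>, the term of order \<open>r\<close> decides. If \<open>a = 0\<close>,
  the horizontal contribution has order \<open>r ^ 4\<close>, and the vertical term of order
  \<open>r\<^sup>2\<close> decides.\<close>

lemma half_space:
  fixes \<Lambda> :: "('n::finite par \<Rightarrow> real) \<Rightarrow> real"
  assumes t: "is_tangent s \<Lambda> q M"
    and near: "\<And>y. y \<in> supp \<Lambda> \<Longrightarrow> gnorm (q - p) \<le> gnorm (y - p)" and z: "z \<in> supp M"
  shows "fst (p - q) \<bullet> fst z \<le> 0" "fst (p - q) = 0 \<Longrightarrow> snd (p - q) * snd z \<le> 0"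
proof -
  define a where "a = fst (p - q)"
  define \<tau> where "\<tau> = snd (p - q)"
  \<comment> \<open>Expansion of \<open>gnorm (q + dil r z - p) ^ 4 \<ge> gnorm (q - p) ^ 4\<close>;
    the only term of order \<open>r\<close> stands on the left.\<close>
  have key: "4 * r * (a \<bullet> a) * (a \<bullet> fst z) \<le> 2 * (a \<bullet> a) * r\<^sup>2 * (fst z \<bullet> fst z)
      + (r\<^sup>2 * (fst z \<bullet> fst z) - 2 * r * (a \<bullet> fst z))\<^sup>2 + r ^ 4 * (snd z)\<^sup>2 - 2 * r\<^sup>2 * (\<tau> * snd z)"
    if "q + dil r z \<in> supp \<Lambda>" for r z
  proof -
    have "gnorm (q - p) ^ 4 \<le> gnorm ((q + dil r z) - p) ^ 4"
      using near[OF that] by (intro power_mono) auto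
    moreover have "q - p = - (a, \<tau>)" "(q + dil r z) - p = (r *\<^sub>R fst z - a, r\<^sup>2 * snd z - \<tau>)"
      by (auto simp: a_def \<tau>_def prod_eq_iff)
    ultimately have "(a \<bullet> a)\<^sup>2 + \<tau>\<^sup>2 \<le> ((r *\<^sub>R fst z - a) \<bullet> (r *\<^sub>R fst z - a))\<^sup>2 + (r\<^sup>2 * snd z - \<tau>)\<^sup>2"
      by (simp add: gnorm_power4 norm_power4)
    then show ?thesis
      by (simp add: inner_diff_left inner_diff_right inner_commute power2_eq_square power4_eq_xxxx algebra_simps)
  qed
  have bnd: "norm (fst z) \<le> \<bar>R\<bar>" "\<bar>snd z\<bar> \<le> R\<^sup>2" if "gnorm z \<le> R" for z :: "'n par" and R
  proof -
    show "norm (fst z) \<le> \<bar>R\<bar>" using norm_fst_le_gnorm[of z] that by linarith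
    have "(gnorm z)\<^sup>2 \<le> R\<^sup>2" using that by (intro power_mono) auto
    then show "\<bar>snd z\<bar> \<le> R\<^sup>2" using snd_le_gnorm[of z] by linarith
  qed
  show "fst (p - q) \<bullet> fst z \<le> 0"
  proof (cases "a = 0")
    case False
    have "(a \<bullet> a) * (a \<bullet> fst z) \<le> 0"
    proof (rule tangent_le_0[OF t _ z])
      fix R
      define C where "C = 2 * (a \<bullet> a) * R\<^sup>2 + (R\<^sup>2 + 2 * (norm a * \<bar>R\<bar>))\<^sup>2 + (R\<^sup>2)\<^sup>2 + 2 * (\<bar>\<tau>\<bar> * R\<^sup>2)"
      have "(a \<bullet> a) * (a \<bullet> fst z) \<le> C / 4 * r"
        if r: "0 < r" "r < 1" "gnorm z \<le> R" "q + dil r z \<in> supp \<Lambda>" for r z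
      proof -
        have z1: "0 \<le> fst z \<bullet> fst z" "fst z \<bullet> fst z \<le> R\<^sup>2"
          using bnd(1)[OF r(3)] by (auto simp: dot_square_norm abs_le_square_iff[symmetric])
        have az: "\<bar>a \<bullet> fst z\<bar> \<le> norm a * \<bar>R\<bar>"
          using Cauchy_Schwarz_ineq2[of a "fst z"] mult_left_mono[OF bnd(1)[OF r(3)], of "norm a"] by simp
        have t1: "2 * (a \<bullet> a) * r\<^sup>2 * (fst z \<bullet> fst z) \<le> 2 * (a \<bullet> a) * r\<^sup>2 * R\<^sup>2"
          using z1 by (intro mult_left_mono) auto
        have "\<bar>r\<^sup>2 * (fst z \<bullet> fst z) - 2 * r * (a \<bullet> fst z)\<bar> \<le> r * (R\<^sup>2 + 2 * (norm a * \<bar>R\<bar>))"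
        proof -
          have "r\<^sup>2 * (fst z \<bullet> fst z) \<le> r * R\<^sup>2"
            using r z1 by (intro mult_mono) (auto simp: power2_eq_square)
          moreover have "\<bar>r * (a \<bullet> fst z)\<bar> \<le> r * (norm a * \<bar>R\<bar>)"
            using r az by (simp add: abs_mult)
          moreover have "0 \<le> r\<^sup>2 * (fst z \<bullet> fst z)" using z1 by simp
          ultimately show ?thesis unfolding distrib_left mult.assoc by linarith
        qed
        then have t2: "(r\<^sup>2 * (fst z \<bullet> fst z) - 2 * r * (a \<bullet> fst z))\<^sup>2 \<le> (r * (R\<^sup>2 + 2 * (norm a * \<bar>R\<bar>)))\<^sup>2"
          by (metis abs_ge_zero power2_abs power_mono)
        have t3: "r ^ 4 * (snd z)\<^sup>2 \<le> r\<^sup>2 * (R\<^sup>2)\<^sup>2"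
        proof (intro mult_mono)
          show "r ^ 4 \<le> r\<^sup>2" using r by (intro power_decreasing) auto
          show "(snd z)\<^sup>2 \<le> (R\<^sup>2)\<^sup>2" using power_mono[OF bnd(2)[OF r(3)], of 2] by simp
        qed auto
        have "\<bar>\<tau> * snd z\<bar> \<le> \<bar>\<tau>\<bar> * R\<^sup>2" unfolding abs_mult using bnd(2)[OF r(3)] by (intro mult_left_mono) auto
        then have "- (\<tau> * snd z) \<le> \<bar>\<tau>\<bar> * R\<^sup>2" by linarith
        then have t4: "r\<^sup>2 * - (\<tau> * snd z) \<le> r\<^sup>2 * (\<bar>\<tau>\<bar> * R\<^sup>2)" by (rule mult_left_mono) simp
        have "4 * r * (a \<bullet> a) * (a \<bullet> fst z) \<le> r\<^sup>2 * C"
          using key[OF r(4)] t1 t2 t3 t4 unfolding C_def power_mult_distrib by (simp add: algebra_simps)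
        then have "r * ((a \<bullet> a) * (a \<bullet> fst z)) \<le> r * (C / 4 * r)" by (simp add: power2_eq_square algebra_simps)
        then show ?thesis using r by simp
      qed
      then show "\<exists>C. \<exists>r0>0. \<forall>r z. 0 < r \<longrightarrow> r < r0 \<longrightarrow> gnorm z \<le> R \<longrightarrow> q + dil r z \<in> supp \<Lambda> \<longrightarrow>
          (a \<bullet> a) * (a \<bullet> fst z) \<le> C * r"
        by (intro exI[of _ "C / 4"] exI[of _ 1]) simp
    qed (intro continuous_intros)
    moreover have "0 < a \<bullet> a" using False by simp
    ultimately have "a \<bullet> fst z \<le> 0" by (metis mult_le_0_iff not_le)
    then show ?thesis by (simp add: a_def)
  qed (simp add: a_def)
  show "snd (p - q) * snd z \<le> 0" if "fst (p - q) = 0"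
  proof -
    have a0: "a = 0" using that by (simp add: a_def)
    have "\<tau> * snd z \<le> 0"
    proof (rule tangent_le_0[OF t _ z])
      fix R
      have "\<tau> * snd z \<le> (\<bar>R\<bar> ^ 4 + (R\<^sup>2)\<^sup>2) / 2 * r"
        if r: "0 < r" "r < 1" "gnorm z \<le> R" "q + dil r z \<in> supp \<Lambda>" for r z
      proof -
        have "2 * r\<^sup>2 * (\<tau> * snd z) \<le> (r\<^sup>2 * (fst z \<bullet> fst z))\<^sup>2 + r ^ 4 * (snd z)\<^sup>2"
          using key[OF r(4)] a0 by simp
        then have "r\<^sup>2 * (2 * (\<tau> * snd z)) \<le> r\<^sup>2 * (r\<^sup>2 * (norm (fst z) ^ 4 + (snd z)\<^sup>2))"
          unfolding norm_power4 by (simp add: power2_eq_square power4_eq_xxxx algebra_simps)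
        then have "2 * (\<tau> * snd z) \<le> r\<^sup>2 * (norm (fst z) ^ 4 + (snd z)\<^sup>2)"
          using r by (subst (asm) mult_le_cancel_left_pos) auto
        also have "\<dots> \<le> r * (\<bar>R\<bar> ^ 4 + (R\<^sup>2)\<^sup>2)"
        proof (intro mult_mono add_mono)
          show "(snd z)\<^sup>2 \<le> (R\<^sup>2)\<^sup>2" using power_mono[OF bnd(2)[OF r(3)], of 2] by simp
          show "norm (fst z) ^ 4 \<le> \<bar>R\<bar> ^ 4" by (rule power_mono[OF bnd(1)[OF r(3)]]) simp
        qed (use r in \<open>auto simp: power2_eq_square\<close>)
        finally show ?thesis by (simp add: mult.commute)
      qed
      then show "\<exists>C. \<exists>r0>0. \<forall>r z. 0 < r \<longrightarrow> r < r0 \<longrightarrow> gnorm z \<le> R \<longrightarrow> q + dil r z \<in> supp \<Lambda> \<longrightarrow> \<tau> * snd z \<le> C * r"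
        by (intro exI[of _ "(\<bar>R\<bar> ^ 4 + (R\<^sup>2)\<^sup>2) / 2"] exI[of _ 1]) simp
    qed (intro continuous_intros)
    then show ?thesis by (simp add: \<tau>_def)
  qed
qed

text \<open>The other moments have degree two, so on the support of \<open>\<Lambda>\<close> near
  \<open>0\<close> the linear form is bounded by a multiple of \<open>(gnorm x)\<^sup>2\<close>.
  Along \<open>dil r z\<close> it scales by \<open>r\<close>, which leaves an error of order
  \<open>r\<close>.\<close>

lemma tangent_mom1:
  assumes u: "uniform s \<Lambda>" and t: "is_tangent s \<Lambda> 0 M" and z: "z \<in> supp M"
  shows "mom1 \<Lambda> (fst z) = 0"
proof (rule tangent_eq_0[OF t _ z])
  have pf: "posfun \<Lambda>" using u by (simp add: uniform_def)
  have lin: "linear (mom1 \<Lambda>)" by (rule linear_mom1[OF pf])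
  show "continuous_on UNIV (\<lambda>z. mom1 \<Lambda> (fst z))"
    by (rule continuous_on_compose2[OF linear_continuous_on[OF linear_linear[THEN iffD2, OF lin], of UNIV]])
      (auto intro!: continuous_intros)
  obtain K where K: "\<And>x y. norm (mom2 \<Lambda> x y) \<le> norm x * norm y * K" "0 \<le> K"
    using bounded_bilinear.nonneg_bounded[OF bounded_bilinear_mom2[OF pf]] by metis
  obtain C where C: "C > 0" and ex: "\<And>x. x \<in> supp \<Lambda> \<Longrightarrow> gnorm x \<le> 1 \<Longrightarrow>
      \<bar>12 * mom1 \<Lambda> (fst x) + (mom2 \<Lambda> (fst x) (fst x) + 6 * snd x * vmom \<Lambda>)\<bar> \<le> C * gnorm x ^ 3"
    using moment_expansion[OF u] by metis
  fix R
  define D where "D = C + K + 6 * \<bar>vmom \<Lambda>\<bar>"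
  have small: "\<bar>12 * mom1 \<Lambda> (fst x)\<bar> \<le> D * (gnorm x)\<^sup>2" if x: "x \<in> supp \<Lambda>" "gnorm x \<le> 1" for x
  proof -
    have "gnorm x ^ 3 \<le> (gnorm x)\<^sup>2" using x by (intro power_decreasing) auto
    then have "C * gnorm x ^ 3 \<le> C * (gnorm x)\<^sup>2" using C by simp
    moreover have "\<bar>mom2 \<Lambda> (fst x) (fst x)\<bar> \<le> K * (gnorm x)\<^sup>2"
    proof -
      have "norm (fst x) * norm (fst x) \<le> (gnorm x)\<^sup>2"
        unfolding power2_eq_square by (intro mult_mono norm_fst_le_gnorm) auto
      then show ?thesis using K(1)[of "fst x" "fst x"] mult_right_mono[OF _ K(2)] by (fastforce simp: mult.commute)
    qed
    moreover have "\<bar>6 * snd x * vmom \<Lambda>\<bar> \<le> 6 * \<bar>vmom \<Lambda>\<bar> * (gnorm x)\<^sup>2"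
      using mult_right_mono[OF snd_le_gnorm[of x], of "6 * \<bar>vmom \<Lambda>\<bar>"] by (simp add: abs_mult mult_ac)
    ultimately show ?thesis using ex[OF x] unfolding D_def distrib_right by linarith
  qed
  have "\<bar>mom1 \<Lambda> (fst z)\<bar> \<le> D * R\<^sup>2 * r"
    if r: "0 < r" "r < 1 / (\<bar>R\<bar> + 1)" "gnorm z \<le> R" "0 + dil r z \<in> supp \<Lambda>" for r z
  proof -
    have "r * gnorm z \<le> r * (\<bar>R\<bar> + 1)" using r by (intro mult_left_mono) auto
    also have "\<dots> < 1" using r by (simp add: field_simps)
    finally have g: "gnorm (dil r z) \<le> 1" using r by (simp add: gnorm_dil)
    have D: "0 \<le> D" using C K by (simp add: D_def)
    have "r * \<bar>mom1 \<Lambda> (fst z)\<bar> = \<bar>mom1 \<Lambda> (fst (dil r z))\<bar>"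
      using r by (simp add: linear_cmul[OF lin] abs_mult)
    also have "\<dots> \<le> \<bar>12 * mom1 \<Lambda> (fst (dil r z))\<bar>" by simp
    also have "\<dots> \<le> D * (gnorm (dil r z))\<^sup>2" using g r by (intro small) auto
    also have "\<dots> = r * (D * (gnorm z)\<^sup>2 * r)" using r by (simp add: gnorm_dil power2_eq_square)
    also have "\<dots> \<le> r * (D * R\<^sup>2 * r)" using r D by (intro mult_left_mono mult_right_mono power_mono) auto
    finally show ?thesis using r by simp
  qed
  then show "\<exists>C. \<exists>r0>0. \<forall>r z. 0 < r \<longrightarrow> r < r0 \<longrightarrow> gnorm z \<le> R \<longrightarrow> 0 + dil r z \<in> supp \<Lambda> \<longrightarrow>
      \<bar>mom1 \<Lambda> (fst z)\<bar> \<le> C * r"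
    by (intro exI[of _ "D * R\<^sup>2"] exI[of _ "1 / (\<bar>R\<bar> + 1)"]) auto
qed

text \<open>Without the linear term, both remaining terms scale by \<open>r\<^sup>2\<close> while
  the error is cubic, so the blow-up makes the relation exact.\<close>

lemma tangent_quadric:
  assumes u: "uniform s \<Lambda>" and t: "is_tangent s \<Lambda> 0 M" and z: "z \<in> supp M"
    and V: "subspace V" "supp \<Lambda> \<subseteq> plane V b" and m0: "\<And>v. v \<in> V \<Longrightarrow> mom1 \<Lambda> v = 0"
  shows "mom2 \<Lambda> (fst z) (fst z) + 6 * snd z * vmom \<Lambda> = 0"
proof (rule tangent_eq_0[OF t _ z])
  have pf: "posfun \<Lambda>" using u by (simp add: uniform_def)
  note bb = bounded_bilinear_mom2[OF pf]
  show "continuous_on UNIV (\<lambda>z. mom2 \<Lambda> (fst z) (fst z) + 6 * snd z * vmom \<Lambda>)"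
    by (intro continuous_intros bounded_bilinear.continuous_on[OF bb])
  obtain C where C: "C > 0" and ex: "\<And>x. x \<in> supp \<Lambda> \<Longrightarrow> gnorm x \<le> 1 \<Longrightarrow>
      \<bar>12 * mom1 \<Lambda> (fst x) + (mom2 \<Lambda> (fst x) (fst x) + 6 * snd x * vmom \<Lambda>)\<bar> \<le> C * gnorm x ^ 3"
    using moment_expansion[OF u] by metis
  fix R
  have "\<bar>mom2 \<Lambda> (fst z) (fst z) + 6 * snd z * vmom \<Lambda>\<bar> \<le> C * R ^ 3 * r"
    if r: "0 < r" "r < 1 / (\<bar>R\<bar> + 1)" "gnorm z \<le> R" "0 + dil r z \<in> supp \<Lambda>" for r z
  proof -
    have "r * gnorm z \<le> r * (\<bar>R\<bar> + 1)" using r by (intro mult_left_mono) auto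
    also have "\<dots> < 1" using r by (simp add: field_simps)
    finally have g: "gnorm (dil r z) \<le> 1" using r by (simp add: gnorm_dil)
    have "mom1 \<Lambda> (fst (dil r z)) = 0" using m0 V r by (auto simp: plane_def)
    then have "\<bar>mom2 \<Lambda> (fst (dil r z)) (fst (dil r z)) + 6 * snd (dil r z) * vmom \<Lambda>\<bar> \<le> C * gnorm (dil r z) ^ 3"
      using ex[of "dil r z"] g r by simp
    moreover have "mom2 \<Lambda> (fst (dil r z)) (fst (dil r z)) + 6 * snd (dil r z) * vmom \<Lambda>
        = r\<^sup>2 * (mom2 \<Lambda> (fst z) (fst z) + 6 * snd z * vmom \<Lambda>)"
      by (simp add: bounded_bilinear.scaleR_left[OF bb] bounded_bilinear.scaleR_right[OF bb]
          power2_eq_square algebra_simps)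
    ultimately have "r\<^sup>2 * \<bar>mom2 \<Lambda> (fst z) (fst z) + 6 * snd z * vmom \<Lambda>\<bar> \<le> C * (r * gnorm z) ^ 3"
      using r by (simp add: abs_mult gnorm_dil)
    also have "\<dots> = r\<^sup>2 * (C * gnorm z ^ 3 * r)" by (simp add: power2_eq_square power3_eq_cube)
    finally have "\<bar>mom2 \<Lambda> (fst z) (fst z) + 6 * snd z * vmom \<Lambda>\<bar> \<le> C * gnorm z ^ 3 * r" using r by simp
    also have "\<dots> \<le> C * R ^ 3 * r" using r C by (intro mult_left_mono mult_right_mono power_mono) auto
    finally show ?thesis .
  qed
  then show "\<exists>C. \<exists>r0>0. \<forall>r z. 0 < r \<longrightarrow> r < r0 \<longrightarrow> gnorm z \<le> R \<longrightarrow> 0 + dil r z \<in> supp \<Lambda> \<longrightarrow>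
      \<bar>mom2 \<Lambda> (fst z) (fst z) + 6 * snd z * vmom \<Lambda>\<bar> \<le> C * r"
    by (intro exI[of _ "C * R ^ 3"] exI[of _ "1 / (\<bar>R\<bar> + 1)"]) auto
qed

text \<open>From \<open>x\<close> to \<open>x + dil r z\<close> the defining function changes by
  \<open>2 * r * B (fst x) (fst z)\<close> plus terms of order \<open>r\<^sup>2\<close>, the height
  among them. Only the horizontal derivative survives.\<close>

lemma quadric_tangent:
  fixes B :: "real ^ 'n \<Rightarrow> real ^ 'n::finite \<Rightarrow> real"
  assumes bb: "bounded_bilinear B" and sym: "\<And>x y. B x y = B y x"
    and quad: "\<And>x. x \<in> supp \<Lambda> \<Longrightarrow> B (fst x) (fst x) + c * snd x = 0"
    and x: "x \<in> supp \<Lambda>" and t: "is_tangent s \<Lambda> x M" and z: "z \<in> supp M"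
  shows "B (fst x) (fst z) = 0"
proof (rule tangent_eq_0[OF t _ z])
  show "continuous_on UNIV (\<lambda>z. B (fst x) (fst z))"
    by (intro continuous_intros bounded_bilinear.continuous_on[OF bb])
  obtain K where K: "\<And>x y. norm (B x y) \<le> norm x * norm y * K" "0 \<le> K"
    using bounded_bilinear.nonneg_bounded[OF bb] by metis
  fix R
  have "\<bar>B (fst x) (fst z)\<bar> \<le> (K * R\<^sup>2 + \<bar>c\<bar> * R\<^sup>2) * r"
    if r: "0 < r" "r < 1" "gnorm z \<le> R" "x + dil r z \<in> supp \<Lambda>" for r z
  proof -
    have "B (fst x + r *\<^sub>R fst z) (fst x + r *\<^sub>R fst z) + c * (snd x + r\<^sup>2 * snd z) = 0"
      using quad[OF r(4)] by simp
    then have "r * (2 * B (fst x) (fst z)) = r * (- (r * (B (fst z) (fst z) + c * snd z)))"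
      using quad[OF x] sym[of "fst z" "fst x"]
      by (simp add: bounded_bilinear.add_left[OF bb] bounded_bilinear.add_right[OF bb]
          bounded_bilinear.scaleR_left[OF bb] bounded_bilinear.scaleR_right[OF bb] power2_eq_square algebra_simps)
    then have "2 * B (fst x) (fst z) = - (r * (B (fst z) (fst z) + c * snd z))"
      using r by (subst (asm) mult_left_cancel) auto
    then have "2 * \<bar>B (fst x) (fst z)\<bar> = r * \<bar>B (fst z) (fst z) + c * snd z\<bar>"
      using r by (metis abs_minus_cancel abs_mult abs_numeral abs_of_pos)
    also have "\<dots> \<le> r * (K * R\<^sup>2 + \<bar>c\<bar> * R\<^sup>2)"
    proof (intro mult_left_mono order.trans[OF abs_triangle_ineq] add_mono)
      have gR: "(gnorm z)\<^sup>2 \<le> R\<^sup>2" using r by (intro power_mono) auto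
      have "norm (fst z) * norm (fst z) \<le> (gnorm z)\<^sup>2"
        unfolding power2_eq_square by (intro mult_mono norm_fst_le_gnorm) auto
      then have "norm (fst z) * norm (fst z) * K \<le> R\<^sup>2 * K" using gR K by (intro mult_right_mono) auto
      then show "\<bar>B (fst z) (fst z)\<bar> \<le> K * R\<^sup>2" using K(1)[of "fst z" "fst z"] by (simp add: mult.commute)
      show "\<bar>c * snd z\<bar> \<le> \<bar>c\<bar> * R\<^sup>2"
        unfolding abs_mult using snd_le_gnorm[of z] gR by (intro mult_left_mono) auto
    qed (use r in auto)
    finally show ?thesis by (simp add: mult.commute)
  qed
  then show "\<exists>C. \<exists>r0>0. \<forall>r z. 0 < r \<longrightarrow> r < r0 \<longrightarrow> gnorm z \<le> R \<longrightarrow> x + dil r z \<in> supp \<Lambda> \<longrightarrow>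
      \<bar>B (fst x) (fst z)\<bar> \<le> C * r"
    by (intro exI[of _ "K * R\<^sup>2 + \<bar>c\<bar> * R\<^sup>2"] exI[of _ 1]) auto
qed

section \<open>Descent to a minimal subgroup\<close>

lemma dim_kernel_less:
  fixes V :: "(real ^ 'n::finite) set" and l :: "real ^ 'n \<Rightarrow> real"
  assumes V: "subspace V" and l: "linear l" and v: "v \<in> V" "l v \<noteq> 0"
  shows "subspace {x \<in> V. l x = 0}" "dim {x \<in> V. l x = 0} < dim V"
proof -
  show s: "subspace {x \<in> V. l x = 0}"
    using V unfolding subspace_def by (auto simp: linear_0[OF l] linear_add[OF l] linear_cmul[OF l])
  have "{x \<in> V. l x = 0} \<subset> V" using v by blast
  then have "span {x \<in> V. l x = 0} \<subset> span V" using s V by (metis span_eq_iff)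
  then show "dim {x \<in> V. l x = 0} < dim V" by (rule dim_psubset)
qed

text \<open>The minimised rank is \<open>dim V\<close>, plus one for the vertical axis. Passing to
  the kernel of a linear form on \<open>V\<close> or dropping the axis lowers it, so every way of
  leaving part of the plane uncovered must end in one of these two.\<close>

lemma full_support:
  fixes \<Lambda>0 :: "('n::finite par \<Rightarrow> real) \<Rightarrow> real"
  assumes "uniform s \<Lambda>0"
  obtains V b \<Lambda> where "subspace (V :: (real ^ 'n) set)" "uniform s \<Lambda>" "supp \<Lambda> = plane V b"
proof -
  define P where "P k \<longleftrightarrow> (\<exists>(V :: (real ^ 'n) set) b \<Lambda>. subspace V \<and> uniform s \<Lambda> \<and> supp \<Lambda> \<subseteq> plane V b \<and>
     k = dim V + (if b then 1 else 0))" for k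
  have "P (dim (UNIV :: (real ^ 'n) set) + 1)"
    unfolding P_def by (rule exI[of _ UNIV], rule exI[of _ True], rule exI[of _ \<Lambda>0]) (use assms in \<open>auto simp: plane_def\<close>)
  then have "P (LEAST k. P k)" by (rule LeastI)
  then obtain V b \<Lambda> where V: "subspace (V :: (real ^ 'n) set)" and u: "uniform s \<Lambda>"
    and sub: "supp \<Lambda> \<subseteq> plane V b" and least: "(LEAST k. P k) = dim V + (if b then 1 else 0)"
    unfolding P_def by blast
  have min: "dim V + (if b then 1 else 0) \<le> dim V' + (if b' then 1 else 0)"
    if "subspace V'" "uniform s M" "supp M \<subseteq> plane V' b'" for V' :: "(real ^ 'n) set" and b' M
    unfolding least[symmetric] P_def
    by (rule Least_le, rule exI[of _ V'], rule exI[of _ b'], rule exI[of _ M]) (use that in simp)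
  \<comment> \<open>The kernel of \<open>l\<close> would give a smaller rank. Since \<open>M\<close>
    is arbitrary, this applies to tangents of \<open>\<Lambda>\<close> and to tangents of
    those.\<close>
  have min1: "l v = 0" if M: "uniform s M" "supp M \<subseteq> plane V b" and l: "linear l"
    and 0: "\<And>z. z \<in> supp M \<Longrightarrow> l (fst z) = 0" and v: "v \<in> V" for M v and l :: "real ^ 'n \<Rightarrow> real"
  proof (rule ccontr)
    assume "l v \<noteq> 0"
    note k = dim_kernel_less[OF V l v this]
    have "supp M \<subseteq> plane {x \<in> V. l x = 0} b" using M 0 by (auto simp: plane_def)
    from min[OF k(1) M(1) this] k(2) show False by (simp split: if_splits)
  qed
  have min2: False if M: "uniform s M" "supp M \<subseteq> plane V b" "b"
    and 0: "\<And>z. z \<in> supp M \<Longrightarrow> snd z = 0" for M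
  proof -
    have "supp M \<subseteq> plane V False" using M 0 by (auto simp: plane_def)
    from min[OF V M(1) this] \<open>b\<close> show False by simp
  qed
  have "supp \<Lambda> = plane V b"
  proof (rule ccontr)
    assume "supp \<Lambda> \<noteq> plane V b"
    then obtain p where p: "p \<in> plane V b" "p \<notin> supp \<Lambda>" using sub by blast
    obtain q where q: "q \<in> supp \<Lambda>" "q \<noteq> p" and near: "\<And>y. y \<in> supp \<Lambda> \<Longrightarrow> gnorm (q - p) \<le> gnorm (y - p)"
      using touching_ball[OF u p(2)] by metis
    obtain \<Lambda>1 where t1: "is_tangent s \<Lambda> q \<Lambda>1" and u1: "uniform s \<Lambda>1" by (rule tangent_exists[OF u q(1)])
    have sub1: "supp \<Lambda>1 \<subseteq> plane V b" by (rule tangent_plane[OF t1 V sub q(1)])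
    have pf1: "posfun \<Lambda>1" and z1: "0 \<in> supp \<Lambda>1" using u1 by (auto simp: uniform_def)
    \<comment> \<open>The touching point gives \<open>\<Lambda>1\<close> a half space, but the
      moment relations of \<open>\<Lambda>1\<close> become exact only on its own blow-up. Minimality
      for \<open>\<Lambda>2\<close> then returns information about the moments of
      \<open>\<Lambda>1\<close>.\<close>
    obtain \<Lambda>2 where t2: "is_tangent s \<Lambda>1 0 \<Lambda>2" and u2: "uniform s \<Lambda>2" by (rule tangent_exists[OF u1 z1])
    have sub2: "supp \<Lambda>2 \<subseteq> plane V b" by (rule tangent_plane[OF t2 V sub1 z1])
    have m0: "mom1 \<Lambda>1 v = 0" if "v \<in> V" for v
      by (rule min1[OF u2 sub2 linear_mom1[OF pf1] tangent_mom1[OF u1 t2] that])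
    have qp: "q \<in> plane V b" using q sub by blast
    define a where "a = fst (p - q)"
    define \<tau> where "\<tau> = snd (p - q)"
    have aV: "a \<in> V" using p qp V by (auto simp: plane_def a_def intro: subspace_diff)
    show False
    proof (cases "a = 0")
      case False
      let ?f = "\<lambda>y :: 'n par. (wt y)\<^sup>2 * (norm (fst y))\<^sup>2 * (a \<bullet> fst y)"
      have le: "a \<bullet> fst y \<le> 0" if "y \<in> supp \<Lambda>1" for y
        using half_space(1)[OF t1 near that] by (simp add: a_def)
      \<comment> \<open>\<open>mom1 \<Lambda>1 a = 0\<close> integrates a function of constant sign,
        so the integrand vanishes on the support. Where its factor \<open>norm (fst y)\<close> is
        zero, \<open>a \<bullet> fst y\<close> is zero as well.\<close>
      have zero: "a \<bullet> fst y = 0" if y: "y \<in> supp \<Lambda>1" "gnorm y < 1" for y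
      proof -
        have "(\<lambda>y. -1 * ?f y) y = 0"
        proof (rule posfun_eq_0_supp[OF pf1 test_cmult[OF test_mom1_fun] _ _ y(1)])
          show "0 \<le> -1 * ?f y" if "y \<in> supp \<Lambda>1" for y
            using le[OF that] by (simp add: mult_nonneg_nonpos)
          show "\<Lambda>1 (\<lambda>y. -1 * ?f y) = 0"
            unfolding posfun_cmult[OF pf1 test_mom1_fun] using m0[OF aV] by (simp add: mom1_def)
        qed
        then show ?thesis using wt_pos[OF y(2)] by auto
      qed
      have "a \<bullet> fst z = 0" if "z \<in> supp \<Lambda>2" for z
        by (rule tangent_eq_0_local[OF t2 _ that _ zero]) (auto intro!: continuous_intros)
      from min1[OF u2 sub2 bounded_linear.linear[OF bounded_linear_inner_right] this aV] False
      show False by simp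
    next
      case True
      have "\<tau> \<noteq> 0" using True q by (auto simp: a_def \<tau>_def prod_eq_iff)
      then have b: b using p qp by (auto simp: plane_def \<tau>_def)
      let ?f = "\<lambda>y :: 'n par. (wt y)\<^sup>2 * snd y"
      have le: "\<tau> * snd y \<le> 0" if "y \<in> supp \<Lambda>1" for y
        using half_space(2)[OF t1 near that] True by (simp add: a_def \<tau>_def)
      show False
      proof (cases "vmom \<Lambda>1 = 0")
        case v0: True
        have zero: "snd y = 0" if y: "y \<in> supp \<Lambda>1" "gnorm y < 1" for y
        proof -
          have "(\<lambda>y. - \<tau> * ?f y) y = 0"
          proof (rule posfun_eq_0_supp[OF pf1 test_cmult[OF test_vmom_fun] _ _ y(1)])
            show "0 \<le> - \<tau> * ?f y" if "y \<in> supp \<Lambda>1" for y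
              using mult_nonneg_nonpos[OF zero_le_power2[of "wt y"] le[OF that]] by (simp add: mult_ac)
            show "\<Lambda>1 (\<lambda>y. - \<tau> * ?f y) = 0"
              unfolding posfun_cmult[OF pf1 test_vmom_fun] using v0 by (simp add: vmom_def)
          qed
          then show ?thesis using wt_pos[OF y(2)] \<open>\<tau> \<noteq> 0\<close> by auto
        qed
        have "snd z = 0" if "z \<in> supp \<Lambda>2" for z
          by (rule tangent_eq_0_local[OF t2 _ that _ zero]) (auto intro!: continuous_intros)
        then show False by (rule min2[OF u2 sub2 b])
      next
        case v: False
        have quad: "mom2 \<Lambda>1 (fst z) (fst z) + (6 * vmom \<Lambda>1) * snd z = 0" if "z \<in> supp \<Lambda>2" for z
          using tangent_quadric[OF u1 t2 that V sub1 m0] by (simp add: mult_ac)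
        have "snd x = 0" if x: "x \<in> supp \<Lambda>2" for x
        proof -
          obtain \<Lambda>3 where t3: "is_tangent s \<Lambda>2 x \<Lambda>3" and u3: "uniform s \<Lambda>3" by (rule tangent_exists[OF u2 x])
          have sub3: "supp \<Lambda>3 \<subseteq> plane V b" by (rule tangent_plane[OF t3 V sub2 x])
          have "mom2 \<Lambda>1 (fst x) (fst z) = 0" if "z \<in> supp \<Lambda>3" for z
            by (rule quadric_tangent[OF bounded_bilinear_mom2[OF pf1] mom2_commute quad x t3 that])
          \<comment> \<open>By minimality for \<open>\<Lambda>3\<close> the form
            \<open>mom2 \<Lambda>1 (fst x)\<close> vanishes on all of \<open>V\<close>, which
            contains \<open>fst x\<close> itself. The quadric equation then leaves
            \<open>snd x = 0\<close>.\<close>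
          from min1[OF u3 sub3 linear_mom2[OF pf1] this, of "fst x"]
          have "mom2 \<Lambda>1 (fst x) (fst x) = 0" using x sub2 by (auto simp: plane_def)
          then show ?thesis using quad[OF x] v by simp
        qed
        then show False by (rule min2[OF u2 sub2 b])
      qed
    qed
  qed
  then show ?thesis using that V u by blast
qed

section \<open>Homogeneous dimension\<close>

lemma powr_bounded_imp_nonpos:
  fixes d C :: real
  assumes "\<And>n::nat. 1 \<le> n \<Longrightarrow> real n powr d \<le> C"
  shows "d \<le> 0"
proof (rule ccontr)
  assume "\<not> d \<le> 0"
  then have d: "0 < d" by simp
  obtain n :: nat where n: "1 + (\<bar>C\<bar> + 1) powr (1 / d) \<le> real n"
    using real_arch_simple by blast
  have "\<bar>C\<bar> + 1 = ((\<bar>C\<bar> + 1) powr (1 / d)) powr d"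
    using d by (simp add: powr_powr)
  also have "\<dots> \<le> real n powr d" using n d by (intro powr_mono2) auto
  also have "\<dots> \<le> C"
  proof (rule assms)
    have "1 \<le> real n" using n powr_ge_zero[of "\<bar>C\<bar> + 1" "1 / d"] by linarith
    then show "1 \<le> n" by simp
  qed
  finally show False by linarith
qed

text \<open>Packing and covering by lattice points in an orthonormal basis of \<open>V\<close>.
  Small bumps at separated points have disjoint positivity sets, which bounds
  \<open>N powr Q\<close> by a multiple of \<open>N powr s\<close>; bumps of a fixed larger radius
  cover the support in the \<open>N\<close>-ball, which gives the reverse bound.\<close>

lemma full_dimension:
  fixes \<Lambda> :: "('n::finite par \<Rightarrow> real) \<Rightarrow> real" and V :: "(real ^ 'n) set"
  assumes u: "uniform s \<Lambda>" and V: "subspace V" and supp: "supp \<Lambda> = plane V b"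
  shows "s = real (dim V + (if b then 2 else 0))"
proof -
  have pf: "posfun \<Lambda>" and un: "\<And>x r. x \<in> plane V b \<Longrightarrow> 0 < r \<Longrightarrow> \<Lambda> (bump x r) = r powr s"
    using u supp by (auto simp: uniform_def)
  have 0: "0 \<in> plane V b" using subspace_0[OF V] by (simp add: plane_def)
  obtain B where B: "B \<subseteq> V" "pairwise orthogonal B" "\<And>x. x \<in> B \<Longrightarrow> norm x = 1"
    "independent B" "card B = dim V" "span B = V"
    using orthonormal_basis_subspace[OF V] by metis
  have fB: "finite B" using B(4) independent_imp_finite by blast
  define m where "m = dim V"
  have ip: "e \<bullet> (\<Sum>e'\<in>B. c e' *\<^sub>R e') = c e" if "e \<in> B" for e and c :: "real ^ 'n \<Rightarrow> real"
  proof -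
    have "e \<bullet> (\<Sum>e'\<in>B. c e' *\<^sub>R e') = (\<Sum>e'\<in>B. if e' = e then c e else 0)"
      unfolding inner_sum_right
    proof (rule sum.cong[OF refl])
      fix e' assume e': "e' \<in> B"
      show "e \<bullet> c e' *\<^sub>R e' = (if e' = e then c e else 0)"
      proof (cases "e' = e")
        case True
        then show ?thesis using B(3)[OF that] by (simp add: dot_square_norm)
      next
        case False
        then have "orthogonal e e'" using B(2) that e' by (metis pairwiseD)
        then show ?thesis using False by (simp add: orthogonal_def)
      qed
    qed
    then show ?thesis using that fB by simp
  qed
  have rep: "x = (\<Sum>e\<in>B. (e \<bullet> x) *\<^sub>R e)" if "x \<in> V" for x
  proof -
    have "x \<in> span B" using that B by simp
    then obtain c where c: "x = (\<Sum>e\<in>B. c e *\<^sub>R e)" using span_finite[OF fB] by auto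
    have "(\<Sum>e\<in>B. (e \<bullet> x) *\<^sub>R e) = (\<Sum>e\<in>B. c e *\<^sub>R e)"
      by (rule sum.cong[OF refl]) (simp add: c ip)
    then show ?thesis using c by simp
  qed
  have nsum: "norm (\<Sum>e\<in>B. c e *\<^sub>R e) \<le> m * K" if "\<And>e. e \<in> B \<Longrightarrow> \<bar>c e\<bar> \<le> K" for c :: "real ^ 'n \<Rightarrow> real" and K :: real
  proof -
    have "norm (\<Sum>e\<in>B. c e *\<^sub>R e) \<le> (\<Sum>e\<in>B. K)"
      by (rule sum_norm_le) (use that B(3) in simp)
    then show ?thesis using B(5) by (simp add: m_def)
  qed
  define pt :: "(real ^ 'n \<Rightarrow> int) \<times> int \<Rightarrow> 'n par" where
    "pt p = ((\<Sum>e\<in>B. of_int (fst p e) *\<^sub>R e), of_int (snd p))" for p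
  \<comment> \<open>Heights run up to \<open>N\<^sup>2\<close> because the gauge sees
    \<open>sqrt \<bar>t\<bar>\<close>; hence the vertical axis counts twice in
    \<open>Q\<close>.\<close>
  define I where "I N = (PiE B (\<lambda>_. {- int N..int N})) \<times> (if b then {- int (N\<^sup>2)..int (N\<^sup>2)} else {0})" for N :: nat
  define Q where "Q = m + (if b then 2 else 0)"
  have fin: "finite (I N)" for N using fB by (auto simp: I_def intro!: finite_PiE)
  have cardI: "card (I N) = (2 * N + 1) ^ m * (if b then 2 * N\<^sup>2 + 1 else 1)" for N
    using B(5) fB by (auto simp: I_def card_cartesian_product card_PiE m_def nat_add_distrib nat_mult_distrib
        nat_power_eq simp flip: of_nat_power)
  have card_ge: "real N powr real Q \<le> real (card (I N))" if "1 \<le> N" for N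
  proof -
    have "N ^ Q \<le> card (I N)"
      unfolding cardI Q_def power_add by (intro mult_mono power_mono) auto
    then show ?thesis using that by (simp add: powr_realpow del: of_nat_power flip: of_nat_power)
  qed
  have card_le: "real (card (I N)) \<le> 3 ^ (m + 1) * real N powr real Q" if "1 \<le> N" for N
  proof -
    \<comment> \<open>Without the vertical axis the factor is 1; the weaker 3 gives both cases the
      constant \<open>3 ^ (m + 1)\<close>.\<close>
    have "card (I N) \<le> (3 * N) ^ m * (if b then 3 * N\<^sup>2 else 3)"
      unfolding cardI using that by (intro mult_mono power_mono) auto
    also have "\<dots> = 3 ^ (m + 1) * N ^ Q" by (simp add: Q_def power_add power_mult_distrib)
    finally have "real (card (I N)) \<le> real (3 ^ (m + 1) * N ^ Q)" by (rule of_nat_mono)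
    then show ?thesis using that by (simp add: powr_realpow)
  qed
  have pt_plane: "pt p \<in> plane V b" if "p \<in> I N" for p N
  proof -
    have "fst (pt p) \<in> V"
      unfolding pt_def fst_conv by (intro subspace_sum V subspace_scale) (use B in auto)
    then show ?thesis using that by (auto simp: plane_def I_def pt_def split: if_splits)
  qed
  have pt_norm: "gnorm (pt p) \<le> (m + 1) * real N" if p: "p \<in> I N" for p N
  proof -
    have "norm (fst (pt p)) \<le> m * real N"
      unfolding pt_def fst_conv
    proof (rule nsum)
      fix e assume "e \<in> B"
      then have "fst p e \<in> {- int N..int N}" using p by (auto simp: I_def PiE_iff)
      then have "\<bar>fst p e\<bar> \<le> int N" by auto
      then show "\<bar>of_int (fst p e)\<bar> \<le> real N" by linarith
    qed
    moreover have "sqrt \<bar>snd (pt p)\<bar> \<le> real N"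
    proof -
      have "\<bar>snd p\<bar> \<le> int (N\<^sup>2)" using p by (auto simp: I_def split: if_splits)
      then have "\<bar>real_of_int (snd p)\<bar> \<le> (real N)\<^sup>2" by (simp add: of_nat_power[symmetric] del: of_nat_power)
      then show ?thesis by (simp add: pt_def real_le_lsqrt)
    qed
    ultimately show ?thesis using gnorm_le[of "pt p"] by (simp add: distrib_right)
  qed
  have pt_sep: "1 \<le> gnorm (pt p - pt p')" if p: "p \<in> I N" "p' \<in> I N" "p \<noteq> p'" for p p' N
  proof (cases "fst p = fst p'")
    case False
    then obtain e where e: "e \<in> B" "fst p e \<noteq> fst p' e"
      using p unfolding I_def by (metis PiE_ext mem_Times_iff)
    have "e \<bullet> fst (pt p - pt p') = of_int (fst p e) - of_int (fst p' e)"
      using ip[OF e(1)] by (simp add: pt_def inner_diff_right)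
    moreover have "\<bar>e \<bullet> fst (pt p - pt p')\<bar> \<le> norm (fst (pt p - pt p'))"
      using Cauchy_Schwarz_ineq2[of e "fst (pt p - pt p')"] B(3)[OF e(1)] by simp
    moreover have "1 \<le> \<bar>real_of_int (fst p e) - real_of_int (fst p' e)\<bar>" using e(2) by linarith
    ultimately show ?thesis using norm_fst_le_gnorm[of "pt p - pt p'"] by linarith
  next
    case True
    then have "snd p \<noteq> snd p'" using p by (simp add: prod_eq_iff)
    then have "1 \<le> \<bar>snd (pt p - pt p')\<bar>" unfolding pt_def by simp
    then have "1 \<le> (gnorm (pt p - pt p'))\<^sup>2" using snd_le_gnorm[of "pt p - pt p'"] by linarith
    then show ?thesis using power_less_one_iff[of "gnorm (pt p - pt p')" 2] by (meson gnorm_nonneg not_le zero_less_numeral)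
  qed
  have upper: "real N powr (Q - s) \<le> 8 * (2 * (m + 2)) powr s / (1 / 2) powr s" if N: "1 \<le> N" for N
  proof -
    \<comment> \<open>A bump of radius 1/2 at a lattice point lives within
      \<open>(m + 2) * N\<close> of \<open>0\<close>; doubling places this inside
      \<open>3 / 4 * R\<close>.\<close>
    define R where "R = 2 * ((real m + 2) * real N)"
    have R: "0 < R" using N by (simp add: R_def)
    have "(\<Sum>p\<in>I N. bump (pt p) (1 / 2) y) \<le> 8 * bump 0 R y" for y
    proof (cases "\<exists>p\<in>I N. gnorm (y - pt p) < 1 / 2")
      case True
      then obtain p where p: "p \<in> I N" "gnorm (y - pt p) < 1 / 2" by blast
      have "bump (pt p') (1 / 2) y = 0" if "p' \<in> I N - {p}" for p'
      proof (rule bump_eq_0)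
        have "1 \<le> gnorm (pt p' - pt p)" by (rule pt_sep[of _ N]) (use that p in auto)
        then show "1 / 2 \<le> gnorm (y - pt p')"
          using gnorm_triangle'[of "pt p'" "pt p" y] p(2) gnorm_minus_commute[of y "pt p'"] by linarith
      qed simp
      then have "(\<Sum>p'\<in>I N - {p}. bump (pt p') (1 / 2) y) = 0" by (intro sum.neutral) auto
      then have "(\<Sum>p'\<in>I N. bump (pt p') (1 / 2) y) \<le> 1"
        using sum.remove[OF fin p(1), of "\<lambda>p. bump (pt p) (1 / 2) y"] by simp
      moreover have "1 / 8 \<le> bump 0 R y"
      proof (rule bump_ge[OF R])
        have "gnorm y \<le> 1 / 2 + (m + 1) * real N"
          using gnorm_triangle[of "y - pt p" "pt p"] p(2) pt_norm[OF p(1)] by simp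
        also have "\<dots> \<le> (real m + 2) * real N" using N by (simp add: algebra_simps)
        also have "\<dots> \<le> 3 / 4 * R" by (simp add: R_def)
        finally show "gnorm (y - 0) \<le> 3 / 4 * R" by simp
      qed
      ultimately show ?thesis by linarith
    next
      case False
      then have "(\<Sum>p\<in>I N. bump (pt p) (1 / 2) y) = 0" by (intro sum.neutral ballI bump_eq_0) (auto simp: not_less)
      then show ?thesis by simp
    qed
    then have "\<Lambda> (\<lambda>y. \<Sum>p\<in>I N. bump (pt p) (1 / 2) y) \<le> \<Lambda> (\<lambda>y. 8 * bump 0 R y)"
      using R by (intro posfun_mono[OF pf]) auto
    also have "\<dots> = 8 * R powr s" using R un[OF 0 R] posfun_cmult[OF pf test_bump[OF R]] by simp
    also have "\<Lambda> (\<lambda>y. \<Sum>p\<in>I N. bump (pt p) (1 / 2) y) = (\<Sum>p\<in>I N. \<Lambda> (bump (pt p) (1 / 2)))"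
      by (rule posfun_sum[OF pf]) auto
    also have "\<dots> = (\<Sum>p\<in>I N. (1 / 2) powr s)" using pt_plane un by (intro sum.cong) auto
    also have "\<dots> = card (I N) * (1 / 2) powr s" by simp
    finally have "real N powr real Q * (1 / 2) powr s \<le> 8 * R powr s"
      using mult_right_mono[OF card_ge[OF N], of "(1/2) powr s"] by (meson order.trans powr_ge_zero)
    moreover have "R powr s = (2 * (m + 2)) powr s * real N powr s"
      unfolding R_def using N by (subst powr_mult[symmetric]) (auto simp: algebra_simps)
    ultimately show ?thesis using N by (simp add: powr_diff field_simps)
  qed
  have lower: "real N powr (s - Q) \<le> 8 * (3 ^ (m + 1) * (2 * (m + 1)) powr s)" if N: "1 \<le> N" for N
  proof -
    define R where "R = 2 * (real m + 1)"
    have R: "0 < R" by (simp add: R_def add_nonneg_pos)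
    have N0: "0 < real N" using N by simp
    have "bump 0 N y \<le> 8 * (\<Sum>p\<in>I N. bump (pt p) R y)" if y: "y \<in> supp \<Lambda>" for y
    proof (cases "gnorm y < N")
      case False
      then have "bump 0 N y = 0" using N by (intro bump_eq_0) auto
      then show ?thesis by (simp add: sum_nonneg)
    next
      case True
      have yV: "fst y \<in> V" and yb: "\<not> b \<Longrightarrow> snd y = 0" using y supp by (auto simp: plane_def)
      \<comment> \<open>Rounding down changes each coordinate and the height by less than 1, hence
        moves \<open>y\<close> by at most \<open>m + 1\<close> in the gauge; \<open>R\<close> is
        twice that. Integer bounds survive rounding, so \<open>p\<close> stays in
        \<open>I N\<close>.\<close>
      define p where "p = ((\<lambda>e\<in>B. \<lfloor>e \<bullet> fst y\<rfloor>), \<lfloor>snd y\<rfloor>)"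
      have "p \<in> I N"
      proof -
        have "\<lfloor>e \<bullet> fst y\<rfloor> \<in> {- int N..int N}" if "e \<in> B" for e
        proof -
          have "\<bar>e \<bullet> fst y\<bar> \<le> real N"
            using Cauchy_Schwarz_ineq2[of e "fst y"] B(3)[OF that] norm_fst_le_gnorm[of y] True by simp
          then show ?thesis by (simp add: abs_le_iff le_floor_iff floor_le_iff)
        qed
        moreover have "\<lfloor>snd y\<rfloor> \<in> {- int (N\<^sup>2)..int (N\<^sup>2)}"
        proof -
          have "(gnorm y)\<^sup>2 \<le> (real N)\<^sup>2" using True by (intro power_mono) auto
          then have "\<bar>snd y\<bar> \<le> (real N)\<^sup>2" using snd_le_gnorm[of y] by linarith
          then show ?thesis by (simp add: abs_le_iff le_floor_iff floor_le_iff)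
        qed
        ultimately show ?thesis using yb by (auto simp: I_def p_def)
      qed
      have "1 / 8 \<le> bump (pt p) R y"
      proof (rule bump_ge[OF R])
        have "fst (y - pt p) = (\<Sum>e\<in>B. (e \<bullet> fst y - of_int \<lfloor>e \<bullet> fst y\<rfloor>) *\<^sub>R e)"
          using rep[OF yV] by (simp add: pt_def p_def scaleR_diff_left sum_subtractf)
        moreover have "norm (\<Sum>e\<in>B. (e \<bullet> fst y - of_int \<lfloor>e \<bullet> fst y\<rfloor>) *\<^sub>R e) \<le> real m * 1"
          by (rule nsum) linarith
        ultimately have "norm (fst (y - pt p)) \<le> real m" by simp
        moreover have "\<bar>snd (y - pt p)\<bar> \<le> 1" unfolding pt_def p_def by simp linarith
        then have "sqrt \<bar>snd (y - pt p)\<bar> \<le> 1" by simp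
        ultimately have "gnorm (y - pt p) \<le> real m + 1" using gnorm_le[of "y - pt p"] by linarith
        also have "\<dots> \<le> 3 / 4 * R" by (simp add: R_def)
        finally show "gnorm (y - pt p) \<le> 3 / 4 * R" .
      qed
      also have "\<dots> \<le> (\<Sum>p\<in>I N. bump (pt p) R y)"
        using \<open>p \<in> I N\<close> fin by (intro member_le_sum) auto
      finally show ?thesis using bump_le_1[of 0 "real N" y] by linarith
    qed
    then have "\<Lambda> (bump 0 N) \<le> \<Lambda> (\<lambda>y. 8 * (\<Sum>p\<in>I N. bump (pt p) R y))"
      using R N by (intro posfun_mono_supp[OF pf]) auto
    also have "\<dots> = 8 * \<Lambda> (\<lambda>y. \<Sum>p\<in>I N. bump (pt p) R y)"
      using R by (intro posfun_cmult[OF pf] test_sum) auto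
    also have "\<Lambda> (\<lambda>y. \<Sum>p\<in>I N. bump (pt p) R y) = (\<Sum>p\<in>I N. \<Lambda> (bump (pt p) R))"
      using R by (intro posfun_sum[OF pf]) auto
    also have "\<dots> = (\<Sum>p\<in>I N. R powr s)" using pt_plane un R by (intro sum.cong) auto
    also have "8 * \<dots> = 8 * (card (I N) * R powr s)" by simp
    also have "\<dots> \<le> 8 * ((3 ^ (m + 1) * real N powr real Q) * R powr s)"
      by (intro mult_left_mono mult_right_mono card_le N) auto
    finally have "real N powr s \<le> 8 * ((3 ^ (m + 1) * real N powr real Q) * R powr s)" using un[OF 0 N0] by simp
    then show ?thesis using N by (simp add: powr_diff R_def field_simps)
  qed
  have "real Q - s \<le> 0" by (rule powr_bounded_imp_nonpos[OF upper])
  moreover have "s - real Q \<le> 0" by (rule powr_bounded_imp_nonpos[OF lower])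
  ultimately show ?thesis by (simp add: Q_def m_def)
qed

lemma uniform_integer_dimension: "uniform s \<Lambda> \<Longrightarrow> s \<in> \<int>"
  using full_support[of s \<Lambda>] full_dimension by (metis Ints_of_nat)

section \<open>Blow-ups of the measure\<close>

lemma borel_bump:
  fixes x :: "'n::finite par"
  assumes "0 < r"
  shows "bump x r \<in> borel_measurable borel"
  using test_bump[OF assms, of x] by (intro borel_measurable_continuous_onI) (simp add: test_def)

text \<open>Superlevel sets of a bump are closed gauge balls, whose masses the density hypothesis
  controls; the formula inverts the profile.\<close>

lemma bump_layer:
  fixes x :: "'n::finite par"
  assumes "0 < r" "0 < \<tau>" "\<tau> < 1"
  shows "\<tau> \<le> bump x r y \<longleftrightarrow> gnorm (y - x) \<le> r * root 4 (1 - root 3 \<tau>)"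
proof -
  define v where "v = root 3 \<tau>"
  have v: "0 < v" "v < 1" "v ^ 3 = \<tau>" using assms by (auto simp: v_def)
  define w where "w = gnorm (y - x) / r"
  have w: "0 \<le> w" using assms by (simp add: w_def)
  have "\<tau> \<le> bump x r y \<longleftrightarrow> v ^ 3 \<le> (max 0 (1 - w ^ 4)) ^ 3" by (simp add: bump_def w_def v)
  also have "\<dots> \<longleftrightarrow> v \<le> max 0 (1 - w ^ 4)" using v by (subst power_mono_iff) auto
  also have "\<dots> \<longleftrightarrow> w ^ 4 \<le> 1 - v" using v by auto
  also have "\<dots> \<longleftrightarrow> w ^ 4 \<le> (root 4 (1 - v)) ^ 4" using v by simp
  also have "\<dots> \<longleftrightarrow> w \<le> root 4 (1 - v)" using v w by (subst power_mono_iff) auto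
  also have "\<dots> \<longleftrightarrow> gnorm (y - x) \<le> r * root 4 (1 - v)" using assms by (simp add: w_def field_simps)
  finally show ?thesis by (simp add: v_def)
qed

text \<open>By the layer cake formula this is the integral of \<open>bump x 1\<close> against a measure that gives
  mass \<open>t\<^sup>s\<close> to the ball of radius \<open>t\<close> around \<open>x\<close>.\<close>

definition layer_const :: "real \<Rightarrow> real" where
  "layer_const s = (LINT \<tau>:{0<..<1}|lborel. root 4 (1 - root 3 \<tau>) powr s)"

lemma layer_bounds: "0 < \<tau> \<Longrightarrow> \<tau> < 1 \<Longrightarrow> 0 < root 4 (1 - root 3 \<tau>) \<and> root 4 (1 - root 3 \<tau>) \<le> 1"
  by simp

lemma layer_measurable [measurable]: "(\<lambda>\<tau>. root 4 (1 - root 3 \<tau>) powr s) \<in> borel_measurable borel"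
  by measurable

lemma layer_integrable: "0 \<le> s \<Longrightarrow> set_integrable lborel {0<..<1} (\<lambda>\<tau>. root 4 (1 - root 3 \<tau>) powr s)"
  unfolding set_integrable_def
  by (rule Bochner_Integration.integrable_bound[of lborel "indicator {0<..<1::real} :: real \<Rightarrow> real"])
    (auto simp: indicator_def powr_le1)

lemma layer_const_pos: "0 \<le> s \<Longrightarrow> 0 < layer_const s"
proof -
  assume s: "0 \<le> s"
  \<comment> \<open>\<open>c\<close> bounds the integrand from below on \<open>(0, 1/8)\<close>,
    since \<open>1 / 8 = (1 / 2) ^ 3\<close> gives \<open>root 3 \<tau> \<le> 1 / 2\<close>
    there.\<close>
  define c where "c = root 4 (1 / 2) powr s"
  have c: "0 < c" by (simp add: c_def)
  have "c * (1 / 8) = (LINT \<tau>:{0<..<1/8::real}|lborel. c)"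
    by (simp add: set_lebesgue_integral_def mult.commute)
  also have "\<dots> \<le> layer_const s"
    unfolding layer_const_def set_lebesgue_integral_def
  proof (rule integral_mono)
    show "integrable lborel (\<lambda>\<tau>. indicat_real {0<..<1 / 8 :: real} \<tau> *\<^sub>R c)" by simp
    show "integrable lborel (\<lambda>\<tau>. indicat_real {0<..<1} \<tau> *\<^sub>R (root 4 (1 - root 3 \<tau>) powr s))"
      using layer_integrable[OF s] by (simp add: set_integrable_def)
    fix \<tau> :: real
    show "indicat_real {0<..<1 / 8} \<tau> *\<^sub>R c \<le> indicat_real {0<..<1} \<tau> *\<^sub>R (root 4 (1 - root 3 \<tau>) powr s)"
    proof (cases "0 < \<tau> \<and> \<tau> < 1 / 8")
      case True
      then have "root 3 \<tau> \<le> root 3 ((1 / 2) ^ 3)" by (simp add: power_divide)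
      then have "root 3 \<tau> \<le> 1 / 2" by (simp only: real_root_power_cancel)
      then have "root 4 (1 / 2) \<le> root 4 (1 - root 3 \<tau>)" by simp
      then have "c \<le> root 4 (1 - root 3 \<tau>) powr s" unfolding c_def using s by (intro powr_mono2) auto
      then show ?thesis using True by simp
    qed (auto simp: indicator_def)
  qed
  finally show ?thesis using c by simp
qed

text \<open>Fubini rewrites the bump integral as an integral of ball masses over the levels
  \<open>\<tau>\<close>. All radii are at most \<open>r\<close>, so the bounds apply; they factor
  into \<open>r powr s\<close> and \<open>layer_const s\<close>.\<close>

lemma integral_bump_bounds:
  fixes \<mu> :: "'n::finite par measure" and x :: "'n par"
  assumes sets: "sets \<mu> = sets borel" and fin: "\<And>t. emeasure \<mu> (pcball x t) < \<infinity>"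
    and r: "0 < r" and s: "0 \<le> s" and a: "0 \<le> a" "0 \<le> b"
    and bd: "\<And>t. 0 < t \<Longrightarrow> t \<le> r \<Longrightarrow> a * t powr s \<le> measure \<mu> (pcball x t) \<and> measure \<mu> (pcball x t) \<le> b * t powr s"
  shows "integrable \<mu> (bump x r)"
    "a * layer_const s * r powr s \<le> integral\<^sup>L \<mu> (bump x r)"
    "integral\<^sup>L \<mu> (bump x r) \<le> b * layer_const s * r powr s"
proof -
  let ?\<rho> = "\<lambda>\<tau>. root 4 (1 - root 3 \<tau>)"
  have clo: "pcball x t \<in> sets borel" for t
    unfolding pcball_gnorm by (intro borel_closed closed_Collect_le continuous_intros)
  have [measurable]: "bump x r \<in> borel_measurable \<mu>"
    using borel_bump[OF r, of x] sets by (simp cong: measurable_cong_sets)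
  interpret M: sigma_finite_measure \<mu>
  proof
    have "y \<in> (\<Union>n::nat. pcball x n)" for y
      using real_arch_simple[of "gnorm (y - x)"] by (auto simp: pcball_gnorm)
    then show "\<exists>A. countable A \<and> A \<subseteq> sets \<mu> \<and> \<Union> A = space \<mu> \<and> (\<forall>a\<in>A. emeasure \<mu> a \<noteq> \<infinity>)"
      using clo sets fin sets_eq_imp_space_eq[OF sets]
      by (intro exI[of _ "range (\<lambda>n::nat. pcball x n)"]) (auto simp: less_top[symmetric])
  qed
  interpret P: pair_sigma_finite \<mu> lborel ..
  let ?I = "\<lambda>\<tau>::real. indicator {0<..<1} \<tau> :: real"
  have inner1: "(\<integral>\<^sup>+ \<tau>. (if 0 < \<tau> \<and> \<tau> < 1 \<and> \<tau> \<le> bump x r y then 1 else 0) \<partial>lborel) = ennreal (bump x r y)" for y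
  proof -
    \<comment> \<open>Levels are kept strictly between 0 and 1, where \<open>bump_layer\<close>
      applies; the end points form a null set.\<close>
    have "AE \<tau> in lborel. (if 0 < \<tau> \<and> \<tau> < 1 \<and> \<tau> \<le> bump x r y then 1 else 0) = (indicator {0..bump x r y} \<tau> :: ennreal)"
      using AE_lborel_singleton[of "0::real"] AE_lborel_singleton[of "1::real"]
    proof eventually_elim
      case (elim \<tau>)
      then show ?case using bump_le_1[of x r y] by (auto simp: indicator_def simp del: bump_le_1)
    qed
    then have "(\<integral>\<^sup>+ \<tau>. (if 0 < \<tau> \<and> \<tau> < 1 \<and> \<tau> \<le> bump x r y then 1 else 0) \<partial>lborel)
        = (\<integral>\<^sup>+ \<tau>. indicator {0..bump x r y} \<tau> \<partial>lborel)"
      by (rule nn_integral_cong_AE)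
    then show ?thesis by simp
  qed
  have inner2: "(\<integral>\<^sup>+ y. (if 0 < \<tau> \<and> \<tau> < 1 \<and> \<tau> \<le> bump x r y then 1 else 0) \<partial>\<mu>)
      = ennreal (?I \<tau> * measure \<mu> (pcball x (r * ?\<rho> \<tau>)))" for \<tau>
  proof (cases "0 < \<tau> \<and> \<tau> < 1")
    case True
    then have "(\<integral>\<^sup>+ y. (if 0 < \<tau> \<and> \<tau> < 1 \<and> \<tau> \<le> bump x r y then 1 else 0) \<partial>\<mu>)
        = (\<integral>\<^sup>+ y. indicator (pcball x (r * ?\<rho> \<tau>)) y \<partial>\<mu>)"
      using bump_layer[OF r, of \<tau> x] by (intro nn_integral_cong) (simp add: indicator_def pcball_gnorm)
    also have "\<dots> = emeasure \<mu> (pcball x (r * ?\<rho> \<tau>))" using clo sets by simp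
    also have "\<dots> = ennreal (measure \<mu> (pcball x (r * ?\<rho> \<tau>)))"
      using fin by (intro emeasure_eq_ennreal_measure) (simp add: less_top)
    finally show ?thesis using True by simp
  next
    case False
    then have "(if 0 < \<tau> \<and> \<tau> < 1 \<and> \<tau> \<le> bump x r y then 1 else 0 :: ennreal) = 0" for y by auto
    moreover have "?I \<tau> = 0" using False by simp
    ultimately show ?thesis by simp
  qed
  have nn: "(\<integral>\<^sup>+ y. ennreal (bump x r y) \<partial>\<mu>) = (\<integral>\<^sup>+ \<tau>. ennreal (?I \<tau> * measure \<mu> (pcball x (r * ?\<rho> \<tau>))) \<partial>lborel)"
    unfolding inner1[symmetric] inner2[symmetric]
    by (rule P.Fubini'[symmetric]) measurable
  have bd': "a * (r powr s * ?\<rho> \<tau> powr s) \<le> measure \<mu> (pcball x (r * ?\<rho> \<tau>))"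
    "measure \<mu> (pcball x (r * ?\<rho> \<tau>)) \<le> b * (r powr s * ?\<rho> \<tau> powr s)" if "0 < \<tau>" "\<tau> < 1" for \<tau>
    using bd[of "r * ?\<rho> \<tau>"] layer_bounds[OF that] r by (auto simp: powr_mult mult_le_cancel_left1)
  have const: "(\<integral>\<^sup>+ \<tau>. ennreal (c * r powr s * (?I \<tau> * ?\<rho> \<tau> powr s)) \<partial>lborel) = ennreal (c * layer_const s * r powr s)"
    if "0 \<le> c" for c
  proof (subst nn_integral_eq_integral)
    show "integrable lborel (\<lambda>\<tau>. c * r powr s * (?I \<tau> * ?\<rho> \<tau> powr s))"
      using layer_integrable[OF s] by (intro integrable_mult_right) (simp add: set_integrable_def)
    show "ennreal (LBINT \<tau>. c * r powr s * (?I \<tau> * ?\<rho> \<tau> powr s)) = ennreal (c * layer_const s * r powr s)"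
      by (simp add: layer_const_def set_lebesgue_integral_def mult_ac)
  qed (use that in auto)
  have up: "(\<integral>\<^sup>+ y. ennreal (bump x r y) \<partial>\<mu>) \<le> ennreal (b * layer_const s * r powr s)"
    unfolding nn const[OF a(2), symmetric]
    by (intro nn_integral_mono ennreal_leI) (use bd' in \<open>auto simp: indicator_def mult_ac\<close>)
  have low: "ennreal (a * layer_const s * r powr s) \<le> (\<integral>\<^sup>+ y. ennreal (bump x r y) \<partial>\<mu>)"
    unfolding nn const[OF a(1), symmetric]
    by (intro nn_integral_mono ennreal_leI) (use bd' in \<open>auto simp: indicator_def mult_ac\<close>)
  show int: "integrable \<mu> (bump x r)"
    by (rule integrableI_nonneg) (use up in \<open>auto intro: le_less_trans\<close>)
  have eq: "(\<integral>\<^sup>+ y. ennreal (bump x r y) \<partial>\<mu>) = ennreal (integral\<^sup>L \<mu> (bump x r))"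
    by (rule nn_integral_eq_integral[OF int]) simp
  have nn0: "0 \<le> integral\<^sup>L \<mu> (bump x r)" by simp
  show "a * layer_const s * r powr s \<le> integral\<^sup>L \<mu> (bump x r)"
    using low nn0 unfolding eq by (simp add: ennreal_le_iff)
  show "integral\<^sup>L \<mu> (bump x r) \<le> b * layer_const s * r powr s"
    using up a layer_const_pos[OF s] unfolding eq by (subst (asm) ennreal_le_iff) auto
qed

section \<open>Compact sets with uniform density bounds\<close>

lemma compact_pcball: "compact (pcball x r)"
  unfolding pcball_gnorm by (rule compact_gball)

lemma pcball_sets: "sets \<mu> = sets borel \<Longrightarrow> pcball x r \<in> sets \<mu>"
  using compact_pcball[of x r] by (simp add: borel_compact)

definition regular_set :: "'n::finite par measure \<Rightarrow> real \<Rightarrow> real \<Rightarrow> real \<Rightarrow> real \<Rightarrow> 'n par set" where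
  "regular_set \<mu> s a b r0 = {x. \<forall>r. 0 < r \<longrightarrow> r < r0 \<longrightarrow>
     a * r powr s \<le> measure \<mu> (pcball x r) \<and> measure \<mu> (pcball x r) \<le> b * r powr s}"

text \<open>Ball masses need not be continuous in the centre. The bounds are taken at a nearby
  centre with radius \<open>r - \<epsilon>\<close> or \<open>r + \<epsilon>\<close>, where inclusion
  of balls compares masses, and continuity of the power removes \<open>\<epsilon>\<close>.\<close>

lemma closed_regular_set:
  fixes \<mu> :: "'n::finite par measure"
  assumes sets: "sets \<mu> = sets borel" and fin: "\<And>K. compact K \<Longrightarrow> emeasure \<mu> K < \<infinity>" and s: "0 \<le> s"
  shows "closed (regular_set \<mu> s a b r0)"
proof -
  have mono: "measure \<mu> (pcball x r) \<le> measure \<mu> (pcball y t)" if "gnorm (y - x) + r \<le> t" for x y r t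
  proof (rule measure_mono_fmeasurable)
    show "pcball x r \<subseteq> pcball y t"
    proof
      fix w assume "w \<in> pcball x r"
      then show "w \<in> pcball y t"
        using gnorm_triangle'[of w y x] that gnorm_minus_commute[of x y] by (simp add: pcball_gnorm)
    qed
    show "pcball y t \<in> fmeasurable \<mu>"
      using fin[OF compact_pcball] pcball_sets[OF sets] by (simp add: fmeasurable_def)
  qed (rule pcball_sets[OF sets])
  have "x \<in> regular_set \<mu> s a b r0" if x: "x \<in> closure (regular_set \<mu> s a b r0)" for x
    unfolding regular_set_def mem_Collect_eq
  proof (intro allI impI)
    fix r :: real assume r: "0 < r" "r < r0"
    have close: "\<exists>y\<in>regular_set \<mu> s a b r0. gnorm (y - x) < \<epsilon>" if "0 < \<epsilon>" for \<epsilon>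
    proof -
      have "open {y. gnorm (y - x) < \<epsilon>}" by (intro open_Collect_less continuous_intros)
      moreover have "x \<in> {y. gnorm (y - x) < \<epsilon>}" using that by simp
      ultimately have "regular_set \<mu> s a b r0 \<inter> {y. gnorm (y - x) < \<epsilon>} \<noteq> {}"
        using x open_Int_closure_eq_empty by (metis Int_commute disjoint_iff)
      then show ?thesis by blast
    qed
    have ev: "eventually (\<lambda>\<epsilon>. 0 < \<epsilon> \<and> \<epsilon> < min r (r0 - r)) (at_right 0)"
      unfolding eventually_at_right_field using r by (intro exI[of _ "min r (r0 - r)"]) auto
    have "a * r powr s \<le> measure \<mu> (pcball x r)"
    proof (rule tendsto_upperbound)
      show "((\<lambda>\<epsilon>. a * (r - \<epsilon>) powr s) \<longlongrightarrow> a * r powr s) (at_right 0)"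
        using r by (auto intro!: tendsto_eq_intros)
      show "\<forall>\<^sub>F \<epsilon> in at_right 0. a * (r - \<epsilon>) powr s \<le> measure \<mu> (pcball x r)"
        using ev
      proof eventually_elim
        case (elim \<epsilon>)
        then obtain y where y: "y \<in> regular_set \<mu> s a b r0" "gnorm (y - x) < \<epsilon>" using close by blast
        then have "a * (r - \<epsilon>) powr s \<le> measure \<mu> (pcball y (r - \<epsilon>))"
          using elim r by (simp add: regular_set_def)
        also have "\<dots> \<le> measure \<mu> (pcball x r)"
          using y by (intro mono) (simp add: gnorm_minus_commute)
        finally show ?case .
      qed
    qed simp
    moreover have "measure \<mu> (pcball x r) \<le> b * r powr s"
    proof (rule tendsto_lowerbound)
      show "((\<lambda>\<epsilon>. b * (r + \<epsilon>) powr s) \<longlongrightarrow> b * r powr s) (at_right 0)"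
        using r by (auto intro!: tendsto_eq_intros)
      show "\<forall>\<^sub>F \<epsilon> in at_right 0. measure \<mu> (pcball x r) \<le> b * (r + \<epsilon>) powr s"
        using ev
      proof eventually_elim
        case (elim \<epsilon>)
        then obtain y where y: "y \<in> regular_set \<mu> s a b r0" "gnorm (y - x) < \<epsilon>" using close by blast
        have "measure \<mu> (pcball x r) \<le> measure \<mu> (pcball y (r + \<epsilon>))"
          using y by (intro mono) simp
        also have "\<dots> \<le> b * (r + \<epsilon>) powr s" using y elim r by (simp add: regular_set_def)
        finally show ?case .
      qed
    qed simp
    ultimately show "a * r powr s \<le> measure \<mu> (pcball x r) \<and> measure \<mu> (pcball x r) \<le> b * r powr s" ..
  qed
  then have "closure (regular_set \<mu> s a b r0) \<subseteq> regular_set \<mu> s a b r0" by blast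
  then show ?thesis by (simp add: closure_subset_eq)
qed

text \<open>Makes pointwise limits uniform: rational densities, scales \<open>1 / Suc k\<close> and
  integer radii give countably many compact sets covering \<open>A\<close>, and one of them is not
  null. The resulting \<open>L\<close> is an approximate density shared by all points of
  \<open>K\<close>.\<close>

lemma exists_regular_compact:
  fixes \<mu> :: "'n::finite par measure"
  assumes sets: "sets \<mu> = sets borel" and fin: "\<And>K. compact K \<Longrightarrow> emeasure \<mu> K < \<infinity>" and s: "0 \<le> s"
    and A: "A \<in> sets \<mu>" "emeasure \<mu> A > 0"
    and dens: "\<And>x. x \<in> A \<Longrightarrow> \<exists>L>0. ((\<lambda>r. r powr (-s) * measure \<mu> (pcball x r)) \<longlongrightarrow> L) (at_right 0)"
    and \<eta>: "0 < \<eta>" "\<eta> < 1"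
  obtains L r0 K where "0 < L" "0 < r0" "compact K" "0 < emeasure \<mu> K"
    "K \<subseteq> regular_set \<mu> s ((1 - \<eta>) * L) ((1 + \<eta>) * L) r0"
proof -
  define T :: "(rat \<times> nat \<times> nat) set" where "T = {p. 0 < fst p}"
  define N where "N p = regular_set \<mu> s ((1 - \<eta>) * of_rat (fst p)) ((1 + \<eta>) * of_rat (fst p)) (1 / Suc (fst (snd p)))
     \<inter> pcball 0 (snd (snd p))" for p :: "rat \<times> nat \<times> nat"
  have cN: "compact (N p)" for p
    unfolding N_def by (intro closed_Int_compact closed_regular_set[OF sets fin s] compact_pcball)
  have sN: "N p \<in> sets \<mu>" for p using borel_compact[OF cN] sets by simp
  have cover: "A \<subseteq> (\<Union>p\<in>T. N p)"
  proof
    fix x assume "x \<in> A"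
    then obtain L where L: "L > 0" and lim: "((\<lambda>r. r powr (-s) * measure \<mu> (pcball x r)) \<longlongrightarrow> L) (at_right 0)"
      using dens by blast
    have "L / (1 + \<eta>) < L" using L \<eta> by (simp add: field_simps)
    \<comment> \<open>Any such \<open>q\<close> has
      \<open>(1 - \<eta>) * q < L < (1 + \<eta>) * q\<close>, leaving room on both sides of the
      limit.\<close>
    then obtain q where q: "L / (1 + \<eta>) < real_of_rat q" "real_of_rat q < L"
      using of_rat_dense by blast
    have q0: "0 < real_of_rat q" using L \<eta> q(1) by (meson add_pos_pos divide_pos_pos less_trans zero_less_one)
    have "(1 - \<eta>) * of_rat q < L" using q(2) q0 \<eta> mult_strict_right_mono[of "1 - \<eta>" 1 "of_rat q"] by linarith
    moreover have "L < (1 + \<eta>) * of_rat q" using q(1) \<eta> by (simp add: field_simps)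
    ultimately have "\<forall>\<^sub>F r in at_right 0. (1 - \<eta>) * of_rat q < r powr (-s) * measure \<mu> (pcball x r) \<and>
        r powr (-s) * measure \<mu> (pcball x r) < (1 + \<eta>) * of_rat q"
      using order_tendstoD[OF lim] by (intro eventually_conj) auto
    then obtain d where d: "d > 0" "\<And>r. 0 < r \<Longrightarrow> r < d \<Longrightarrow> (1 - \<eta>) * of_rat q < r powr (-s) * measure \<mu> (pcball x r) \<and>
        r powr (-s) * measure \<mu> (pcball x r) < (1 + \<eta>) * of_rat q"
      unfolding eventually_at_right_field by auto
    obtain k where k: "1 / Suc k < d" using reals_Archimedean[OF d(1)] by (auto simp: inverse_eq_divide)
    obtain m :: nat where m: "gnorm x \<le> m" using real_arch_simple by blast
    have "x \<in> N (q, k, m)"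
      unfolding N_def regular_set_def fst_conv snd_conv
    proof (intro IntI CollectI allI impI)
      show "x \<in> pcball 0 (real m)" using m by (simp add: pcball_gnorm)
      fix r :: real assume r: "0 < r" "r < 1 / Suc k"
      have "(1 - \<eta>) * of_rat q < measure \<mu> (pcball x r) / r powr s"
        "measure \<mu> (pcball x r) / r powr s < (1 + \<eta>) * of_rat q"
        using d(2)[of r] r k by (auto simp: powr_minus_divide)
      moreover have "0 < r powr s" using r by simp
      ultimately show "(1 - \<eta>) * of_rat q * r powr s \<le> measure \<mu> (pcball x r) \<and>
          measure \<mu> (pcball x r) \<le> (1 + \<eta>) * of_rat q * r powr s"
        by (simp add: pos_less_divide_eq pos_divide_less_eq less_imp_le)
    qed
    moreover have "(q, k, m) \<in> T" using q0 by (simp add: T_def)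
    ultimately show "x \<in> (\<Union>p\<in>T. N p)" by blast
  qed
  have "\<exists>p\<in>T. 0 < emeasure \<mu> (N p)"
  proof (rule ccontr)
    assume "\<not> (\<exists>p\<in>T. 0 < emeasure \<mu> (N p))"
    then have "\<And>p. p \<in> T \<Longrightarrow> N p \<in> null_sets \<mu>" using sN by (auto simp: null_sets_def not_less)
    moreover have "countable T" by simp
    ultimately have "(\<Union>p\<in>T. N p) \<in> null_sets \<mu>" by (intro null_sets_UN') auto
    then have "A \<in> null_sets \<mu>" using cover A(1) null_sets_subset by blast
    then show False using A(2) by (simp add: null_sets_def)
  qed
  then obtain p where p: "p \<in> T" "0 < emeasure \<mu> (N p)" by blast
  show ?thesis
  proof (rule that[OF _ _ cN p(2)])
    show "0 < real_of_rat (fst p)" using p(1) by (simp add: T_def)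
    show "0 < 1 / real (Suc (fst (snd p)))" by simp
  qed (auto simp: N_def)
qed

text \<open>No covering theorem is needed: on a compact set with uniform mass bounds, failure at every point
  and at one small scale contradicts outer regularity through a maximal separated set.\<close>

lemma exists_density_point:
  fixes \<mu> :: "'n::finite par measure"
  assumes sets: "sets \<mu> = sets borel" and fin: "\<And>K. compact K \<Longrightarrow> emeasure \<mu> K < \<infinity>" and s: "0 \<le> s"
    and outer: "\<And>A. A \<in> sets \<mu> \<Longrightarrow> emeasure \<mu> A = (INF U\<in>{U. open U \<and> A \<subseteq> U}. emeasure \<mu> U)"
    and K: "compact K" "0 < emeasure \<mu> K" and bd: "\<And>x r. x \<in> K \<Longrightarrow> 0 < r \<Longrightarrow> r < r0 \<Longrightarrow> measure \<mu> (pcball x r) \<le> b * r powr s"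
    and b: "0 < b" and r0: "0 < r0" and J: "0 < J" and \<delta>: "0 < \<delta>"
  shows "\<exists>x\<in>K. \<exists>r. 0 < r \<and> r < r0 \<and> measure \<mu> (pcball x (J * r) - K) \<le> \<delta> * r powr s"
proof (rule ccontr)
  assume "\<not> ?thesis"
  then have big: "\<delta> * r powr s < measure \<mu> (pcball x (J * r) - K)" if "x \<in> K" "0 < r" "r < r0" for x r
    using that by force
  have sK: "K \<in> sets \<mu>" using borel_compact[OF K(1)] sets by simp
  have Kfin: "emeasure \<mu> K < \<infinity>" by (rule fin[OF K(1)])
  have mK: "0 < measure \<mu> K" using K(2) Kfin by (simp add: measure_def enn2real_positive_iff)
  \<comment> \<open>\<open>D\<close> is the ratio of the mass bound
    \<open>b * (2 * J * r) powr s\<close> of a covering ball to the mass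
    \<open>\<delta> * r powr s\<close> left outside \<open>K\<close>. \<open>\<epsilon>\<close> is
    chosen so that \<open>D * \<epsilon>\<close> is half the mass of \<open>K\<close>.\<close>
  define D where "D = b * (2 * J) powr s / \<delta>"
  have D: "0 < D" using b J \<delta> by (simp add: D_def)
  define \<epsilon> where "\<epsilon> = measure \<mu> K / (2 * D)"
  have \<epsilon>: "0 < \<epsilon>" using D mK by (simp add: \<epsilon>_def)
  have "emeasure \<mu> K < emeasure \<mu> K + ennreal \<epsilon>" using Kfin \<epsilon> by (simp add: ennreal_add_left_cancel_less less_top)
  then have "(INF U\<in>{U. open U \<and> K \<subseteq> U}. emeasure \<mu> U) < emeasure \<mu> K + ennreal \<epsilon>"
    unfolding outer[OF sK, symmetric] .
  then obtain U where U: "open U" "K \<subseteq> U" "emeasure \<mu> U < emeasure \<mu> K + ennreal \<epsilon>"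
    unfolding INF_less_iff by blast
  have sU: "U \<in> sets \<mu>" using U sets by simp
  have Ufin: "emeasure \<mu> U < \<infinity>" 
    using U(3) Kfin by (metis ennreal_add_eq_top ennreal_less_top infinity_ennreal_def less_top order.strict_trans)
  have "measure \<mu> (U - K) = measure \<mu> U - measure \<mu> K"
    using sU sK U Ufin by (intro measure_Diff) auto
  moreover have "measure \<mu> U < measure \<mu> K + \<epsilon>"
  proof -
    have "ennreal (measure \<mu> U) < ennreal (measure \<mu> K) + ennreal \<epsilon>"
      using U(3) Ufin Kfin by (simp add: emeasure_eq_ennreal_measure less_top)
    then show ?thesis using \<epsilon> by (simp add: ennreal_plus[symmetric] ennreal_less_iff del: ennreal_plus)
  qed
  ultimately have UK: "measure \<mu> (U - K) < \<epsilon>" by simp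
  obtain r2 where r2: "r2 > 0" "\<And>x. x \<in> K \<Longrightarrow> pcball x r2 \<subseteq> U"
  proof -
    have "K \<inter> - U = {}" using U by blast
    then obtain d where d: "d > 0" "\<And>x y. x \<in> K \<Longrightarrow> y \<in> - U \<Longrightarrow> d \<le> dist x y"
      using separate_compact_closed[OF K(1), of "- U"] U(1) closed_Compl by metis
    \<comment> \<open>For gauge distance at most 1 the Euclidean distance is at most twice the gauge
      distance, so \<open>d / 3\<close> keeps the points within
      \<open>2 * d / 3 < d\<close>.\<close>
    show ?thesis
    proof (rule that[of "min 1 (d / 3)"])
      fix x assume x: "x \<in> K"
      show "pcball x (min 1 (d / 3)) \<subseteq> U"
      proof
        fix y assume "y \<in> pcball x (min 1 (d / 3))"
        then have g: "gnorm (y - x) \<le> 1" "gnorm (y - x) \<le> d / 3" by (auto simp: pcball_gnorm)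
        then have "(gnorm (y - x))\<^sup>2 \<le> gnorm (y - x)" by (simp add: power2_eq_square mult_left_le)
        then have "dist x y < d" using norm_le_gnorm[of "y - x"] g d(1)
          by (simp add: dist_norm norm_minus_commute)
        then show "y \<in> U" using d(2)[OF x, of y] by fastforce
      qed
    qed (use d in auto)
  qed
  \<comment> \<open>One scale for all points: \<open>J * r \<le> r2\<close> keeps the balls in
    \<open>U\<close>, and the 3 yields \<open>2 * (J * r) < r0\<close>, so the mass bound covers the
    doubled balls.\<close>
  define r where "r = min (r0 / 2) (min (r2 / J) (r0 / (3 * J)))"
  have r: "0 < r" "r < r0" "J * r \<le> r2" "2 * (J * r) < r0"
  proof -
    show "0 < r" using r0 r2 J by (simp add: r_def)
    show "r < r0" using r0 by (simp add: r_def min_less_iff_disj)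
    have "r \<le> r2 / J" "r \<le> r0 / (3 * J)" by (auto simp: r_def)
    then show "J * r \<le> r2" "2 * (J * r) < r0" using J r0 by (auto simp: field_simps)
  qed
  define sep where "sep F \<longleftrightarrow> F \<subseteq> K \<and> finite F \<and> (\<forall>x\<in>F. \<forall>y\<in>F. x \<noteq> y \<longrightarrow> 2 * (J * r) < gnorm (x - y))" for F
  have pos: "0 < \<delta> * r powr s" using \<delta> r by simp
  \<comment> \<open>Outside \<open>K\<close> the balls about separated points are disjoint subsets
    of \<open>U - K\<close>, each of mass above \<open>\<delta> * r powr s\<close>. This limits
    their number, so a maximal separated set exists.\<close>
  have card: "real (card F) * (\<delta> * r powr s) \<le> \<epsilon>" if F: "sep F" for F
  proof -
    have sb: "pcball x (J * r) - K \<in> sets \<mu>" for x using pcball_sets[OF sets] sK by auto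
    have fb: "emeasure \<mu> (pcball x (J * r) - K) \<noteq> \<infinity>" for x
      using emeasure_mono[of "pcball x (J * r) - K" "pcball x (J * r)" \<mu>] fin[OF compact_pcball, of x "J * r"]
        pcball_sets[OF sets] by (auto simp: top_unique)
    have dj: "disjoint_family_on (\<lambda>x. pcball x (J * r) - K) F"
      unfolding disjoint_family_on_def
    proof (intro ballI impI)
      fix x y assume xy: "x \<in> F" "y \<in> F" "x \<noteq> y"
      then have "2 * (J * r) < gnorm (x - y)" using F by (simp add: sep_def)
      then have "w \<notin> pcball x (J * r) \<inter> pcball y (J * r)" for w
        using gnorm_triangle'[of x y w] gnorm_minus_commute[of x w] by (auto simp: pcball_gnorm)
      then show "(pcball x (J * r) - K) \<inter> (pcball y (J * r) - K) = {}" by blast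
    qed
    have "real (card F) * (\<delta> * r powr s) = (\<Sum>x\<in>F. \<delta> * r powr s)" by simp
    also have "\<dots> \<le> (\<Sum>x\<in>F. measure \<mu> (pcball x (J * r) - K))"
      using F r big by (intro sum_mono less_imp_le) (auto simp: sep_def)
    also have "\<dots> = measure \<mu> (\<Union>x\<in>F. pcball x (J * r) - K)"
      using F sb dj fb by (intro measure_finite_Union[symmetric]) (auto simp: sep_def)
    also have "\<dots> \<le> measure \<mu> (U - K)"
    proof (rule measure_mono_fmeasurable)
      show "(\<Union>x\<in>F. pcball x (J * r) - K) \<subseteq> U - K"
        using F r2(2) r(3) by (fastforce simp: sep_def pcball_gnorm)
      show "(\<Union>x\<in>F. pcball x (J * r) - K) \<in> sets \<mu>"
        by (rule sets.finite_UN) (use F sb in \<open>auto simp only: sep_def\<close>)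
      have "emeasure \<mu> (U - K) \<le> emeasure \<mu> U" using sU by (intro emeasure_mono) auto
      then show "U - K \<in> fmeasurable \<mu>" using sU sK Ufin by (intro fmeasurableI) (auto intro: le_less_trans)
    qed
    finally show ?thesis using UK by simp
  qed
  have "sep {}" by (simp add: sep_def)
  moreover have "\<forall>F. sep F \<longrightarrow> card F < Suc (nat \<lceil>\<epsilon> / (\<delta> * r powr s)\<rceil>)"
  proof (intro allI impI)
    fix F assume "sep F"
    then have "real (card F) \<le> \<epsilon> / (\<delta> * r powr s)" using card pos by (simp add: pos_le_divide_eq)
    then show "card F < Suc (nat \<lceil>\<epsilon> / (\<delta> * r powr s)\<rceil>)" by linarith
  qed
  ultimately obtain F where F: "sep F" and max: "\<And>G. sep G \<Longrightarrow> card G \<le> card F"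
    using ex_has_greatest_nat[of sep "{}" card] by (metis le_simps(2))
  have "K \<subseteq> (\<Union>x\<in>F. pcball x (2 * (J * r)))"
  proof
    fix y assume y: "y \<in> K"
    show "y \<in> (\<Union>x\<in>F. pcball x (2 * (J * r)))"
    proof (rule ccontr)
      assume n: "y \<notin> (\<Union>x\<in>F. pcball x (2 * (J * r)))"
      then have far: "\<And>x. x \<in> F \<Longrightarrow> 2 * (J * r) < gnorm (y - x)" by (auto simp: pcball_gnorm)
      have "y \<notin> F" using n r J by (auto simp: pcball_gnorm)
      have "sep (insert y F)" using F y far gnorm_minus_commute[of y] by (auto simp: sep_def)
      from max[OF this] show False using \<open>y \<notin> F\<close> F by (simp add: sep_def)
    qed
  qed
  moreover have "compact (\<Union>x\<in>F. pcball x (2 * (J * r)))"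
    using F compact_pcball by (intro compact_UN) (auto simp only: sep_def)
  then have "(\<Union>x\<in>F. pcball x (2 * (J * r))) \<in> fmeasurable \<mu>"
    using fin borel_compact sets by (intro fmeasurableI) auto
  ultimately have "measure \<mu> K \<le> measure \<mu> (\<Union>x\<in>F. pcball x (2 * (J * r)))"
    using sK by (intro measure_mono_fmeasurable)
  also have "\<dots> \<le> (\<Sum>x\<in>F. measure \<mu> (pcball x (2 * (J * r))))"
    using F fin[OF compact_pcball] pcball_sets[OF sets]
    by (intro measure_UNION_le) (auto simp: sep_def)
  also have "\<dots> \<le> (\<Sum>x\<in>F. b * (2 * (J * r)) powr s)"
    using F r J by (intro sum_mono bd) (auto simp: sep_def)
  also have "\<dots> = D * (real (card F) * (\<delta> * r powr s))"
    using \<delta> J r by (simp add: D_def powr_mult mult_ac)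
  also have "\<dots> \<le> D * \<epsilon>" using card[OF F] D by (intro mult_left_mono) auto
  also have "\<dots> = measure \<mu> K / 2" using D by (simp add: \<epsilon>_def)
  finally show False using mK by simp
qed

section \<open>Extraction of a uniform functional\<close>

lemma test_integrable:
  fixes f :: "'n::finite par \<Rightarrow> real"
  assumes sets: "sets \<mu> = sets borel" and fin: "\<And>K. compact K \<Longrightarrow> emeasure \<mu> K < \<infinity>" and f: "test f"
  shows "integrable \<mu> f"
proof -
  obtain M R where M: "0 \<le> M" "0 < R" and le: "\<And>y. \<bar>f y\<bar> \<le> M * bump 0 R y" and M': "\<And>y. \<bar>f y\<bar> \<le> M"
    using test_dominated[OF f] by metis
  have [measurable]: "f \<in> borel_measurable \<mu>"
    using f sets by (simp add: test_def borel_measurable_continuous_onI cong: measurable_cong_sets)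
  show ?thesis
  proof (rule Bochner_Integration.integrable_bound)
    show "integrable \<mu> (\<lambda>y. M * indicator (pcball 0 R) y)"
      using fin[OF compact_pcball, of 0 R] pcball_sets[OF sets, of 0 R] by (intro integrable_mult_right) simp
    have "norm (f y) \<le> norm (M * indicator (pcball 0 R) y)" for y
      using M M'[of y] le[of y] bump_eq_0[of R y 0] by (cases "gnorm y \<le> R") (auto simp: pcball_gnorm)
    then show "AE y in \<mu>. norm (f y) \<le> norm (M * indicator (pcball 0 R) y)" by simp
  qed simp
qed

lemma eventually_le_Suc: "\<forall>\<^sub>F j in sequentially. a \<le> real (Suc j)"
proof -
  obtain n :: nat where "a \<le> n" using real_arch_simple by blast
  then have "a \<le> real (Suc j)" if "n \<le> j" for j using that by simp
  then show ?thesis unfolding eventually_sequentially by blast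
qed

lemma eventually_divide_Suc_less: "0 < \<epsilon> \<Longrightarrow> \<forall>\<^sub>F j in sequentially. a / real (Suc j) < \<epsilon>"
  using order_tendstoD(2)[OF tendsto_mult_right_zero[OF LIMSEQ_inverse_real_of_nat, of a]]
  by (simp add: divide_inverse)

text \<open>The rescaled \<open>K j\<close> serves as approximate support: regularity of
  \<open>K j\<close> gives the bump integrals at its points, and the density point makes the mass
  off it negligible in a growing window. Each functional is normalised by its own
  \<open>L j\<close>, so these constants need not converge.\<close>

lemma exists_uniform:
  fixes \<mu> :: "'n::finite par measure"
  assumes sets: "sets \<mu> = sets borel" and fin: "\<And>K. compact K \<Longrightarrow> emeasure \<mu> K < \<infinity>" and s: "0 \<le> s"
    and outer: "\<And>A. A \<in> sets \<mu> \<Longrightarrow> emeasure \<mu> A = (INF U\<in>{U. open U \<and> A \<subseteq> U}. emeasure \<mu> U)"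
    and A: "A \<in> sets \<mu>" "emeasure \<mu> A > 0"
    and dens: "\<And>x. x \<in> A \<Longrightarrow> \<exists>L>0. ((\<lambda>r. r powr (-s) * measure \<mu> (pcball x r)) \<longlongrightarrow> L) (at_right 0)"
  shows "\<exists>\<Lambda> :: ('n par \<Rightarrow> real) \<Rightarrow> real. uniform s \<Lambda>"
proof -
  define c where "c = layer_const s"
  have c: "0 < c" by (simp add: c_def layer_const_pos[OF s])
  have "\<exists>L r0 K x r. 0 < L \<and> compact K \<and> 0 < r \<and> real (Suc j) * r < r0 \<and> x \<in> K \<and>
      K \<subseteq> regular_set \<mu> s ((1 - 1 / (real j + 2)) * L) ((1 + 1 / (real j + 2)) * L) r0 \<and>
      measure \<mu> (pcball x (real (Suc j) * r) - K) \<le> L / real (Suc j) * r powr s" for j :: nat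
  proof -
    \<comment> \<open>The \<open>+ 2\<close> keeps the tolerance below 1 at
      \<open>j = 0\<close>.\<close>
    have \<eta>: "0 < 1 / (real j + 2)" "1 / (real j + 2) < 1" by auto
    obtain L r0 K where K: "0 < L" "0 < r0" "compact K" "0 < emeasure \<mu> K"
      "K \<subseteq> regular_set \<mu> s ((1 - 1 / (real j + 2)) * L) ((1 + 1 / (real j + 2)) * L) r0"
      by (rule exists_regular_compact[OF sets fin s A dens \<eta>])
    \<comment> \<open>Radii below \<open>r0 / Suc j\<close> keep \<open>Suc j * r\<close> below
      \<open>r0\<close>, so after rescaling by \<open>r\<close> the density bounds hold up to radius
      \<open>Suc j\<close>.\<close>
    have "\<exists>x\<in>K. \<exists>r. 0 < r \<and> r < r0 / Suc j \<and> measure \<mu> (pcball x (real (Suc j) * r) - K) \<le> L / real (Suc j) * r powr s"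
    proof (rule exists_density_point[OF sets fin s outer K(3,4), of "r0 / Suc j" "(1 + 1 / (real j + 2)) * L" "Suc j" "L / Suc j"])
      fix x r assume "x \<in> K" "0 < r" "r < r0 / Suc j"
      moreover have "r0 / Suc j \<le> r0" using K(2) by (simp add: field_simps)
      ultimately show "measure \<mu> (pcball x r) \<le> (1 + 1 / (real j + 2)) * L * r powr s"
        using K(5) unfolding regular_set_def by force
    qed (use K in \<open>auto intro!: mult_pos_pos add_pos_pos\<close>)
    then obtain x r where "x \<in> K" "0 < r" "r < r0 / Suc j"
      "measure \<mu> (pcball x (real (Suc j) * r) - K) \<le> L / real (Suc j) * r powr s" by blast
    then show ?thesis using K
      by (intro exI[of _ L] exI[of _ r0] exI[of _ K] exI[of _ x] exI[of _ r]) (auto simp: field_simps)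
  qed
  then obtain L r0 K x r where L: "\<And>j. 0 < L j" and r: "\<And>j. 0 < r j" "\<And>j. real (Suc j) * r j < r0 j" and x: "\<And>j. x j \<in> K j"
    and K: "\<And>j. K j \<subseteq> regular_set \<mu> s ((1 - 1 / (real j + 2)) * L j) ((1 + 1 / (real j + 2)) * L j) (r0 j)"
    and cK: "\<And>j. compact (K j)"
    and off: "\<And>j. measure \<mu> (pcball (x j) (real (Suc j) * r j) - K j) \<le> L j / real (Suc j) * r j powr s"
    by metis
  define S where "S j = {z. x j + dil (r j) z \<in> K j}" for j
  \<comment> \<open>\<open>c * L j * r j powr s\<close> would be the integral of a bump of radius
    \<open>r j\<close> if balls had mass exactly \<open>L j * t powr s\<close>.\<close>
  define w where "w j = 1 / (c * L j * r j powr s)" for j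
  have w: "0 < w j" for j
    unfolding w_def using c L[of j] r(1)[of j] by (intro divide_pos_pos mult_pos_pos) auto
  define \<Lambda> where "\<Lambda> j f = w j * integral\<^sup>L \<mu> (\<lambda>y. f (dil (1 / r j) (y - x j)))" for j f
  have ti: "integrable \<mu> (\<lambda>y. f (dil (1 / r j) (y - x j)))" if "test f" for f :: "'n par \<Rightarrow> real" and j
    by (rule test_integrable[OF sets fin test_affine[OF that r(1)]])
  have \<Lambda>b: "\<Lambda> j (bump z \<rho>) = w j * integral\<^sup>L \<mu> (bump (x j + dil (r j) z) (r j * \<rho>))" for j z \<rho>
    unfolding \<Lambda>_def bump_affine[OF r(1)] ..
  have "\<exists>M. uniform s M \<and> (\<forall>z \<rho>. z \<in> supp M \<longrightarrow> 0 < \<rho> \<longrightarrow> frequently (\<lambda>j. \<exists>y\<in>S j. gnorm (y - z) < \<rho>) sequentially)"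
  proof (rule posfun_limit[of sequentially \<Lambda> S s])
    show "posfun (\<Lambda> j)" for j
      unfolding posfun_def \<Lambda>_def
      using less_imp_le[OF w] by (auto simp: ti distrib_left simp del: split_paired_All intro!: mult_nonneg_nonneg integral_nonneg)
    show "\<forall>\<^sub>F j in sequentially. 0 \<in> S j" using x by (simp add: S_def)
  next
    fix R \<rho> \<epsilon> :: real assume \<rho>: "0 < \<rho>" and \<epsilon>: "0 < \<epsilon>"
    show "\<forall>\<^sub>F j in sequentially. \<forall>z\<in>S j. gnorm z \<le> R \<longrightarrow> \<bar>\<Lambda> j (bump z \<rho>) - \<rho> powr s\<bar> \<le> \<epsilon>"
      using eventually_divide_Suc_less[OF \<epsilon>, of "\<rho> powr s"] eventually_le_Suc[of \<rho>]
    proof eventually_elim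
      case (elim j)
      let ?\<eta> = "1 / (real j + 2)"
      show ?case
      proof (intro ballI impI)
        fix z assume z: "z \<in> S j"
        let ?I = "integral\<^sup>L \<mu> (bump (x j + dil (r j) z) (r j * \<rho>))"
        have rr: "r j * \<rho> < r0 j" using mult_right_mono[OF elim(2), of "r j"] r[of j] by (simp only: mult.commute) linarith
        have bd: "(1 - ?\<eta>) * L j * t powr s \<le> measure \<mu> (pcball (x j + dil (r j) z) t) \<and>
            measure \<mu> (pcball (x j + dil (r j) z) t) \<le> (1 + ?\<eta>) * L j * t powr s" if "0 < t" "t \<le> r j * \<rho>" for t
          using K[of j] z that rr unfolding S_def regular_set_def by force
        have rp: "0 < r j * \<rho>" using r \<rho> by simp
        have n1: "0 \<le> (1 - ?\<eta>) * L j" "0 \<le> (1 + ?\<eta>) * L j" using L[of j] by (auto simp: field_simps)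
        have "(1 - ?\<eta>) * L j * c * (r j * \<rho>) powr s \<le> ?I" "?I \<le> (1 + ?\<eta>) * L j * c * (r j * \<rho>) powr s"
          using integral_bump_bounds(2,3)[OF sets fin[OF compact_pcball] rp s n1 bd] by (auto simp: c_def)
        then have B: "w j * ((1 - ?\<eta>) * L j * c * (r j * \<rho>) powr s) \<le> \<Lambda> j (bump z \<rho>)"
          "\<Lambda> j (bump z \<rho>) \<le> w j * ((1 + ?\<eta>) * L j * c * (r j * \<rho>) powr s)"
          unfolding \<Lambda>b using w[of j] by (auto intro: mult_left_mono)
        have eq: "w j * (q * L j * c * (r j * \<rho>) powr s) = q * \<rho> powr s" for q
        proof -
          have "w j * (q * L j * c * (r j * \<rho>) powr s) = (w j * (c * L j * r j powr s)) * (q * \<rho> powr s)"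
            using r[of j] \<rho> by (simp add: powr_mult)
          also have "w j * (c * L j * r j powr s) = 1" using c L[of j] r[of j] by (simp add: w_def)
          finally show ?thesis by simp
        qed
        have "?\<eta> * \<rho> powr s \<le> \<epsilon>"
        proof -
          have "?\<eta> * \<rho> powr s \<le> \<rho> powr s / real (Suc j)" by (simp add: divide_left_mono)
          then show ?thesis using elim(1) by linarith
        qed
        then show "\<bar>\<Lambda> j (bump z \<rho>) - \<rho> powr s\<bar> \<le> \<epsilon>"
          using B[unfolded eq] unfolding left_diff_distrib distrib_right by linarith
      qed
    qed
  next
    fix z :: "'n par" and \<rho> \<epsilon> :: real assume \<rho>: "0 < \<rho>" and \<epsilon>: "0 < \<epsilon>"
    show "\<forall>\<^sub>F j in sequentially. (\<forall>y\<in>S j. \<rho> \<le> gnorm (y - z)) \<longrightarrow> \<Lambda> j (bump z \<rho>) \<le> \<epsilon>"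
      using eventually_divide_Suc_less[OF \<epsilon>, of "1 / c"] eventually_le_Suc[of "gnorm z + \<rho>"]
    proof eventually_elim
      case (elim j)
      show ?case
      proof
        assume far: "\<forall>y\<in>S j. \<rho> \<le> gnorm (y - z)"
        let ?B = "pcball (x j) (real (Suc j) * r j) - K j"
        let ?x = "x j + dil (r j) z"
        have rp: "0 < r j * \<rho>" using r \<rho> by simp
        have B_fm: "?B \<in> fmeasurable \<mu>"
        proof (rule fmeasurableI)
          show B: "?B \<in> sets \<mu>" using pcball_sets[OF sets] borel_compact[OF cK] sets by auto
          have "emeasure \<mu> ?B \<le> emeasure \<mu> (pcball (x j) (real (Suc j) * r j))"
            by (rule emeasure_mono[OF Diff_subset pcball_sets[OF sets]])
          then show "emeasure \<mu> ?B < \<infinity>" using fin[OF compact_pcball] by (rule le_less_trans)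
        qed
        \<comment> \<open>The bump misses \<open>K j\<close> because \<open>z\<close> is far from
          \<open>S j\<close>, and lies in the ball of radius \<open>Suc j * r j\<close> by
          \<open>elim(2)\<close>. Its integral is thus at most the small mass left over at the
          density point.\<close>
        have ind: "bump ?x (r j * \<rho>) y \<le> indicator ?B y" for y
        proof (cases "gnorm (y - ?x) < r j * \<rho>")
          case True
          have "gnorm (y - x j) \<le> gnorm (y - ?x) + gnorm (dil (r j) z)"
            using gnorm_triangle[of "y - ?x" "dil (r j) z"] by (simp add: algebra_simps)
          also have "\<dots> \<le> r j * \<rho> + r j * gnorm z" using True r[of j] by (simp add: gnorm_dil)
          also have "\<dots> \<le> real (Suc j) * r j" using mult_left_mono[OF elim(2), of "r j"] r[of j] by (simp add: algebra_simps)
          finally have "y \<in> pcball (x j) (real (Suc j) * r j)" by (simp add: pcball_gnorm)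
          moreover have "y \<notin> K j"
          proof
            assume y: "y \<in> K j"
            define v where "v = dil (1 / r j) (y - x j)"
            have v: "dil (r j) v = y - x j" using r[of j] by (simp add: v_def)
            then have "v \<in> S j" using y by (simp add: S_def)
            then have "r j * \<rho> \<le> r j * gnorm (v - z)" using far r[of j] by (intro mult_left_mono) auto
            also have "\<dots> = gnorm (dil (r j) (v - z))" using r[of j] by (simp add: gnorm_dil)
            also have "dil (r j) (v - z) = y - ?x" by (simp add: dil_diff v)
            finally show False using True by simp
          qed
          ultimately show ?thesis by simp
        qed (use rp in \<open>simp add: bump_eq_0\<close>)
        have "integral\<^sup>L \<mu> (bump ?x (r j * \<rho>)) \<le> integral\<^sup>L \<mu> (indicator ?B)"
          using B_fm by (intro integral_mono ind test_integrable[OF sets fin test_bump[OF rp]]) (auto simp: fmeasurable_def)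
        also have "\<dots> = measure \<mu> ?B" using B_fm by (simp add: fmeasurable_def)
        also have "\<dots> \<le> L j / real (Suc j) * r j powr s" by (rule off)
        finally have "\<Lambda> j (bump z \<rho>) \<le> w j * (L j / real (Suc j) * r j powr s)"
          unfolding \<Lambda>b using w[of j] by (intro mult_left_mono) auto
        also have "\<dots> = 1 / c / real (Suc j)" using c L[of j] r(1)[of j] by (simp add: w_def field_simps del: of_nat_Suc)
        finally show "\<Lambda> j (bump z \<rho>) \<le> \<epsilon>" using elim(1) by simp
      qed
    qed
  qed auto
  then show ?thesis by blast
qed

theorem theorem1p6:
  fixes \<mu> :: "((real ^ 'n) \<times> real) measure" and s :: real
    and A :: "((real ^ 'n) \<times> real) set"
  assumes "s \<ge> 0"
    and "radon_measure (Metric_space.mtopology UNIV pdist) \<mu>"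
    and "A \<in> sets \<mu>" and "emeasure \<mu> A > 0"
    and "\<And>x. x \<in> A \<Longrightarrow>
           \<exists>L>0. ((\<lambda>r. r powr (-s) * measure \<mu> (pcball x r)) \<longlongrightarrow> L) (at_right 0)"
  shows "s \<in> \<int>"
proof -
  have euc: "Metric_space.mtopology UNIV pdist = (euclidean :: ((real ^ 'n) \<times> real) topology)"
    by (rule mtopology_pdist)
  have R: "sets \<mu> = sigma_sets UNIV {U. open U}" "\<And>K. compact K \<Longrightarrow> emeasure \<mu> K < \<infinity>"
    "\<And>B. B \<in> sets \<mu> \<Longrightarrow> emeasure \<mu> B = (INF U\<in>{U. open U \<and> B \<subseteq> U}. emeasure \<mu> U)"
    using assms(2) unfolding radon_measure_def euc by (simp_all add: compactin_euclidean_iff)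
  have "sets \<mu> = sets borel"
    unfolding R(1) borel_def by (rule sets_measure_of[symmetric]) auto
  from exists_uniform[OF this R(2) assms(1) R(3) assms(3,4,5)]
  show ?thesis using uniform_integer_dimension by blast
qed

end
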